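(* Consider the linear-Gaussian sensor design problem (P-LGS) defined in the context, with data $T$, $A_t$, $W_t$, $P_0$, $\Theta_t$, $D_t$. An optimal solution to (P-LGS) can be constructed by solving the following determinant maximization problem with decision variables $P_{t|t},\Pi_t\in\mathbb{S}^{n_t}$ (real symmetric $n_t\times n_t$ matrices), $t=1,\dots,T$, where $P_{0|0}:=P_0$: $$ \begin{aligned} \min\quad & -\sum_{t=1}^T \tfrac12\log\det \Pi_t + c\\ \text{s.t.}\quad & \Pi_t\succ 0,\quad t=1,\dots,T,\\ & P_{t+1|t+1}\preceq A_tP_{t|t}A_t^\top+W_t,\quad t=0,\dots,T-1,\\ & \begin{bmatrix} P_{t|t}-\Pi_t & P_{t|t}A_t^\top\\ A_tP_{t|t} & W_t+A_tP_{t|t}A_t^\top\end{bmatrix}\succeq 0,\quad t=1,\dots,T-1,\\ & \mathrm{Tr}(\Theta_tP_{t|t})\le D_t,\quad t=1,\dots,T,\\ & P_{T|T}=\Pi_T, \end{aligned} $$ where $c=\frac12\log\det(A_0P_{0|0}A_0^\top+W_0)+\sum_{t=1}^{T-1}\frac12\log\det W_t$ is a constant. Precisely: let $\{P_{t|t},\Pi_t\}_{t=1}^T$ be an optimal solution of this problem and put $$\mathsf{SNR}_t = P_{t|t}^{-1}-(A_{t-1}P_{t-1|t-1}A_{t-1}^\top+W_{t-1})^{-1},\qquad t=1,\dots,T.$$ Then, for each $t$, there exist an integer $r_t\ge 0$ and matrices $C_t\in\mathbb{R}^{r_t\times n_t}$, $V_t\in\mathbb{S}^{r_t}_{++}$ with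 $C_t^\top V_t^{-1}C_t=\mathsf{SNR}_t$ (obtainable from a singular value decomposition of $\mathsf{SNR}_t$), and with such a choice of $\{C_t,V_t\}_{t=1}^T$ the composition of the sensor $\mathbf{y}_t=C_t\mathbf{x}_t+\mathbf{v}_t$, $\mathbf{v}_t\sim\mathcal{N}(0,V_t)$, and the estimator $\mathbf{z}_t=\mathbb{E}(\mathbf{x}_t\mid\mathbf{y}_1,\dots,\mathbf{y}_t)$, $t=1,\dots,T$, is an optimal solution to (P-LGS).
   Context: Notation. $\mathbb{S}^n_{++}$ denotes the real symmetric positive definite $n\times n$ matrices; $\succ,\succeq$ denote the Loewner order. For $\Theta\succeq0$, $\|x\|_\Theta=\sqrt{x^\top\Theta x}$. $\mathbf{y}^{t}=(\mathbf{y}_1,\dots,\mathbf{y}_t)$. $I(\cdot;\cdot|\cdot)$ is conditional mutual information (natural logarithm). Source. $T\ge1$ is an integer. $\{\mathbf{x}_t\}$ is the $\mathbb{R}^{n_t}$-valued Gauss-Markov process $\mathbf{x}_{t+1}=A_t\mathbf{x}_t+\mathbf{w}_t$, $t=0,\dots,T-1$, where $A_t\in\mathbb{R}^{n_{t+1}\times n_t}$, and $\mathbf{x}_0\sim\mathcal{N}(0,P_0)$ with $P_0\succ0$ and $\mathbf{w}_t\sim\mathcal{N}(0,W_t)$ with $W_t\succ0$ ($t=0,\dots,T-1$) are mutually independent. Weight matrices $\Theta_t\succeq0$ ($n_t\times n_t$) and real numbers $D_t$, $t=1,\dots,T$, are given. Problem (P-LGS). The design variables are, for each $t=1,\dots,T$,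 a sensor dimension $r_t\in\{0,1,2,\dots\}$ and matrices $C_t\in\mathbb{R}^{r_t\times n_t}$, $V_t\in\mathbb{S}^{r_t}_{++}$ ($r_t=0$ means no observation is made at time $t$, and then $C_t^\top V_t^{-1}C_t$ is read as $0$). Given these, $\mathbf{y}_t=C_t\mathbf{x}_t+\mathbf{v}_t$ with $\mathbf{v}_t\sim\mathcal{N}(0,V_t)$ mutually independent and independent of $\mathbf{x}_0,\mathbf{w}_0,\dots,\mathbf{w}_{T-1}$, and $\mathbf{z}_t=\mathbb{E}(\mathbf{x}_t|\mathbf{y}^t)$ (the Kalman filter). The problem is $$\min\ \sum_{t=1}^T I(\mathbf{x}_t;\mathbf{y}_t|\mathbf{y}^{t-1})\quad\text{s.t.}\quad \mathbb{E}\|\mathbf{x}_t-\mathbf{z}_t\|_{\Theta_t}^2\le D_t,\ t=1,\dots,T.$$ *)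

theory Defs
  imports
    "HOL-Probability.Probability"
    "Jordan_Normal_Form.Determinant"
    "Jordan_Normal_Form.Gauss_Jordan_Elimination"
begin

unbundle no vec_syntax and no inner_syntax

hide_type (open) Finite_Cartesian_Product.vec
hide_const (open) Finite_Cartesian_Product.vec Finite_Cartesian_Product.mat Determinants.det
  Determinants.trace Finite_Cartesian_Product.transpose

text \<open>Dimensions vary with time and, for the sensors, are part of the design, so vectors and
  matrices are those of \<^theory>\<open>Jordan_Normal_Form.Matrix\<close>, whose sizes are values.\<close>

definition pos_def :: "nat \<Rightarrow> real mat \<Rightarrow> bool" where
  "pos_def m A \<longleftrightarrow> A \<in> carrier_mat m m \<and> A\<^sup>T = A \<and>
     (\<forall>v\<in>carrier_vec m. v \<noteq> 0\<^sub>v m \<longrightarrow> 0 < v \<bullet> (A *\<^sub>v v))"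

definition pos_semidef :: "nat \<Rightarrow> real mat \<Rightarrow> bool" where
  "pos_semidef m A \<longleftrightarrow> A \<in> carrier_mat m m \<and> A\<^sup>T = A \<and>
     (\<forall>v\<in>carrier_vec m. 0 \<le> v \<bullet> (A *\<^sub>v v))"

definition loewner_le :: "nat \<Rightarrow> real mat \<Rightarrow> real mat \<Rightarrow> bool" where
  "loewner_le m A B \<longleftrightarrow> pos_semidef m (B - A)"

text \<open>Unspecified for singular matrices; below it is only meaningful on positive definite ones.
  For the empty matrix it is the empty matrix.\<close>
definition matinv :: "real mat \<Rightarrow> real mat" where
  "matinv A = the (mat_inverse A)"

definition mtrace :: "real mat \<Rightarrow> real" where
  "mtrace A = (\<Sum>i<dim_row A. A $$ (i, i))"

definition weighted_norm :: "real mat \<Rightarrow> real Matrix.vec \<Rightarrow> real" where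
  "weighted_norm \<Theta> v = sqrt (v \<bullet> (\<Theta> *\<^sub>v v))"

text \<open>Borel and Lebesgue structure on the vectors of dimension \<open>m\<close>, transported from the
  product of \<open>m\<close> copies of the real line. For \<open>m = 0\<close> this is a single point of mass one.\<close>

definition borel_vec :: "nat \<Rightarrow> real Matrix.vec measure" where
  "borel_vec m = vimage_algebra (carrier_vec m) (\<lambda>v. \<lambda>i\<in>{..<m}. v $ i) (\<Pi>\<^sub>M i\<in>{..<m}. borel)"

definition lborel_vec :: "nat \<Rightarrow> real Matrix.vec measure" where
  "lborel_vec m = distr (\<Pi>\<^sub>M i\<in>{..<m}. lborel) (borel_vec m) (Matrix.vec m)"

definition gaussian_density :: "real mat \<Rightarrow> real Matrix.vec \<Rightarrow> real" where
  "gaussian_density S v =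
     exp (- (v \<bullet> (matinv S *\<^sub>v v)) / 2) / sqrt ((2 * pi) ^ dim_row S * det S)"

text \<open>The law \<open>N(0, S)\<close> on vectors of dimension \<open>m\<close>, for positive definite \<open>S\<close>.\<close>
definition gaussian :: "'a measure \<Rightarrow> nat \<Rightarrow> real mat \<Rightarrow> ('a \<Rightarrow> real Matrix.vec) \<Rightarrow> bool" where
  "gaussian M m S X \<longleftrightarrow>
     distributed M (lborel_vec m) X (\<lambda>v. ennreal (gaussian_density S v))"

text \<open>The mutually independent variables driving the source are indexed as
  \<open>x\<^sub>0, w\<^sub>0, \<dots>, w\<^bsub>T-1\<^esub>\<close>; the \<open>k\<close>-th one has dimension \<open>n k\<close>.\<close>
definition source_driver ::
  "(nat \<Rightarrow> 'a \<Rightarrow> real Matrix.vec) \<Rightarrow> (nat \<Rightarrow> 'a \<Rightarrow> real Matrix.vec) \<Rightarrow> nat \<Rightarrow> 'a \<Rightarrow> real Matrix.vec"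
  where "source_driver x w k = (case k of 0 \<Rightarrow> x 0 | Suc t \<Rightarrow> w t)"

definition gauss_markov_source ::
  "nat \<Rightarrow> (nat \<Rightarrow> nat) \<Rightarrow> (nat \<Rightarrow> real mat) \<Rightarrow> (nat \<Rightarrow> real mat) \<Rightarrow> real mat \<Rightarrow>
   'a measure \<Rightarrow> (nat \<Rightarrow> 'a \<Rightarrow> real Matrix.vec) \<Rightarrow> (nat \<Rightarrow> 'a \<Rightarrow> real Matrix.vec) \<Rightarrow> bool" where
  "gauss_markov_source T n A W P0 M x w \<longleftrightarrow>
     prob_space M \<and>
     gaussian M (n 0) P0 (x 0) \<and>
     (\<forall>t<T. gaussian M (n (Suc t)) (W t) (w t)) \<and>
     prob_space.indep_vars M (\<lambda>k. borel_vec (n k)) (source_driver x w) {..T} \<and>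
     (\<forall>t<T. \<forall>\<omega>\<in>space M. x (Suc t) \<omega> = A t *\<^sub>v x t \<omega> + w t \<omega>)"

text \<open>Only the values at times \<open>1, \<dots>, T\<close> matter. For sensor dimension \<open>0\<close> the matrix \<open>C\<close> has
  no rows, the measurement is the empty vector, and \<open>C\<^sup>T * matinv V * C\<close> is a zero matrix.\<close>
record sensor =
  sdim :: "nat \<Rightarrow> nat"
  sgain :: "nat \<Rightarrow> real mat"
  scov :: "nat \<Rightarrow> real mat"

definition admissible_sensor :: "nat \<Rightarrow> (nat \<Rightarrow> nat) \<Rightarrow> sensor \<Rightarrow> bool" where
  "admissible_sensor T n s \<longleftrightarrow>
     (\<forall>t\<in>{1..T}. sgain s t \<in> carrier_mat (sdim s t) (n t) \<and> pos_def (sdim s t) (scov s t))"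

text \<open>\<open>v\<close> is a measurement noise for \<open>s\<close>: all of \<open>x\<^sub>0\<close>, the \<open>w\<^sub>t\<close> and the \<open>v\<^sub>t\<close> are mutually
  independent.\<close>
definition sensor_noise ::
  "nat \<Rightarrow> (nat \<Rightarrow> nat) \<Rightarrow> 'a measure \<Rightarrow> (nat \<Rightarrow> 'a \<Rightarrow> real Matrix.vec) \<Rightarrow>
   (nat \<Rightarrow> 'a \<Rightarrow> real Matrix.vec) \<Rightarrow> sensor \<Rightarrow> (nat \<Rightarrow> 'a \<Rightarrow> real Matrix.vec) \<Rightarrow> bool" where
  "sensor_noise T n M x w s v \<longleftrightarrow>
     (\<forall>t\<in>{1..T}. gaussian M (sdim s t) (scov s t) (v t)) \<and>
     prob_space.indep_vars M
       (case_sum (\<lambda>k. borel_vec (n k)) (\<lambda>t. borel_vec (sdim s t)))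
       (case_sum (source_driver x w) v) ({..T} <+> {1..T})"

definition measurement ::
  "sensor \<Rightarrow> (nat \<Rightarrow> 'a \<Rightarrow> real Matrix.vec) \<Rightarrow> (nat \<Rightarrow> 'a \<Rightarrow> real Matrix.vec) \<Rightarrow>
   nat \<Rightarrow> 'a \<Rightarrow> real Matrix.vec" where
  "measurement s x v t \<omega> = sgain s t *\<^sub>v x t \<omega> + v t \<omega>"

definition history :: "(nat \<Rightarrow> 'a \<Rightarrow> real Matrix.vec) \<Rightarrow> nat \<Rightarrow> 'a \<Rightarrow> nat \<Rightarrow> real Matrix.vec" where
  "history y k \<omega> = (\<lambda>i\<in>{1..k}. y i \<omega>)"

definition history_space :: "sensor \<Rightarrow> nat \<Rightarrow> (nat \<Rightarrow> real Matrix.vec) measure" where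
  "history_space s k = (\<Pi>\<^sub>M i\<in>{1..k}. borel_vec (sdim s i))"

text \<open>\<open>z\<^sub>t = E(x\<^sub>t | y\<^sub>1, \<dots>, y\<^sub>t)\<close>, componentwise, with respect to the sigma-algebra generated by
  the measurements.\<close>
definition estimate ::
  "(nat \<Rightarrow> nat) \<Rightarrow> 'a measure \<Rightarrow> (nat \<Rightarrow> 'a \<Rightarrow> real Matrix.vec) \<Rightarrow> sensor \<Rightarrow>
   (nat \<Rightarrow> 'a \<Rightarrow> real Matrix.vec) \<Rightarrow> nat \<Rightarrow> 'a \<Rightarrow> real Matrix.vec" where
  "estimate n M x s v t \<omega> = Matrix.vec (n t) (\<lambda>i.
     real_cond_exp M
       (vimage_algebra (space M) (history (measurement s x v) t) (history_space s t))
       (\<lambda>\<omega>'. x t \<omega>' $ i) \<omega>)"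

text \<open>With base \<open>exp 1\<close> this is mutual information in nats. At \<open>t = 1\<close> the conditioning history
  ranges over an empty index set, so the term is \<open>I(x\<^sub>1; y\<^sub>1)\<close>.\<close>
definition lgs_cost ::
  "nat \<Rightarrow> (nat \<Rightarrow> nat) \<Rightarrow> 'a measure \<Rightarrow> (nat \<Rightarrow> 'a \<Rightarrow> real Matrix.vec) \<Rightarrow> sensor \<Rightarrow>
   (nat \<Rightarrow> 'a \<Rightarrow> real Matrix.vec) \<Rightarrow> real" where
  "lgs_cost T n M x s v = (\<Sum>t=1..T.
     prob_space.conditional_mutual_information M (exp 1)
       (borel_vec (n t)) (borel_vec (sdim s t)) (history_space s (t - 1))
       (x t) (measurement s x v t) (history (measurement s x v) (t - 1)))"

definition lgs_feasible ::
  "nat \<Rightarrow> (nat \<Rightarrow> nat) \<Rightarrow> (nat \<Rightarrow> real mat) \<Rightarrow> (nat \<Rightarrow> real) \<Rightarrow> 'a measure \<Rightarrow>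
   (nat \<Rightarrow> 'a \<Rightarrow> real Matrix.vec) \<Rightarrow> sensor \<Rightarrow> (nat \<Rightarrow> 'a \<Rightarrow> real Matrix.vec) \<Rightarrow> bool" where
  "lgs_feasible T n \<Theta> D M x s v \<longleftrightarrow>
     admissible_sensor T n s \<and>
     (\<forall>t\<in>{1..T}.
        (\<integral>\<omega>. (weighted_norm (\<Theta> t) (x t \<omega> - estimate n M x s v t \<omega>))\<^sup>2 \<partial>M) \<le> D t)"

text \<open>\<open>v s\<close> is the measurement noise in use when the design is \<open>s\<close>. No joint law is prescribed for
  the noises of different designs; cost and feasibility of \<open>s\<close> only involve \<open>v s\<close>.\<close>
definition lgs_optimal ::
  "nat \<Rightarrow> (nat \<Rightarrow> nat) \<Rightarrow> (nat \<Rightarrow> real mat) \<Rightarrow> (nat \<Rightarrow> real) \<Rightarrow> 'a measure \<Rightarrow>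
   (nat \<Rightarrow> 'a \<Rightarrow> real Matrix.vec) \<Rightarrow> (sensor \<Rightarrow> nat \<Rightarrow> 'a \<Rightarrow> real Matrix.vec) \<Rightarrow> sensor \<Rightarrow> bool" where
  "lgs_optimal T n \<Theta> D M x v s \<longleftrightarrow>
     lgs_feasible T n \<Theta> D M x s (v s) \<and>
     (\<forall>s'. lgs_feasible T n \<Theta> D M x s' (v s') \<longrightarrow>
        lgs_cost T n M x s (v s) \<le> lgs_cost T n M x s' (v s'))"

text \<open>\<open>P t\<close> is \<open>P\<^bsub>t|t\<^esub>\<close> (with \<open>P 0\<close> fixed to the initial covariance) and \<open>Q t\<close> is \<open>\<Pi>\<^sub>t\<close>.\<close>

definition predicted_cov ::
  "(nat \<Rightarrow> real mat) \<Rightarrow> (nat \<Rightarrow> real mat) \<Rightarrow> (nat \<Rightarrow> real mat) \<Rightarrow> nat \<Rightarrow> real mat" where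
  "predicted_cov A W P t = A t * P t * (A t)\<^sup>T + W t"

definition maxdet_feasible ::
  "nat \<Rightarrow> (nat \<Rightarrow> nat) \<Rightarrow> (nat \<Rightarrow> real mat) \<Rightarrow> (nat \<Rightarrow> real mat) \<Rightarrow> real mat \<Rightarrow>
   (nat \<Rightarrow> real mat) \<Rightarrow> (nat \<Rightarrow> real) \<Rightarrow> (nat \<Rightarrow> real mat) \<Rightarrow> (nat \<Rightarrow> real mat) \<Rightarrow> bool" where
  "maxdet_feasible T n A W P0 \<Theta> D P Q \<longleftrightarrow>
     P 0 = P0 \<and>
     (\<forall>t\<in>{1..T}. P t \<in> carrier_mat (n t) (n t) \<and> (P t)\<^sup>T = P t) \<and>
     (\<forall>t\<in>{1..T}. pos_def (n t) (Q t)) \<and>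
     (\<forall>t<T. loewner_le (n (Suc t)) (P (Suc t)) (predicted_cov A W P t)) \<and>
     (\<forall>t\<in>{1..<T}. pos_semidef (n t + n (Suc t))
        (four_block_mat (P t - Q t)   (P t * (A t)\<^sup>T)
                        (A t * P t)   (W t + A t * P t * (A t)\<^sup>T))) \<and>
     (\<forall>t\<in>{1..T}. mtrace (\<Theta> t * P t) \<le> D t) \<and>
     P T = Q T"

definition maxdet_objective ::
  "nat \<Rightarrow> (nat \<Rightarrow> real mat) \<Rightarrow> (nat \<Rightarrow> real mat) \<Rightarrow> real mat \<Rightarrow> (nat \<Rightarrow> real mat) \<Rightarrow> real" where
  "maxdet_objective T A W P0 Q =
     - (\<Sum>t=1..T. ln (det (Q t)) / 2) +
     (ln (det (A 0 * P0 * (A 0)\<^sup>T + W 0)) / 2 + (\<Sum>t=1..T-1. ln (det (W t)) / 2))"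

definition maxdet_optimal ::
  "nat \<Rightarrow> (nat \<Rightarrow> nat) \<Rightarrow> (nat \<Rightarrow> real mat) \<Rightarrow> (nat \<Rightarrow> real mat) \<Rightarrow> real mat \<Rightarrow>
   (nat \<Rightarrow> real mat) \<Rightarrow> (nat \<Rightarrow> real) \<Rightarrow> (nat \<Rightarrow> real mat) \<Rightarrow> (nat \<Rightarrow> real mat) \<Rightarrow> bool" where
  "maxdet_optimal T n A W P0 \<Theta> D P Q \<longleftrightarrow>
     maxdet_feasible T n A W P0 \<Theta> D P Q \<and>
     (\<forall>P' Q'. maxdet_feasible T n A W P0 \<Theta> D P' Q' \<longrightarrow>
        maxdet_objective T A W P0 Q \<le> maxdet_objective T A W P0 Q')"

text \<open>Only used for \<open>t \<ge> 1\<close>; at \<open>t = 0\<close> the truncated \<open>t - 1\<close> makes it meaningless.\<close>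
definition SNR ::
  "(nat \<Rightarrow> real mat) \<Rightarrow> (nat \<Rightarrow> real mat) \<Rightarrow> (nat \<Rightarrow> real mat) \<Rightarrow> nat \<Rightarrow> real mat" where
  "SNR A W P t = matinv (P t) - matinv (predicted_cov A W P (t - 1))"

end

theory Submission
  imports Defs
begin

text \<open>
  A sensor design influences cost and constraints only through the error covariances of the Kalman
  filter. The filter estimates \<open>x\<^sub>t\<close> with an error that is \<open>N(0, P\<^sub>t)\<close> and independent of the measurements
  \<open>y\<^sub>1, \<dots>, y\<^sub>t\<close> (\<open>kalman_filter\<close>), where \<open>P\<^sub>t\<^sup>-\<^sup>1\<close> is the inverse of the predicted covariance
  \<open>A P A\<^sup>T + W\<close>, taken one step earlier, plus \<open>C\<^sub>t\<^sup>T V\<^sub>t\<^sup>-\<^sup>1 C\<^sub>t\<close>. Hence the weighted mean square error is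
  \<open>Tr(\<Theta>\<^sub>t P\<^sub>t)\<close> (\<open>estimation_error_eq\<close>), and the information cost of step \<open>t\<close> is half the difference between
  the logarithms of the determinants of the predicted covariance and of \<open>P\<^sub>t\<close> (\<open>lgs_cost_eq\<close>). The
  positive definite matrices below the predicted covariance are exactly the posteriors that some sensor
  realizes, and the signal-to-noise ratio determines the sensor up to the choice of \<open>C\<^sub>t\<close> and \<open>V\<^sub>t\<close>
  (\<open>pos_semidef_factorization\<close>).

  What remains is a rearrangement of the cost. The predicted covariance for step \<open>t + 1\<close> is grouped with
  \<open>P\<^sub>t\<close> instead of \<open>P\<^bsub>t+1\<^esub>\<close>. If the transition from \<open>x\<^sub>t\<close> to \<open>x\<^bsub>t+1\<^esub>\<close> is read as one more observation of \<open>x\<^sub>t\<close>,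
  with gain \<open>A\<^sub>t\<close> and noise \<open>W\<^sub>t\<close>, the quotient of the two determinants is the determinant of \<open>W\<^sub>t\<close> divided
  by that of the posterior covariance, called \<open>smoothed_cov\<close> below (\<open>maxdet_objective_smoothed\<close>). By a Schur
  complement, the matrix inequality constrains \<open>\<Pi>\<^sub>t\<close> to lie below this covariance, and the determinant is
  monotone, so replacing \<open>\<Pi>\<^sub>t\<close> by the smoothed covariance never increases the objective
  (\<open>maxdet_objective_smoothed_le\<close>). Therefore the designed sensor costs at most the optimal value of the
  determinant problem, while every feasible sensor yields a feasible point of that problem whose
  objective is its cost (\<open>kalman_maxdet_feasible\<close>).

  The Gaussian calculus comes from one identity, \<open>gaussian_density_factor\<close>: for a signal \<open>e\<close> and an
  observation \<open>u = C e + v\<close>, the product of the densities of \<open>e\<close> and \<open>v\<close> is the product of the densities of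
  the estimation error and of \<open>u\<close>. Integrated, it gives the law of \<open>C e + v\<close> and the independence of error
  and observation, which drive the time and the measurement update of the filter. For one-dimensional
  signals it also compares a covariance with its rank-one updates. Since every positive definite matrix
  arises from a multiple of the identity by rank-one updates (\<open>pos_def_rank_one_induct\<close>), this yields the
  normalization of the densities, and the same induction yields positivity and monotonicity of the
  determinant.
\<close>

section \<open>Positive definite matrices and their inverses\<close>

text \<open>The ring laws with equations between dimensions as premises. The carrier versions have
  sizes as extra variables in their premises; here the simplifier has nothing to guess.\<close>
lemma
  fixes A B C :: "real mat"
  shows mult_assoc_dim: "dim_col A = dim_row B \<Longrightarrow> dim_col B = dim_row C \<Longrightarrow> A * B * C = A * (B * C)"
    and mult_add_dim: "dim_col A = dim_row B \<Longrightarrow> dim_row B = dim_row C \<Longrightarrow> dim_col B = dim_col C \<Longrightarrow>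
          A * (B + C) = A * B + A * C"
    and add_mult_dim: "dim_col A = dim_row C \<Longrightarrow> dim_row A = dim_row B \<Longrightarrow> dim_col A = dim_col B \<Longrightarrow>
          (A + B) * C = A * C + B * C"
    and transpose_mult_dim: "dim_col A = dim_row B \<Longrightarrow> (A * B)\<^sup>T = B\<^sup>T * A\<^sup>T"
    and transpose_add_dim: "dim_row A = dim_row B \<Longrightarrow> dim_col A = dim_col B \<Longrightarrow> (A + B)\<^sup>T = A\<^sup>T + B\<^sup>T"
    and transpose_minus_dim: "dim_row A = dim_row B \<Longrightarrow> dim_col A = dim_col B \<Longrightarrow> (A - B)\<^sup>T = A\<^sup>T - B\<^sup>T"
  using assoc_mult_mat[of A "dim_row A" "dim_col A" B "dim_col B" C "dim_col C"]
    mult_add_distrib_mat[of A "dim_row A" "dim_col A" B "dim_col B" C]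
    add_mult_distrib_mat[of A "dim_row A" "dim_col A" B C "dim_col C"]
    transpose_mult[of A "dim_row A" "dim_col A" B "dim_col B"]
    transpose_add[of A "dim_row A" "dim_col A" B]
    transpose_minus[of A "dim_row A" "dim_col A" B]
  unfolding carrier_mat_def by simp_all

lemma add_comm_dim:
  fixes A B :: "real mat"
  shows "dim_row A = dim_row B \<Longrightarrow> dim_col A = dim_col B \<Longrightarrow> A + B = B + A"
  by (rule eq_matI) auto

lemma
  fixes A B :: "real mat" and v w :: "real Matrix.vec"
  shows mult_mat_vec_assoc_dim: "dim_col A = dim_row B \<Longrightarrow> dim_col B = dim_vec v \<Longrightarrow>
          (A * B) *\<^sub>v v = A *\<^sub>v (B *\<^sub>v v)"
    and mult_vec_add_dim: "dim_col A = dim_vec v \<Longrightarrow> dim_vec v = dim_vec w \<Longrightarrow>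
          A *\<^sub>v (v + w) = A *\<^sub>v v + A *\<^sub>v w"
    and mult_vec_minus_dim: "dim_col A = dim_vec v \<Longrightarrow> dim_vec v = dim_vec w \<Longrightarrow>
          A *\<^sub>v (v - w) = A *\<^sub>v v - A *\<^sub>v w"
    and add_mult_vec_dim: "dim_col A = dim_vec v \<Longrightarrow> dim_row A = dim_row B \<Longrightarrow> dim_col A = dim_col B \<Longrightarrow>
          (A + B) *\<^sub>v v = A *\<^sub>v v + B *\<^sub>v v"
    and minus_mult_vec_dim: "dim_col A = dim_vec v \<Longrightarrow> dim_row A = dim_row B \<Longrightarrow> dim_col A = dim_col B \<Longrightarrow>
          (A - B) *\<^sub>v v = A *\<^sub>v v - B *\<^sub>v v"
  using assoc_mult_mat_vec[of A "dim_row A" "dim_col A" B "dim_col B" v]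
    mult_add_distrib_mat_vec[of A "dim_row A" "dim_col A" v w]
    mult_minus_distrib_mat_vec[of A "dim_row A" "dim_col A" v w]
    add_mult_distrib_mat_vec[of A "dim_row A" "dim_col A" B v]
    minus_mult_distrib_mat_vec[of A "dim_row A" "dim_col A" B v]
  unfolding carrier_mat_def carrier_vec_def by simp_all

lemma
  fixes u v w :: "real Matrix.vec" and A :: "real mat"
  shows scalar_add_right_dim: "dim_vec u = dim_vec v \<Longrightarrow> dim_vec v = dim_vec w \<Longrightarrow> u \<bullet> (v + w) = u \<bullet> v + u \<bullet> w"
    and scalar_add_left_dim: "dim_vec u = dim_vec v \<Longrightarrow> dim_vec v = dim_vec w \<Longrightarrow> (u + v) \<bullet> w = u \<bullet> w + v \<bullet> w"
    and scalar_minus_right_dim: "dim_vec u = dim_vec v \<Longrightarrow> dim_vec v = dim_vec w \<Longrightarrow> u \<bullet> (v - w) = u \<bullet> v - u \<bullet> w"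
    and scalar_minus_left_dim: "dim_vec u = dim_vec v \<Longrightarrow> dim_vec v = dim_vec w \<Longrightarrow> (u - v) \<bullet> w = u \<bullet> w - v \<bullet> w"
    and scalar_comm_dim: "dim_vec u = dim_vec v \<Longrightarrow> u \<bullet> v = v \<bullet> u"
    and transpose_scalar_dim: "dim_col A = dim_vec w \<Longrightarrow> dim_row A = dim_vec v \<Longrightarrow> (A\<^sup>T *\<^sub>v v) \<bullet> w = v \<bullet> (A *\<^sub>v w)"
  using scalar_prod_add_distrib[of u "dim_vec u" v w] add_scalar_prod_distrib[of u "dim_vec u" v w]
    scalar_prod_minus_distrib[of u "dim_vec u" v w] minus_scalar_prod_distrib[of u "dim_vec u" v w]
    comm_scalar_prod[of u "dim_vec u" v] transpose_vec_mult_scalar[of A "dim_row A" "dim_col A" w v]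
  unfolding carrier_mat_def carrier_vec_def mem_Collect_eq by metis+

lemma pos_def_dim:
  assumes "pos_def m A"
  shows "dim_row A = m" "dim_col A = m" "A\<^sup>T = A" "A \<in> carrier_mat m m"
  using assms unfolding pos_def_def by auto

lemma pos_semidef_dim:
  assumes "pos_semidef m A"
  shows "dim_row A = m" "dim_col A = m" "A\<^sup>T = A" "A \<in> carrier_mat m m"
  using assms unfolding pos_semidef_def by auto

lemma pos_def_pos: "pos_def m A \<Longrightarrow> v \<in> carrier_vec m \<Longrightarrow> v \<noteq> 0\<^sub>v m \<Longrightarrow> 0 < v \<bullet> (A *\<^sub>v v)"
  unfolding pos_def_def by auto

lemma pos_semidef_nonneg: "pos_semidef m A \<Longrightarrow> v \<in> carrier_vec m \<Longrightarrow> 0 \<le> v \<bullet> (A *\<^sub>v v)"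
  unfolding pos_semidef_def by auto

lemma pos_def_imp_pos_semidef: assumes "pos_def m A" shows "pos_semidef m A"
  unfolding pos_semidef_def
proof (intro conjI ballI)
  fix v :: "real Matrix.vec" assume v: "v \<in> carrier_vec m"
  show "0 \<le> v \<bullet> (A *\<^sub>v v)"
  proof (cases "v = 0\<^sub>v m")
    case True
    then show ?thesis using pos_def_dim[OF assms] by (simp add: scalar_prod_def)
  next
    case False
    then show ?thesis using pos_def_pos[OF assms v] by simp
  qed
qed (use pos_def_dim[OF assms] in auto)

text \<open>A vector in the kernel would have a vanishing quadratic form, so the determinant is nonzero.\<close>
lemma pos_def_matinv:
  assumes A: "pos_def m A"
  shows "A * matinv A = 1\<^sub>m m" "matinv A * A = 1\<^sub>m m" "dim_row (matinv A) = m" "dim_col (matinv A) = m"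
    "matinv A \<in> carrier_mat m m"
proof -
  have cA: "A \<in> carrier_mat m m" using pos_def_dim[OF A] by simp
  have "det A \<noteq> 0"
  proof
    assume "det A = 0"
    then obtain v where v: "v \<in> carrier_vec m" "v \<noteq> 0\<^sub>v m" "A *\<^sub>v v = 0\<^sub>v m"
      using det_0_iff_vec_prod_zero[OF cA] by auto
    then show False using pos_def_pos[OF A v(1,2)] by simp
  qed
  then have "A \<in> Units (ring_mat TYPE(real) m ())" by (rule det_non_zero_imp_unit[OF cA])
  then obtain B where "mat_inverse A = Some B" using mat_inverse(1)[OF cA, of "()"] by (cases "mat_inverse A") auto
  with mat_inverse(2)[OF cA this]
  show "A * matinv A = 1\<^sub>m m" "matinv A * A = 1\<^sub>m m" "dim_row (matinv A) = m" "dim_col (matinv A) = m"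
    "matinv A \<in> carrier_mat m m"
    unfolding matinv_def by auto
qed

lemma matinv_unique:
  assumes A: "pos_def m A" and B: "B \<in> carrier_mat m m" and AB: "A * B = 1\<^sub>m m"
  shows "matinv A = B"
proof -
  have "matinv A = matinv A * (A * B)" using AB pos_def_matinv[OF A] by simp
  also have "\<dots> = (matinv A * A) * B"
    using pos_def_matinv(3-)[OF A] pos_def_dim[OF A] B by (intro mult_assoc_dim[symmetric]) auto
  also have "\<dots> = B" using pos_def_matinv[OF A] B by simp
  finally show ?thesis .
qed

lemma pos_def_cancel:
  assumes A: "pos_def m A"
  shows "dim_row X = m \<Longrightarrow> A * (matinv A * X) = X" "dim_row X = m \<Longrightarrow> matinv A * (A * X) = X"
    "dim_vec x = m \<Longrightarrow> A *\<^sub>v (matinv A *\<^sub>v x) = x" "dim_vec x = m \<Longrightarrow> matinv A *\<^sub>v (A *\<^sub>v x) = x"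
proof -
  note d = pos_def_matinv[OF A] pos_def_dim[OF A]
  show "A * (matinv A * X) = X" if "dim_row X = m"
    using that by (simp add: mult_assoc_dim[symmetric] d)
  show "matinv A * (A * X) = X" if "dim_row X = m"
    using that by (simp add: mult_assoc_dim[symmetric] d)
  show "A *\<^sub>v (matinv A *\<^sub>v x) = x" if "dim_vec x = m"
  proof -
    have "A *\<^sub>v (matinv A *\<^sub>v x) = (A * matinv A) *\<^sub>v x"
      using that d by (intro mult_mat_vec_assoc_dim[symmetric]) auto
    then show ?thesis unfolding d(1) using carrier_vecI[OF that] by simp
  qed
  show "matinv A *\<^sub>v (A *\<^sub>v x) = x" if "dim_vec x = m"
  proof -
    have "matinv A *\<^sub>v (A *\<^sub>v x) = (matinv A * A) *\<^sub>v x"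
      using that d by (intro mult_mat_vec_assoc_dim[symmetric]) auto
    then show ?thesis unfolding d(2) using carrier_vecI[OF that] by simp
  qed
qed

lemma matinv_symmetric: assumes A: "pos_def m A" shows "(matinv A)\<^sup>T = matinv A"
proof -
  note d = pos_def_matinv[OF A] pos_def_dim[OF A]
  have "A * (matinv A)\<^sup>T = (matinv A * A)\<^sup>T" using transpose_mult_dim[of "matinv A" A] d(3,4,6,8) by simp
  then have "A * (matinv A)\<^sup>T = 1\<^sub>m m" using d by simp
  from matinv_unique[OF A _ this] d show ?thesis by simp
qed

lemma pos_def_inverse: assumes A: "pos_def m A" shows "pos_def m (matinv A)"
  unfolding pos_def_def
proof (intro conjI ballI impI)
  note d = pos_def_matinv[OF A] pos_def_dim[OF A]
  show "matinv A \<in> carrier_mat m m" using d by simp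
  show "(matinv A)\<^sup>T = matinv A" by (rule matinv_symmetric[OF A])
  fix v :: "real Matrix.vec" assume v: "v \<in> carrier_vec m" "v \<noteq> 0\<^sub>v m"
  have Av: "A *\<^sub>v (matinv A *\<^sub>v v) = v" using pos_def_cancel[OF A] v by simp
  have "matinv A *\<^sub>v v \<noteq> 0\<^sub>v m"
  proof
    assume "matinv A *\<^sub>v v = 0\<^sub>v m"
    with Av have "v = A *\<^sub>v 0\<^sub>v m" by simp
    also have "\<dots> = 0\<^sub>v m" using d by (intro eq_vecI) (auto simp: scalar_prod_def)
    finally show False using v by simp
  qed
  then have "0 < (matinv A *\<^sub>v v) \<bullet> (A *\<^sub>v (matinv A *\<^sub>v v))"
    using d v by (intro pos_def_pos[OF A]) auto
  also have "\<dots> = v \<bullet> (matinv A *\<^sub>v v)" unfolding Av using v d by (intro scalar_comm_dim) auto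
  finally show "0 < v \<bullet> (matinv A *\<^sub>v v)" .
qed

lemma matinv_matinv: assumes A: "pos_def m A" shows "matinv (matinv A) = A"
  using matinv_unique[OF pos_def_inverse[OF A]] pos_def_matinv[OF A] pos_def_dim[OF A] by auto

lemma pos_def_add:
  assumes A: "pos_def m A" and B: "pos_semidef m B"
  shows "pos_def m (A + B)" "pos_def m (B + A)"
proof -
  note d = pos_def_dim[OF A] pos_semidef_dim[OF B]
  show *: "pos_def m (A + B)"
    unfolding pos_def_def
  proof (intro conjI ballI impI)
    show "(A + B)\<^sup>T = A + B" using d by (simp add: transpose_add_dim)
    fix v :: "real Matrix.vec" assume v: "v \<in> carrier_vec m" "v \<noteq> 0\<^sub>v m"
    have "v \<bullet> ((A + B) *\<^sub>v v) = v \<bullet> (A *\<^sub>v v) + v \<bullet> (B *\<^sub>v v)"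
      using d v by (simp add: add_mult_vec_dim scalar_add_right_dim)
    then show "0 < v \<bullet> ((A + B) *\<^sub>v v)"
      using pos_def_pos[OF A v] pos_semidef_nonneg[OF B v(1)] by simp
  qed (use d in auto)
  moreover have "A + B = B + A" using d by (intro comm_add_mat) auto
  ultimately show "pos_def m (B + A)" by simp
qed

lemma pos_semidef_congruence:
  assumes B: "pos_semidef m B" and C: "C \<in> carrier_mat r m"
  shows "pos_semidef r (C * B * C\<^sup>T)"
  unfolding pos_semidef_def
proof (intro conjI ballI)
  note d = pos_semidef_dim[OF B] carrier_matD[OF C]
  show "C * B * C\<^sup>T \<in> carrier_mat r r" using d by auto
  show "(C * B * C\<^sup>T)\<^sup>T = C * B * C\<^sup>T" using d by (simp add: transpose_mult_dim mult_assoc_dim)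
  fix v :: "real Matrix.vec" assume v: "v \<in> carrier_vec r"
  have "v \<bullet> ((C * B * C\<^sup>T) *\<^sub>v v) = v \<bullet> (C *\<^sub>v (B *\<^sub>v (C\<^sup>T *\<^sub>v v)))"
    using d v by (simp add: mult_mat_vec_assoc_dim mult_assoc_dim)
  also have "\<dots> = (C\<^sup>T *\<^sub>v v) \<bullet> (B *\<^sub>v (C\<^sup>T *\<^sub>v v))"
    using d v by (simp add: transpose_scalar_dim)
  also have "\<dots> \<ge> 0" using d v by (intro pos_semidef_nonneg[OF B] carrier_vecI) auto
  finally show "0 \<le> v \<bullet> ((C * B * C\<^sup>T) *\<^sub>v v)" .
qed

lemma pos_semidef_congruence':
  assumes B: "pos_semidef r B" and C: "C \<in> carrier_mat r m"
  shows "pos_semidef m (C\<^sup>T * B * C)"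
  using pos_semidef_congruence[OF B, of "C\<^sup>T" m] C by simp

text \<open>Sylvester's identity: both sides are the determinant of the block matrix with rows
  \<open>(1, -X)\<close> and \<open>(Y, 1)\<close>, in which the block \<open>-X\<close> can be eliminated from the left or from the
  right.\<close>
lemma det_one_plus_mult_commute:
  fixes X Y :: "real mat"
  assumes X: "X \<in> carrier_mat m r" and Y: "Y \<in> carrier_mat r m"
  shows "det (1\<^sub>m m + X * Y) = det (1\<^sub>m r + Y * X)"
proof -
  note d = carrier_matD[OF X] carrier_matD[OF Y]
  let ?B = "four_block_mat (1\<^sub>m m) (- X) Y (1\<^sub>m r)"
  have "four_block_mat (1\<^sub>m m) X (0\<^sub>m r m) (1\<^sub>m r) * ?B = four_block_mat (1\<^sub>m m + X * Y) (0\<^sub>m m r) Y (1\<^sub>m r)"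
    using X Y by (subst mult_four_block_mat[of _ m m _ r _ r _ _ m _ r]) auto
  then have 1: "det ?B = det (1\<^sub>m m + X * Y)"
    using X Y det_mult[of "four_block_mat (1\<^sub>m m) X (0\<^sub>m r m) (1\<^sub>m r)" "m + r" ?B]
      det_four_block_mat_lower_left_zero[of "1\<^sub>m m" m X r "0\<^sub>m r m" "1\<^sub>m r"]
      det_four_block_mat_upper_right_zero[of "1\<^sub>m m + X * Y" m "0\<^sub>m m r" r Y "1\<^sub>m r"]
    by auto
  have "?B * four_block_mat (1\<^sub>m m) X (0\<^sub>m r m) (1\<^sub>m r) = four_block_mat (1\<^sub>m m) (0\<^sub>m m r) Y (1\<^sub>m r + Y * X)"
    using X Y by (subst mult_four_block_mat[of _ m m _ r _ r _ _ m _ r])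
      (auto simp: comm_add_mat[of "Y * X" r r])
  then have 2: "det ?B = det (1\<^sub>m r + Y * X)"
    using X Y det_mult[of ?B "m + r" "four_block_mat (1\<^sub>m m) X (0\<^sub>m r m) (1\<^sub>m r)"]
      det_four_block_mat_lower_left_zero[of "1\<^sub>m m" m X r "0\<^sub>m r m" "1\<^sub>m r"]
      det_four_block_mat_upper_right_zero[of "1\<^sub>m m" m "0\<^sub>m m r" r Y "1\<^sub>m r + Y * X"]
    by auto
  show ?thesis using 1 2 by simp
qed

section \<open>Covariance update by a linear observation\<close>

text \<open>A signal \<open>e\<close> with covariance \<open>P\<close> is observed as \<open>u = C e + v\<close>, where the noise \<open>v\<close> has covariance
  \<open>V\<close>. The three matrices are the covariance of \<open>u\<close>, the conditional covariance of \<open>e\<close> given \<open>u\<close> and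
  the matrix that maps \<open>u\<close> to the conditional mean of \<open>e\<close>. The posterior is written in information
  form, where an observation adds \<open>C\<^sup>T V\<^sup>-\<^sup>1 C\<close> to the inverse covariance, because this sum is what
  a signal-to-noise ratio prescribes.\<close>
definition innovation_cov :: "real mat \<Rightarrow> real mat \<Rightarrow> real mat \<Rightarrow> real mat" where
  "innovation_cov P V C = C * P * C\<^sup>T + V"

definition posterior_cov :: "real mat \<Rightarrow> real mat \<Rightarrow> real mat \<Rightarrow> real mat" where
  "posterior_cov P V C = matinv (matinv P + C\<^sup>T * matinv V * C)"

definition kalman_gain :: "real mat \<Rightarrow> real mat \<Rightarrow> real mat \<Rightarrow> real mat" where
  "kalman_gain P V C = posterior_cov P V C * C\<^sup>T * matinv V"

locale linear_observation =
  fixes m r :: nat and P V C :: "real mat"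
  assumes P: "pos_def m P" and V: "pos_def r V" and C: "C \<in> carrier_mat r m"
begin

abbreviation "S \<equiv> innovation_cov P V C"
abbreviation "P' \<equiv> posterior_cov P V C"
abbreviation "K \<equiv> kalman_gain P V C"
abbreviation "L \<equiv> matinv P + C\<^sup>T * matinv V * C"

lemmas dims = pos_def_dim(1-3)[OF P] pos_def_dim(1-3)[OF V] carrier_matD[OF C]
  pos_def_matinv(3,4)[OF P] pos_def_matinv(3,4)[OF V]

lemma pos_def_innovation: "pos_def r S"
  unfolding innovation_cov_def
  by (rule pos_def_add(2)[OF V pos_semidef_congruence[OF pos_def_imp_pos_semidef[OF P] C]])

lemma pos_def_L: "pos_def m L"
  by (rule pos_def_add(1)[OF pos_def_inverse[OF P]
      pos_semidef_congruence'[OF pos_def_imp_pos_semidef[OF pos_def_inverse[OF V]] C]])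

lemma pos_def_posterior: "pos_def m P'"
  unfolding posterior_cov_def by (rule pos_def_inverse[OF pos_def_L])

lemma matinv_posterior: "matinv P' = L"
  unfolding posterior_cov_def by (rule matinv_matinv[OF pos_def_L])

lemmas dims' = dims pos_def_dim(1-3)[OF pos_def_innovation] pos_def_dim(1-3)[OF pos_def_posterior]
   pos_def_matinv(3,4)[OF pos_def_innovation]

lemma gain_dims: "dim_row K = m" "dim_col K = r"
  unfolding kalman_gain_def using dims' by auto

text \<open>Multiplication by the positive definite \<open>L\<close> turns both sides into \<open>C\<^sup>T V\<^sup>-\<^sup>1 S\<close>.\<close>
lemma gain_innovation: "K * S = P * C\<^sup>T"
proof -
  have "L * (P * C\<^sup>T) = C\<^sup>T * (matinv V * S)"
    unfolding innovation_cov_def using dims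
    by (simp add: mult_assoc_dim mult_add_dim add_mult_dim pos_def_cancel[OF P] pos_def_cancel[OF V]
        pos_def_matinv[OF V] add_comm_dim)
  then have "P' * (L * (P * C\<^sup>T)) = P' * (C\<^sup>T * (matinv V * S))" by simp
  moreover have "P' * (L * (P * C\<^sup>T)) = P * C\<^sup>T"
    unfolding posterior_cov_def using dims by (intro pos_def_cancel[OF pos_def_L]) simp
  moreover have "K * S = P' * (C\<^sup>T * (matinv V * S))"
    unfolding kalman_gain_def using dims' by (simp add: mult_assoc_dim)
  ultimately show ?thesis by argo
qed

lemma gain_eq: "K = P * C\<^sup>T * matinv S"
proof -
  have "K = K * (S * matinv S)"
    unfolding pos_def_matinv(1)[OF pos_def_innovation] using gain_dims by simp
  also have "\<dots> = P * C\<^sup>T * matinv S"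
    using dims' gain_dims by (simp add: gain_innovation mult_assoc_dim[symmetric])
  finally show ?thesis .
qed

lemma posterior_gain: "P = P' + K * (C * P)"
proof -
  have "L * P = 1\<^sub>m m + C\<^sup>T * (matinv V * (C * P))"
    using dims by (simp add: mult_assoc_dim add_mult_dim pos_def_matinv[OF P])
  then have "P' * (L * P) = P' * (1\<^sub>m m + C\<^sup>T * (matinv V * (C * P)))" by simp
  moreover have "P' * (L * P) = P"
    unfolding posterior_cov_def using dims by (intro pos_def_cancel[OF pos_def_L]) simp
  moreover have "P' * (1\<^sub>m m + C\<^sup>T * (matinv V * (C * P))) = P' + K * (C * P)"
    unfolding kalman_gain_def using dims' by (simp add: mult_assoc_dim mult_add_dim right_mult_one_mat')
  ultimately show ?thesis by argo
qed

text \<open>Woodbury's formula for the inverse of \<open>L\<close>.\<close>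
lemma posterior_eq: "P' = P - P * C\<^sup>T * matinv S * C * P"
proof -
  have "P' + K * (C * P) - K * (C * P) = P'"
    using dims' gain_dims by (intro eq_matI) auto
  then have "P' = P - K * (C * P)" using posterior_gain by simp
  then show ?thesis unfolding gain_eq using dims' by (simp add: mult_assoc_dim)
qed

text \<open>Woodbury's formula once more, now for \<open>V = S - C P C\<^sup>T\<close>. It holds because both sides agree after
  multiplication by \<open>S\<close>, where \<open>gain_innovation\<close> applies.\<close>
lemma matinv_noise: "matinv V = matinv S + matinv V * C * P' * C\<^sup>T * matinv V"
proof -
  have "(matinv V * C * K) * S = matinv V * C * P * C\<^sup>T"
    using dims' gain_dims by (simp add: mult_assoc_dim gain_innovation)
  also have "1\<^sub>m r + \<dots> = matinv V * S"
    unfolding innovation_cov_def using dims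
    by (simp add: mult_assoc_dim mult_add_dim pos_def_matinv[OF V] add_comm_dim)
  finally have *: "matinv V * S = 1\<^sub>m r + (matinv V * C * K) * S" by simp
  have "matinv V = matinv V * S * matinv S"
    using dims' by (simp add: mult_assoc_dim pos_def_matinv[OF pos_def_innovation] right_mult_one_mat')
  also have "\<dots> = matinv S + matinv V * C * K"
    unfolding * using dims' gain_dims
    by (simp add: mult_assoc_dim add_mult_dim pos_def_matinv[OF pos_def_innovation] right_mult_one_mat')
  also have "matinv V * C * K = matinv V * C * P' * C\<^sup>T * matinv V"
    using dims' by (simp add: kalman_gain_def mult_assoc_dim)
  finally show ?thesis .
qed

text \<open>The joint density of signal and observation factors in two ways, and this equation compares the
  normalizing constants. Algebraically, Sylvester's identity gives
  \<open>det (L P) = det (V\<^sup>-\<^sup>1 S)\<close>.\<close>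
lemma det_posterior_innovation: "det P * det V = det P' * det S"
proof -
  have *: "det L * det P' = 1"
    using pos_def_matinv[OF pos_def_L] pos_def_dim(4)[OF pos_def_L]
    unfolding posterior_cov_def by (metis det_mult det_one)
  have V1: "det V * det (matinv V) = 1"
    using pos_def_matinv[OF V] pos_def_dim(4)[OF V] by (metis det_mult det_one)
  have "det L * det P = det (1\<^sub>m m + C\<^sup>T * (matinv V * (C * P)))"
    using dims pos_def_dim(4)[OF pos_def_L] pos_def_dim(4)[OF P]
    by (subst det_mult[symmetric, of _ m]) (auto simp: mult_assoc_dim add_mult_dim pos_def_matinv[OF P])
  also have "\<dots> = det (1\<^sub>m r + (matinv V * (C * P)) * C\<^sup>T)"
    using dims by (intro det_one_plus_mult_commute) auto
  also have "1\<^sub>m r + (matinv V * (C * P)) * C\<^sup>T = matinv V * S"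
    unfolding innovation_cov_def using dims
    by (simp add: mult_assoc_dim mult_add_dim pos_def_matinv[OF V] add_comm_dim)
  also have "det \<dots> = det (matinv V) * det S"
    using pos_def_matinv(5)[OF V] pos_def_dim(4)[OF pos_def_innovation] by (rule det_mult)
  finally have LP: "det L * det P = det (matinv V) * det S" .
  have "det P * det V = (det L * det P') * det P * det V" using * by simp
  also have "\<dots> = det P' * det V * (det L * det P)" by simp
  also have "\<dots> = det P' * (det V * det (matinv V)) * det S" unfolding LP by simp
  finally show ?thesis using V1 by simp
qed

text \<open>Both sides are quadratic in \<open>e\<close> with leading matrix \<open>L\<close>. The mixed terms agree because
  \<open>L K u = C\<^sup>T V\<^sup>-\<^sup>1 u\<close>, and the terms in \<open>u\<close> alone agree by \<open>matinv_noise\<close>.\<close>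
lemma complete_square:
  assumes e: "dim_vec e = m" and u: "dim_vec u = r"
  shows "e \<bullet> (matinv P *\<^sub>v e) + (u - C *\<^sub>v e) \<bullet> (matinv V *\<^sub>v (u - C *\<^sub>v e)) =
    (e - K *\<^sub>v u) \<bullet> (matinv P' *\<^sub>v (e - K *\<^sub>v u)) + u \<bullet> (matinv S *\<^sub>v u)"
proof -
  define b where "b = C\<^sup>T *\<^sub>v (matinv V *\<^sub>v u)"
  have [simp]: "dim_vec b = m" using dims by (simp add: b_def)
  note d = e u dims' gain_dims
  have Ku: "K *\<^sub>v u = P' *\<^sub>v b"
    using d by (simp add: kalman_gain_def b_def mult_mat_vec_assoc_dim mult_assoc_dim)
  have LKu: "L *\<^sub>v (P' *\<^sub>v b) = b"
    unfolding posterior_cov_def by (intro pos_def_cancel[OF pos_def_L]) simp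
  have Lsym: "L\<^sup>T = L" "dim_row L = m" "dim_col L = m" using pos_def_dim[OF pos_def_L] by auto
  have "(e - P' *\<^sub>v b) \<bullet> (L *\<^sub>v (e - P' *\<^sub>v b))
     = e \<bullet> (L *\<^sub>v e) - e \<bullet> b - (P' *\<^sub>v b) \<bullet> (L *\<^sub>v e) + (P' *\<^sub>v b) \<bullet> b"
    using d Lsym by (simp add: mult_vec_minus_dim scalar_minus_left_dim scalar_minus_right_dim LKu)
  also have "(P' *\<^sub>v b) \<bullet> (L *\<^sub>v e) = e \<bullet> b"
  proof -
    have "(P' *\<^sub>v b) \<bullet> (L *\<^sub>v e) = (L\<^sup>T *\<^sub>v (P' *\<^sub>v b)) \<bullet> e"
      using Lsym d by (intro transpose_scalar_dim[symmetric]) auto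
    then show ?thesis using Lsym LKu d by (simp add: scalar_comm_dim)
  qed
  also have "(P' *\<^sub>v b) \<bullet> b = u \<bullet> (matinv V *\<^sub>v u) - u \<bullet> (matinv S *\<^sub>v u)"
  proof -
    have "u \<bullet> (matinv V *\<^sub>v u) = u \<bullet> ((matinv S + matinv V * C * P' * C\<^sup>T * matinv V) *\<^sub>v u)"
      using matinv_noise by simp
    also have "\<dots> = u \<bullet> (matinv S *\<^sub>v u) + u \<bullet> (matinv V *\<^sub>v (C *\<^sub>v (P' *\<^sub>v b)))"
      using d by (simp add: add_mult_vec_dim mult_mat_vec_assoc_dim scalar_add_right_dim b_def mult_assoc_dim)
    also have "u \<bullet> (matinv V *\<^sub>v (C *\<^sub>v (P' *\<^sub>v b))) = b \<bullet> (P' *\<^sub>v b)"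
    proof -
      have "u \<bullet> (matinv V *\<^sub>v (C *\<^sub>v (P' *\<^sub>v b))) = (matinv V *\<^sub>v u) \<bullet> (C *\<^sub>v (P' *\<^sub>v b))"
        using d transpose_scalar_dim[of "matinv V" "C *\<^sub>v (P' *\<^sub>v b)" u] by (simp add: matinv_symmetric[OF V])
      also have "\<dots> = b \<bullet> (P' *\<^sub>v b)"
        unfolding b_def using d by (intro transpose_scalar_dim[symmetric]) auto
      finally show ?thesis .
    qed
    finally show ?thesis using d by (simp add: scalar_comm_dim)
  qed
  finally have R: "(e - P' *\<^sub>v b) \<bullet> (L *\<^sub>v (e - P' *\<^sub>v b)) + u \<bullet> (matinv S *\<^sub>v u)
     = e \<bullet> (L *\<^sub>v e) - 2 * (e \<bullet> b) + u \<bullet> (matinv V *\<^sub>v u)" by simp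
  have eL: "e \<bullet> (L *\<^sub>v e) = e \<bullet> (matinv P *\<^sub>v e) + (C *\<^sub>v e) \<bullet> (matinv V *\<^sub>v (C *\<^sub>v e))"
    using d transpose_scalar_dim[of "C\<^sup>T" "matinv V *\<^sub>v (C *\<^sub>v e)" e]
    by (simp add: add_mult_vec_dim mult_mat_vec_assoc_dim scalar_add_right_dim mult_assoc_dim)
  have eb: "e \<bullet> b = (C *\<^sub>v e) \<bullet> (matinv V *\<^sub>v u)"
    using d transpose_scalar_dim[of "C\<^sup>T" "matinv V *\<^sub>v u" e] by (simp add: b_def)
  have eb': "u \<bullet> (matinv V *\<^sub>v (C *\<^sub>v e)) = e \<bullet> b"
    using d transpose_scalar_dim[of "matinv V" "C *\<^sub>v e" u] by (simp add: eb matinv_symmetric[OF V] scalar_comm_dim)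
  have "(u - C *\<^sub>v e) \<bullet> (matinv V *\<^sub>v (u - C *\<^sub>v e)) =
     u \<bullet> (matinv V *\<^sub>v u) - 2 * (e \<bullet> b) + (C *\<^sub>v e) \<bullet> (matinv V *\<^sub>v (C *\<^sub>v e))"
    using d eb eb' by (simp add: mult_vec_minus_dim scalar_minus_left_dim scalar_minus_right_dim)
  then show ?thesis unfolding Ku matinv_posterior using R eL by simp
qed

end

section \<open>Spectral decomposition and rank-one updates\<close>

lemma scalar_mult_mat_vec_sum:
  fixes S :: "real mat"
  assumes "S \<in> carrier_mat n m" "v \<in> carrier_vec n" "w \<in> carrier_vec m"
  shows "v \<bullet> (S *\<^sub>v w) = (\<Sum>i<n. \<Sum>j<m. v $ i * S $$ (i, j) * w $ j)"
  using assms by (auto simp: scalar_prod_def mult_mat_vec_def row_def sum_distrib_left atLeast0LessThan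
      mult.assoc intro!: sum.cong)

lemma scalar_self_sum: "v \<in> carrier_vec n \<Longrightarrow> v \<bullet> v = (\<Sum>i<n. (v $ i)\<^sup>2)" for v :: "real Matrix.vec"
  by (auto simp: scalar_prod_def atLeast0LessThan power2_eq_square)

lemma scalar_self_zero: "v \<in> carrier_vec n \<Longrightarrow> v \<bullet> v = 0 \<longleftrightarrow> v = 0\<^sub>v n" for v :: "real Matrix.vec"
  by (auto simp: scalar_self_sum sum_nonneg_eq_0_iff)

lemma mult_vec_smult_dim: "dim_col A = dim_vec v \<Longrightarrow> A *\<^sub>v (k \<cdot>\<^sub>v v) = k \<cdot>\<^sub>v (A *\<^sub>v v)" for A :: "real mat"
  using mult_mat_vec[of A "dim_row A" "dim_col A" v k] unfolding carrier_mat_def carrier_vec_def by simp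

lemma smult_one_mult_vec:
  assumes "v \<in> carrier_vec n"
  shows "(c \<cdot>\<^sub>m 1\<^sub>m n) *\<^sub>v v = c \<cdot>\<^sub>v (v :: real Matrix.vec)"
proof (rule eq_vecI)
  fix i assume "i < dim_vec (c \<cdot>\<^sub>v v)"
  then have i: "i < n" using assms by simp
  have "Matrix.row (c \<cdot>\<^sub>m 1\<^sub>m n) i = c \<cdot>\<^sub>v unit_vec n i" using i by (intro eq_vecI) auto
  then show "((c \<cdot>\<^sub>m 1\<^sub>m n) *\<^sub>v v) $ i = (c \<cdot>\<^sub>v v) $ i" using i assms by simp
qed (use assms in auto)

text \<open>The unit sphere is realized by functions on the natural numbers that vanish from \<open>n\<close> on. There
  it is a closed subset of a product of compact intervals, so a continuous function attains its
  maximum.\<close>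
lemma quadratic_form_maximizer:
  fixes S :: "real mat"
  assumes S: "S \<in> carrier_mat n n" and n: "0 < n"
  obtains u where "u \<in> carrier_vec n" "u \<bullet> u = 1"
    "\<And>v. v \<in> carrier_vec n \<Longrightarrow> v \<bullet> (S *\<^sub>v v) \<le> (u \<bullet> (S *\<^sub>v u)) * (v \<bullet> v)"
proof -
  define B :: "nat \<Rightarrow> real set" where "B i = (if i < n then {-1..1} else {0})" for i
  define K where "K = (\<Pi>\<^sub>E i\<in>UNIV. B i) \<inter> {f. (\<Sum>i<n. (f i)\<^sup>2) = 1}"
  define g where "g f = (\<Sum>i<n. \<Sum>j<n. f i * S $$ (i, j) * f j)" for f :: "nat \<Rightarrow> real"
  have "compactin (product_topology (\<lambda>i::nat. euclidean :: real topology) UNIV) (\<Pi>\<^sub>E i\<in>UNIV. B i)"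
    unfolding compactin_PiE by (auto simp: B_def)
  then have "compact (\<Pi>\<^sub>E i\<in>UNIV. B i)" by (simp add: euclidean_product_topology)
  moreover have "closed {f::nat \<Rightarrow> real. (\<Sum>i<n. (f i)\<^sup>2) = 1}"
    by (intro closed_Collect_eq continuous_intros continuous_on_product_coordinates)
  ultimately have K: "compact K" unfolding K_def by (rule compact_Int_closed)
  have g: "continuous_on K g" unfolding g_def
    by (intro continuous_intros continuous_on_subset[OF continuous_on_product_coordinates]) auto
  have unit: "\<exists>f\<in>K. g f * (v \<bullet> v) = v \<bullet> (S *\<^sub>v v)"
    if v: "v \<in> carrier_vec n" "v \<bullet> v \<noteq> 0" for v
  proof
    define N where "N = sqrt (v \<bullet> v)"
    define f where "f i = (if i < n then v $ i / N else 0)" for i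
    have pos: "0 < v \<bullet> v" using v by (simp add: scalar_self_sum sum_nonneg order_less_le)
    then have N: "0 < N" "N * N = v \<bullet> v" by (auto simp: N_def)
    have "\<bar>v $ i\<bar> \<le> N" if "i < n" for i
    proof -
      have "(v $ i)\<^sup>2 \<le> v \<bullet> v" unfolding scalar_self_sum[OF v(1)]
        using that by (intro member_le_sum) auto
      then show ?thesis unfolding N_def by (simp add: real_le_rsqrt abs_le_square_iff real_le_rsqrt)
    qed
    then have "- N \<le> v $ i" "v $ i \<le> N" if "i < n" for i
      using that by (auto simp: abs_le_iff minus_le_iff)
    then have "f \<in> (\<Pi>\<^sub>E i\<in>UNIV. B i)"
      using N by (auto simp: f_def B_def divide_simps)
    moreover have "(\<Sum>i<n. (f i)\<^sup>2) = 1"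
    proof -
      have "(\<Sum>i<n. (f i)\<^sup>2) = (\<Sum>i<n. (v $ i)\<^sup>2 / (N * N))"
        by (intro sum.cong) (auto simp: f_def power2_eq_square)
      also have "\<dots> = v \<bullet> v / (N * N)" by (simp add: scalar_self_sum[OF v(1)] sum_divide_distrib)
      finally show ?thesis using N pos by simp
    qed
    ultimately show "f \<in> K" by (simp add: K_def)
    have "g f = (\<Sum>i<n. \<Sum>j<n. (v $ i * S $$ (i, j) * v $ j) / (N * N))"
      unfolding g_def by (intro sum.cong) (auto simp: f_def)
    also have "\<dots> = (v \<bullet> (S *\<^sub>v v)) / (v \<bullet> v)"
      unfolding scalar_mult_mat_vec_sum[OF S v(1) v(1)] N by (simp add: sum_divide_distrib)
    finally show "g f * (v \<bullet> v) = v \<bullet> (S *\<^sub>v v)" using pos by simp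
  qed
  have "K \<noteq> {}"
    using unit[of "unit_vec n 0"] n by auto
  then obtain f where f: "f \<in> K" "\<And>h. h \<in> K \<Longrightarrow> g h \<le> g f"
    using continuous_attains_sup[OF K _ g] by auto
  define u where "u = Matrix.vec n f"
  have u: "u \<in> carrier_vec n" by (simp add: u_def)
  have "u \<bullet> (S *\<^sub>v u) = g f"
    unfolding scalar_mult_mat_vec_sum[OF S u u] g_def by (auto simp: u_def intro!: sum.cong)
  moreover have "u \<bullet> u = 1"
    using f(1) unfolding scalar_self_sum[OF u] K_def by (auto simp: u_def)
  moreover have "v \<bullet> (S *\<^sub>v v) \<le> g f * (v \<bullet> v)" if v: "v \<in> carrier_vec n" for v
  proof (cases "v \<bullet> v = 0")
    case True
    then have "v = 0\<^sub>v n" using scalar_self_zero[OF v] by simp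
    then show ?thesis using S by simp
  next
    case False
    then obtain h where "h \<in> K" "g h * (v \<bullet> v) = v \<bullet> (S *\<^sub>v v)" using unit[OF v] by auto
    then show ?thesis using f(2)[of h] v
      by (metis mult_right_mono scalar_self_sum sum_nonneg zero_le_power2)
  qed
  ultimately show thesis using that[OF u] by simp
qed

text \<open>Otherwise the form would be negative at \<open>u - t N u\<close> for small positive \<open>t\<close>.\<close>
lemma pos_semidef_null:
  assumes N: "pos_semidef n N" and u: "u \<in> carrier_vec n" and 0: "u \<bullet> (N *\<^sub>v u) = 0"
  shows "N *\<^sub>v u = 0\<^sub>v n"
proof (rule ccontr)
  note d = pos_semidef_dim[OF N]
  define w where "w = N *\<^sub>v u"
  have w: "w \<in> carrier_vec n" using d u by (simp add: w_def)
  assume "N *\<^sub>v u \<noteq> 0\<^sub>v n"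
  then have "w \<bullet> w \<noteq> 0" using scalar_self_zero[OF w] by (simp add: w_def)
  then have a: "0 < w \<bullet> w" using w by (simp add: scalar_self_sum sum_nonneg order_less_le)
  define b where "b = w \<bullet> (N *\<^sub>v w)"
  have b: "0 \<le> b" unfolding b_def by (rule pos_semidef_nonneg[OF N w])
  \<comment> \<open>The form at \<open>u - t w\<close> is minimal for \<open>t = (w \<bullet> w) / b\<close>; the added 1 covers \<open>b = 0\<close>.\<close>
  define t where "t = (w \<bullet> w) / (b + 1)"
  have uw: "u \<bullet> (N *\<^sub>v w) = w \<bullet> w"
    using transpose_scalar_dim[of N w u] d u w by (simp add: w_def)
  have "(u - t \<cdot>\<^sub>v w) \<bullet> (N *\<^sub>v (u - t \<cdot>\<^sub>v w)) = t\<^sup>2 * b - 2 * t * (w \<bullet> w)"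
    using d u w 0 uw
    by (simp add: mult_vec_minus_dim scalar_minus_left_dim scalar_minus_right_dim mult_vec_smult_dim
        w_def[symmetric]
        b_def[symmetric] power2_eq_square algebra_simps)
  moreover have "0 \<le> (u - t \<cdot>\<^sub>v w) \<bullet> (N *\<^sub>v (u - t \<cdot>\<^sub>v w))"
    using u w by (intro pos_semidef_nonneg[OF N]) auto
  ultimately have "2 * t * (w \<bullet> w) \<le> t * (t * b)" by (simp add: power2_eq_square)
  moreover have "t > 0" using a b by (simp add: t_def)
  ultimately have "2 * (w \<bullet> w) \<le> t * b" by (simp add: mult.assoc)
  also have "t * b = (w \<bullet> w) * (b / (b + 1))" by (simp add: t_def)
  also have "\<dots> \<le> (w \<bullet> w) * 1" using a b by (intro mult_left_mono) auto
  finally show False using a by simp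
qed

definition outer_sum :: "nat \<Rightarrow> (nat \<Rightarrow> real Matrix.vec) \<Rightarrow> (nat \<Rightarrow> real) \<Rightarrow> nat \<Rightarrow> real mat" where
  "outer_sum n u l k = mat n n (\<lambda>(a, b). \<Sum>i<k. l i * u i $ a * u i $ b)"

definition orthonormal_family :: "nat \<Rightarrow> (nat \<Rightarrow> real Matrix.vec) \<Rightarrow> nat \<Rightarrow> bool" where
  "orthonormal_family n u k \<longleftrightarrow> (\<forall>i<k. u i \<in> carrier_vec n) \<and>
     (\<forall>i<k. \<forall>j<k. u i \<bullet> u j = (if i = j then 1 else 0))"

lemma orthonormal_family_gram:
  assumes "orthonormal_family n u k"
  shows "mat k n (\<lambda>(i, a). u i $ a) * (mat k n (\<lambda>(i, a). u i $ a))\<^sup>T = 1\<^sub>m k"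
proof (rule eq_matI)
  fix i j assume "i < dim_row (1\<^sub>m k)" "j < dim_col (1\<^sub>m k)"
  then have ij: "i < k" "j < k" by auto
  then have "dim_vec (u j) = n" using assms by (simp add: orthonormal_family_def)
  then have "(mat k n (\<lambda>(i, a). u i $ a) * (mat k n (\<lambda>(i, a). u i $ a))\<^sup>T) $$ (i, j) = u i \<bullet> u j"
    using ij by (simp add: scalar_prod_def)
  then show "(mat k n (\<lambda>(i, a). u i $ a) * (mat k n (\<lambda>(i, a). u i $ a))\<^sup>T) $$ (i, j) = 1\<^sub>m k $$ (i, j)"
    using assms ij by (simp add: orthonormal_family_def)
qed auto

text \<open>Let the rows of \<open>C\<close> be the given vectors. Bessel's inequality for the unit vectors bounds the sum
  of squares in each of the \<open>n\<close> columns by 1, while the sum of all squares is \<open>k\<close>.\<close>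
lemma orthonormal_family_card:
  assumes "orthonormal_family n u k"
  shows "k \<le> n"
proof -
  define C where "C = mat k n (\<lambda>(i, a). u i $ a)"
  have C: "C \<in> carrier_mat k n" by (simp add: C_def)
  have CC: "C * C\<^sup>T = 1\<^sub>m k" unfolding C_def by (rule orthonormal_family_gram[OF assms])
  have bessel: "(\<Sum>i<k. (C $$ (i, a))\<^sup>2) \<le> 1" if a: "a < n" for a
  proof -
    define e where "e = (unit_vec n a :: real Matrix.vec)"
    have e: "e \<in> carrier_vec n" "e \<bullet> e = 1" using a by (auto simp: e_def)
    define c where "c = C *\<^sub>v e"
    have c: "c \<in> carrier_vec k" using C e by (simp add: c_def)
    have "0 \<le> (e - C\<^sup>T *\<^sub>v c) \<bullet> (e - C\<^sup>T *\<^sub>v c)"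
      using e c C by (subst scalar_self_sum[of _ n]) (auto intro: sum_nonneg)
    also have "\<dots> = e \<bullet> e - 2 * (c \<bullet> c) + (C\<^sup>T *\<^sub>v c) \<bullet> (C\<^sup>T *\<^sub>v c)"
      using C e c transpose_scalar_dim[of C e c] scalar_comm_dim[of e "C\<^sup>T *\<^sub>v c"]
      by (simp add: scalar_minus_left_dim scalar_minus_right_dim c_def[symmetric])
    also have "(C\<^sup>T *\<^sub>v c) \<bullet> (C\<^sup>T *\<^sub>v c) = c \<bullet> ((C * C\<^sup>T) *\<^sub>v c)"
      using C c by (subst transpose_scalar_dim) (auto simp: mult_mat_vec_assoc_dim)
    also have "\<dots> = c \<bullet> c" unfolding CC using c by simp
    finally have "c \<bullet> c \<le> 1" using e by simp
    also have "c \<bullet> c = (\<Sum>i<k. (C $$ (i, a))\<^sup>2)"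
      unfolding scalar_self_sum[OF c] using C a by (intro sum.cong) (auto simp: c_def e_def)
    finally show ?thesis .
  qed
  have "real k = (\<Sum>i<k. (C * C\<^sup>T) $$ (i, i))" by (simp add: CC)
  also have "\<dots> = (\<Sum>i<k. \<Sum>a<n. (C $$ (i, a))\<^sup>2)"
    using C by (intro sum.cong) (auto simp: scalar_prod_def power2_eq_square atLeast0LessThan intro!: sum.cong)
  also have "\<dots> = (\<Sum>a<n. \<Sum>i<k. (C $$ (i, a))\<^sup>2)" by (rule sum.swap)
  also have "\<dots> \<le> (\<Sum>a<n. 1)" by (intro sum_mono bessel) auto
  finally show ?thesis by simp
qed

text \<open>A maximizer \<open>u\<close> of the form with maximum \<open>c\<close> is an eigenvector, because \<open>c 1 - R\<close> is positive
  semidefinite and its form vanishes at \<open>u\<close>. Subtracting \<open>c u u\<^sup>T\<close> leaves a positive semidefinite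
  matrix, because its form at \<open>v\<close> is the form of \<open>R\<close> at the part of \<open>v\<close> orthogonal to \<open>u\<close>.\<close>
lemma pos_semidef_top_eigenvector:
  assumes R: "pos_semidef n R" and nz: "R \<noteq> 0\<^sub>m n n"
  obtains u c where "u \<in> carrier_vec n" "u \<bullet> u = 1" "0 < c" "R *\<^sub>v u = c \<cdot>\<^sub>v u"
    "pos_semidef n (R - mat n n (\<lambda>(a, b). c * u $ a * u $ b))"
proof -
  note d = pos_semidef_dim[OF R]
  have n: "0 < n" using nz d by (cases n) auto
  obtain u where u: "u \<in> carrier_vec n" "u \<bullet> u = 1"
    and max: "\<And>v. v \<in> carrier_vec n \<Longrightarrow> v \<bullet> (R *\<^sub>v v) \<le> (u \<bullet> (R *\<^sub>v u)) * (v \<bullet> v)"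
    using quadratic_form_maximizer[OF d(4) n] by blast
  define c where "c = u \<bullet> (R *\<^sub>v u)"
  have c0: "0 \<le> c" unfolding c_def by (rule pos_semidef_nonneg[OF R u(1)])
  have "c \<noteq> 0"
  proof
    assume "c = 0"
    then have "v \<bullet> (R *\<^sub>v v) = 0" if "v \<in> carrier_vec n" for v
      using max[OF that] pos_semidef_nonneg[OF R that] by (simp add: c_def)
    then have "R *\<^sub>v v = 0\<^sub>v n" if "v \<in> carrier_vec n" for v
      using pos_semidef_null[OF R that] that by simp
    then have z: "R *\<^sub>v unit_vec n j = 0\<^sub>v n" for j by simp
    have "R = 0\<^sub>m n n"
    proof (rule eq_matI)
      fix i j assume "i < dim_row (0\<^sub>m n n)" "j < dim_col (0\<^sub>m n n)"
      then have ij: "i < n" "j < n" by auto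
      then have "(R *\<^sub>v unit_vec n j) $ i = R $$ (i, j)" using d by simp
      then show "R $$ (i, j) = 0\<^sub>m n n $$ (i, j)" using ij by (simp add: z)
    qed (use d in auto)
    then show False using nz by simp
  qed
  then have c: "0 < c" using c0 by simp
  define N where "N = c \<cdot>\<^sub>m 1\<^sub>m n - R"
  have Nv: "N *\<^sub>v v = c \<cdot>\<^sub>v v - R *\<^sub>v v" if "v \<in> carrier_vec n" for v
    using d that by (simp add: N_def minus_mult_vec_dim smult_one_mult_vec)
  have N: "pos_semidef n N"
    unfolding pos_semidef_def
  proof (intro conjI ballI)
    show "N \<in> carrier_mat n n" unfolding N_def using d(4) by (rule minus_carrier_mat)
    have "(c \<cdot>\<^sub>m 1\<^sub>m n)\<^sup>T = c \<cdot>\<^sub>m 1\<^sub>m n" by (intro eq_matI) auto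
    then show "N\<^sup>T = N" using d by (simp add: N_def transpose_minus_dim)
    fix v :: "real Matrix.vec" assume v: "v \<in> carrier_vec n"
    then show "0 \<le> v \<bullet> (N *\<^sub>v v)" using max[OF v] d unfolding Nv[OF v]
      by (simp add: scalar_minus_right_dim c_def)
  qed
  have "N *\<^sub>v u = 0\<^sub>v n"
    using u d by (intro pos_semidef_null[OF N]) (auto simp: Nv scalar_minus_right_dim c_def)
  then have "c \<cdot>\<^sub>v u - R *\<^sub>v u = 0\<^sub>v n" by (simp add: Nv u)
  have Ru: "R *\<^sub>v u = c \<cdot>\<^sub>v u"
  proof (rule eq_vecI)
    fix i assume "i < dim_vec (c \<cdot>\<^sub>v u)"
    then have i: "i < n" using u by simp
    then have "(c \<cdot>\<^sub>v u - R *\<^sub>v u) $ i = 0" using \<open>c \<cdot>\<^sub>v u - R *\<^sub>v u = 0\<^sub>v n\<close> by simp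
    then show "(R *\<^sub>v u) $ i = (c \<cdot>\<^sub>v u) $ i" using i u d by simp
  qed (use u d in auto)
  define G where "G = mat n n (\<lambda>(a, b). c * u $ a * u $ b)"
  have Gv: "G *\<^sub>v v = (c * (u \<bullet> v)) \<cdot>\<^sub>v u" if "v \<in> carrier_vec n" for v
    using that u by (intro eq_vecI) (auto simp: G_def scalar_prod_def sum_distrib_left sum_distrib_right
        mult_ac intro!: sum.cong)
  have "pos_semidef n (R - G)"
    unfolding pos_semidef_def
  proof (intro conjI ballI)
    show "R - G \<in> carrier_mat n n" unfolding G_def by (rule minus_carrier_mat) simp
    have "G\<^sup>T = G" by (intro eq_matI) (auto simp: G_def)
    then show "(R - G)\<^sup>T = R - G" using d by (simp add: transpose_minus_dim G_def)
    fix v :: "real Matrix.vec" assume v: "v \<in> carrier_vec n"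
    define t where "t = u \<bullet> v"
    have tv: "v \<bullet> u = t" using u v by (simp add: t_def scalar_comm_dim)
    have uv: "u \<bullet> (R *\<^sub>v v) = c * t"
      using transpose_scalar_dim[of R v u] d u v by (simp add: Ru t_def)
    have "0 \<le> (v - t \<cdot>\<^sub>v u) \<bullet> (R *\<^sub>v (v - t \<cdot>\<^sub>v u))"
      using u v by (intro pos_semidef_nonneg[OF R]) auto
    also have "\<dots> = v \<bullet> (R *\<^sub>v v) - c * t * t"
      using d u v by (simp add: mult_vec_minus_dim scalar_minus_left_dim scalar_minus_right_dim
          mult_vec_smult_dim Ru uv tv
          algebra_simps)
    also have "\<dots> = v \<bullet> ((R - G) *\<^sub>v v)"
      using d u v Gv[OF v] by (simp add: minus_mult_vec_dim scalar_minus_right_dim tv t_def[symmetric] G_def)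
    finally show "0 \<le> v \<bullet> ((R - G) *\<^sub>v v)" .
  qed
  then show thesis using that[OF u c Ru] by (simp add: G_def)
qed

text \<open>Deflation. Suppose that \<open>S\<close> is a sum of \<open>k\<close> orthonormal terms and a positive semidefinite remainder
  that annihilates the \<open>k\<close> vectors. A top eigenvector of a nonzero remainder is orthogonal to them and
  gives one more term. As \<open>k\<close> cannot exceed \<open>n\<close>, the remainder of a maximal family is zero.\<close>
lemma pos_semidef_spectral:
  assumes S: "pos_semidef n S"
  obtains u l k where "orthonormal_family n u k" "\<And>i. i < k \<Longrightarrow> 0 < l i" "S = outer_sum n u l k"
proof -
  define good where "good k \<longleftrightarrow> (\<exists>u l R. orthonormal_family n u k \<and> (\<forall>i<k. 0 < l i) \<and> pos_semidef n R \<and>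
     S = outer_sum n u l k + R \<and> (\<forall>i<k. R *\<^sub>v u i = 0\<^sub>v n))" for k
  have "good 0" unfolding good_def
    using S pos_semidef_dim[OF S]
    by (intro exI[of _ undefined] exI[of _ S])
       (auto simp: orthonormal_family_def outer_sum_def intro!: eq_matI)
  moreover have "k \<le> n" if "good k" for k
    using that orthonormal_family_card by (auto simp: good_def)
  ultimately obtain k where k: "good k" and max: "\<not> good (Suc k)"
    by (metis (full_types) GreatestI_nat Greatest_le_nat Suc_n_not_le_n)
  then obtain u l R where u: "orthonormal_family n u k" and l: "\<forall>i<k. 0 < l i" and R: "pos_semidef n R"
    and SR: "S = outer_sum n u l k + R" and Ru: "\<forall>i<k. R *\<^sub>v u i = 0\<^sub>v n"
    unfolding good_def by blast
  note d = pos_semidef_dim[OF R]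
  have "R = 0\<^sub>m n n"
  proof (rule ccontr)
    assume "R \<noteq> 0\<^sub>m n n"
    then obtain x c where x: "x \<in> carrier_vec n" "x \<bullet> x = 1" and c: "0 < c" and Rx: "R *\<^sub>v x = c \<cdot>\<^sub>v x"
      and R': "pos_semidef n (R - mat n n (\<lambda>(a, b). c * x $ a * x $ b))"
      using pos_semidef_top_eigenvector[OF R] by metis
    define G where "G = mat n n (\<lambda>(a, b). c * x $ a * x $ b)"
    have Gv: "G *\<^sub>v v = (c * (x \<bullet> v)) \<cdot>\<^sub>v x" if "v \<in> carrier_vec n" for v
      using that x by (intro eq_vecI) (auto simp: G_def scalar_prod_def sum_distrib_left sum_distrib_right
          mult_ac intro!: sum.cong)
    have ui: "u i \<in> carrier_vec n" if "i < k" for i using u that by (simp add: orthonormal_family_def)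
    have orth: "u i \<bullet> x = 0" if i: "i < k" for i
    proof -
      have "c * (u i \<bullet> x) = u i \<bullet> (R *\<^sub>v x)" using x ui[OF i] by (simp add: Rx)
      also have "\<dots> = (R *\<^sub>v u i) \<bullet> x" using transpose_scalar_dim[of R x "u i"] d x ui[OF i] by simp
      also have "\<dots> = 0" using Ru i x by simp
      finally show ?thesis using c by simp
    qed
    have orth': "x \<bullet> u i = 0" if i: "i < k" for i
      using orth[OF i] scalar_comm_dim[of x "u i"] ui[OF i] x by simp
    have "good (Suc k)" unfolding good_def
    proof (intro exI conjI)
      show "orthonormal_family n (u(k := x)) (Suc k)"
        using u x orth orth' by (auto simp: orthonormal_family_def less_Suc_eq)
      show "\<forall>i<Suc k. 0 < (l(k := c)) i" using l c by (auto simp: less_Suc_eq)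
      show "pos_semidef n (R - G)" using R' by (simp add: G_def)
      show "S = outer_sum n (u(k := x)) (l(k := c)) (Suc k) + (R - G)"
        unfolding SR using d by (intro eq_matI) (auto simp: outer_sum_def G_def)
      show "\<forall>i<Suc k. (R - G) *\<^sub>v (u(k := x)) i = 0\<^sub>v n"
      proof (intro allI impI)
        fix i assume "i < Suc k"
        then consider "i < k" | "i = k" by linarith
        then show "(R - G) *\<^sub>v (u(k := x)) i = 0\<^sub>v n"
        proof cases
          case 1
          then have "(R - G) *\<^sub>v u i = R *\<^sub>v u i - G *\<^sub>v u i"
            using ui[OF 1] d by (intro minus_mult_vec_dim) (auto simp: G_def)
          also have "\<dots> = 0\<^sub>v n" unfolding Gv[OF ui[OF 1]] orth'[OF 1] using Ru 1 x by (intro eq_vecI) auto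
          finally show ?thesis using 1 by simp
        next
          case 2
          have "(R - G) *\<^sub>v x = R *\<^sub>v x - G *\<^sub>v x"
            using x d by (intro minus_mult_vec_dim) (auto simp: G_def)
          also have "\<dots> = 0\<^sub>v n" unfolding Gv[OF x(1)] Rx x(2) using x by (intro eq_vecI) auto
          finally show ?thesis using 2 by simp
        qed
      qed
    qed
    then show False using max by simp
  qed
  then have "S = outer_sum n u l k" using SR by (simp add: outer_sum_def)
  then show thesis using that u l by blast
qed

lemma pos_def_diag:
  fixes d :: "nat \<Rightarrow> real"
  assumes "\<And>i. i < r \<Longrightarrow> 0 < d i"
  shows "pos_def r (mat r r (\<lambda>(i, j). if i = j then d i else 0))"
  unfolding pos_def_def
proof (intro conjI ballI impI)
  fix v :: "real Matrix.vec" assume v: "v \<in> carrier_vec r" "v \<noteq> 0\<^sub>v r"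
  have "v \<bullet> (mat r r (\<lambda>(i, j). if i = j then d i else 0) *\<^sub>v v) = (\<Sum>i<r. d i * (v $ i)\<^sup>2)"
    unfolding scalar_mult_mat_vec_sum[OF mat_carrier v(1) v(1)]
    by (intro sum.cong) (auto simp: power2_eq_square if_distrib[of "\<lambda>x. _ * x * _"] cong: if_cong)
  moreover have "\<exists>i<r. v $ i \<noteq> 0" using v by (metis carrier_vecD eq_vecI index_zero_vec)
  then have "0 < (\<Sum>i<r. d i * (v $ i)\<^sup>2)"
    using assms by (auto intro!: sum_pos2 simp: less_imp_le)
  ultimately show "0 < v \<bullet> (mat r r (\<lambda>(i, j). if i = j then d i else 0) *\<^sub>v v)" by simp
qed (auto intro!: eq_matI)

text \<open>The singular value decomposition without its zero part: the rows of \<open>C\<close> are eigenvectors and \<open>V\<close>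
  carries the inverses of the nonzero eigenvalues.\<close>
lemma pos_semidef_factorization:
  assumes S: "pos_semidef n S"
  obtains r C V where "C \<in> carrier_mat r n" "pos_def r V" "C\<^sup>T * matinv V * C = S" "C * C\<^sup>T = 1\<^sub>m r"
    "\<And>i j. i < r \<Longrightarrow> j < r \<Longrightarrow> i \<noteq> j \<Longrightarrow> V $$ (i, j) = 0"
proof -
  obtain u l k where u: "orthonormal_family n u k" and l: "\<And>i. i < k \<Longrightarrow> 0 < l i" and Su: "S = outer_sum n u l k"
    using pos_semidef_spectral[OF S] by metis
  define C where "C = mat k n (\<lambda>(i, a). u i $ a)"
  define V where "V = mat k k (\<lambda>(i, j). if i = j then 1 / l i else 0)"
  define U where "U = mat k k (\<lambda>(i, j). if i = j then l i else 0)"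
  have V: "pos_def k V" unfolding V_def using l by (intro pos_def_diag) auto
  have sel: "(\<Sum>ia = 0..<k. (if i = ia then f ia else 0) * g ia) = (f i * g i :: real)" if "i < k" for i f g
  proof -
    have "(\<Sum>ia = 0..<k. (if i = ia then f ia else 0) * g ia) = (\<Sum>ia = 0..<k. if i = ia then f ia * g ia else 0)"
      by (intro sum.cong) auto
    then show ?thesis using that by simp
  qed
  have "V * U = 1\<^sub>m k"
  proof (rule eq_matI)
    fix i j assume "i < dim_row (1\<^sub>m k)" "j < dim_col (1\<^sub>m k)"
    then have ij: "i < k" "j < k" by auto
    then have "(V * U) $$ (i, j) = (\<Sum>ia = 0..<k. (if i = ia then 1 / l i else 0) * (if ia = j then l ia else 0))"
      by (auto simp: V_def U_def scalar_prod_def intro!: sum.cong)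
    also have "\<dots> = 1 / l i * (if i = j then l i else 0)" by (rule sel[OF ij(1)])
    finally show "(V * U) $$ (i, j) = 1\<^sub>m k $$ (i, j)" using ij l[OF ij(1)] by auto
  qed (auto simp: V_def U_def)
  then have mV: "matinv V = U" by (intro matinv_unique[OF V]) (auto simp: U_def)
  have UC: "(U * C) $$ (i, b) = l i * u i $ b" if "i < k" "b < n" for i b
    using that sel[OF that(1), of "\<lambda>ia. l i" "\<lambda>ia. u ia $ b"] by (simp add: U_def C_def scalar_prod_def)
  have "C\<^sup>T * matinv V * C = C\<^sup>T * (U * C)" unfolding mV by (intro mult_assoc_dim) (auto simp: C_def U_def)
  also have "\<dots> = S"
  proof (rule eq_matI)
    fix a b assume "a < dim_row S" "b < dim_col S"
    then have ab: "a < n" "b < n" by (auto simp: Su outer_sum_def)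
    define X where "X = U * C"
    have "dim_row X = k" "dim_col X = n" by (auto simp: X_def U_def C_def)
    then have "(C\<^sup>T * (U * C)) $$ (a, b) = (\<Sum>i = 0..<k. C $$ (i, a) * (U * C) $$ (i, b))"
      unfolding X_def[symmetric] using ab by (auto simp: C_def scalar_prod_def)
    also have "\<dots> = (\<Sum>i = 0..<k. C $$ (i, a) * (l i * u i $ b))"
      by (intro sum.cong refl arg_cong2[of _ _ _ _ "(*)"]) (use ab in \<open>auto intro!: UC simp del: index_mult_mat\<close>)
    also have "\<dots> = S $$ (a, b)" unfolding Su outer_sum_def using ab
      by (auto simp: C_def atLeast0LessThan mult_ac intro!: sum.cong)
    finally show "(C\<^sup>T * (U * C)) $$ (a, b) = S $$ (a, b)" .
  qed (auto simp: Su C_def outer_sum_def)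
  finally have "C\<^sup>T * matinv V * C = S" .
  then show thesis
    using that[of C k V] V orthonormal_family_gram[OF u] by (simp add: C_def V_def)
qed

lemma pos_def_scalar_lower_bound:
  assumes S: "pos_def n S"
  obtains c :: real where "0 < c" "pos_semidef n (S - c \<cdot>\<^sub>m 1\<^sub>m n)"
proof -
  note d = pos_def_dim[OF S]
  obtain c where c: "0 < c" "\<And>v. v \<in> carrier_vec n \<Longrightarrow> c * (v \<bullet> v) \<le> v \<bullet> (S *\<^sub>v v)"
  proof (cases "n = 0")
    case True
    have "v \<bullet> w = 0" if "v \<in> carrier_vec n" "w \<in> carrier_vec n" for v w :: "real Matrix.vec"
      using that True by (simp add: scalar_prod_def)
    then show ?thesis using that[of 1] d by simp
  next
    case False
    obtain u where u: "u \<in> carrier_vec n" "u \<bullet> u = 1"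
      and max: "\<And>v. v \<in> carrier_vec n \<Longrightarrow> v \<bullet> ((- S) *\<^sub>v v) \<le> (u \<bullet> ((- S) *\<^sub>v u)) * (v \<bullet> v)"
      using quadratic_form_maximizer[of "- S" n] d False by auto
    have neg: "v \<bullet> ((- S) *\<^sub>v v) = - (v \<bullet> (S *\<^sub>v v))" if "v \<in> carrier_vec n" for v
      using that d by (simp add: uminus_mult_mat_vec)
    have "u \<noteq> 0\<^sub>v n" using u(2) by auto
    then show ?thesis
      using that[of "u \<bullet> (S *\<^sub>v u)"] pos_def_pos[OF S u(1)] max by (auto simp: neg u)
  qed
  have "pos_semidef n (S - c \<cdot>\<^sub>m 1\<^sub>m n)"
    unfolding pos_semidef_def
  proof (intro conjI ballI)
    show "S - c \<cdot>\<^sub>m 1\<^sub>m n \<in> carrier_mat n n" by (intro minus_carrier_mat) auto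
    have "(c \<cdot>\<^sub>m 1\<^sub>m n)\<^sup>T = c \<cdot>\<^sub>m 1\<^sub>m n" by (intro eq_matI) auto
    then show "(S - c \<cdot>\<^sub>m 1\<^sub>m n)\<^sup>T = S - c \<cdot>\<^sub>m 1\<^sub>m n" using d by (simp add: transpose_minus_dim)
    fix v :: "real Matrix.vec" assume v: "v \<in> carrier_vec n"
    then have "v \<bullet> ((S - c \<cdot>\<^sub>m 1\<^sub>m n) *\<^sub>v v) = v \<bullet> (S *\<^sub>v v) - c * (v \<bullet> v)"
      using d by (simp add: minus_mult_vec_dim scalar_minus_right_dim smult_one_mult_vec)
    then show "0 \<le> v \<bullet> ((S - c \<cdot>\<^sub>m 1\<^sub>m n) *\<^sub>v v)" using c(2)[OF v] by simp
  qed
  then show thesis using that c by blast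
qed

text \<open>By the spectral decomposition of \<open>B - A\<close>, the matrix \<open>B\<close> arises from \<open>A\<close> by adding terms \<open>l u u\<^sup>T\<close>.
  Each sum is the innovation covariance of a scalar signal with variance \<open>l\<close> observed through the column
  \<open>u\<close> in noise with the covariance reached so far, so facts about observations of one-dimensional signals
  serve as induction steps.\<close>
lemma loewner_rank_one_induct:
  assumes A: "pos_def n A" and B: "B \<in> carrier_mat n n" and AB: "pos_semidef n (B - A)"
    and base: "Q A"
    and step: "\<And>X p C. pos_def n X \<Longrightarrow> pos_def 1 p \<Longrightarrow> C \<in> carrier_mat n 1 \<Longrightarrow> Q X \<Longrightarrow> Q (innovation_cov p X C)"
  shows "Q B"
proof -
  note d = pos_def_dim[OF A]
  obtain u l k where u: "orthonormal_family n u k" and l: "\<And>i. i < k \<Longrightarrow> 0 < l i" and BA: "B - A = outer_sum n u l k"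
    using pos_semidef_spectral[OF AB] by metis
  have "j \<le> k \<Longrightarrow> pos_def n (outer_sum n u l j + A) \<and> Q (outer_sum n u l j + A)" for j
  proof (induction j)
    case 0
    have "outer_sum n u l 0 + A = A" using d by (intro eq_matI) (auto simp: outer_sum_def)
    then show ?case using A base by simp
  next
    case (Suc j)
    let ?X = "outer_sum n u l j + A"
    define p where "p = mat 1 1 (\<lambda>(i, i'). if i = i' then l j else 0)"
    define C where "C = mat n 1 (\<lambda>(a, i). u j $ a)"
    have p: "pos_def 1 p" unfolding p_def using l Suc by (intro pos_def_diag) auto
    have C: "C \<in> carrier_mat n 1" by (simp add: C_def)
    have X: "pos_def n ?X" "Q ?X" using Suc by auto
    interpret linear_observation 1 n p ?X C using p X C by unfold_locales
    have "innovation_cov p ?X C = outer_sum n u l (Suc j) + A"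
      unfolding innovation_cov_def using d
      by (intro eq_matI) (auto simp: outer_sum_def C_def p_def scalar_prod_def)
    then show ?case using pos_def_innovation step[OF X(1) p C X(2)] by simp
  qed
  from this[of k] have "Q (outer_sum n u l k + A)" by simp
  moreover have "outer_sum n u l k + A = B" unfolding BA[symmetric] using d B by (intro eq_matI) auto
  ultimately show ?thesis by simp
qed

lemma pos_def_smult_one: "0 < c \<Longrightarrow> pos_def n (c \<cdot>\<^sub>m 1\<^sub>m n)"
proof -
  assume "0 < c"
  then have "pos_def n (mat n n (\<lambda>(i, j). if i = j then c else 0))" by (intro pos_def_diag)
  moreover have "mat n n (\<lambda>(i, j). if i = j then c else 0) = c \<cdot>\<^sub>m 1\<^sub>m n" by (intro eq_matI) auto
  ultimately show ?thesis by simp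
qed

lemma pos_def_rank_one_induct:
  assumes S: "pos_def n S"
    and base: "\<And>c. 0 < c \<Longrightarrow> Q (c \<cdot>\<^sub>m 1\<^sub>m n)"
    and step: "\<And>X p C. pos_def n X \<Longrightarrow> pos_def 1 p \<Longrightarrow> C \<in> carrier_mat n 1 \<Longrightarrow> Q X \<Longrightarrow> Q (innovation_cov p X C)"
  shows "Q S"
proof -
  obtain c where c: "0 < c" "pos_semidef n (S - c \<cdot>\<^sub>m 1\<^sub>m n)"
    using pos_def_scalar_lower_bound[OF S] by blast
  show ?thesis
    by (rule loewner_rank_one_induct[OF pos_def_smult_one[OF c(1)] pos_def_dim(4)[OF S] c(2) base[OF c(1)] step])
qed

lemma quadratic_form_unit:
  fixes A :: "real mat"
  assumes "A \<in> carrier_mat n n" "i < n"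
  shows "unit_vec n i \<bullet> (A *\<^sub>v unit_vec n i) = A $$ (i, i)"
  using assms by simp

lemma pos_def_dim1:
  assumes "pos_def 1 p"
  shows "0 < p $$ (0, 0)" "det p = p $$ (0, 0)" "p = p $$ (0, 0) \<cdot>\<^sub>m 1\<^sub>m 1"
proof -
  have c: "p \<in> carrier_mat 1 1" using pos_def_dim[OF assms] by simp
  have "unit_vec 1 0 \<noteq> (0\<^sub>v 1 :: real Matrix.vec)"
    by (metis index_unit_vec(1) index_zero_vec(1) zero_neq_one less_one)
  then have "0 < unit_vec 1 0 \<bullet> (p *\<^sub>v unit_vec 1 0)" by (intro pos_def_pos[OF assms]) auto
  then show "0 < p $$ (0, 0)" using quadratic_form_unit[OF c, of 0] by simp
  show "det p = p $$ (0, 0)" using c by (rule det_single)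
  show "p = p $$ (0, 0) \<cdot>\<^sub>m 1\<^sub>m 1" using c by (intro eq_matI) auto
qed

text \<open>The difference is \<open>P C\<^sup>T S\<^sup>-\<^sup>1 C P\<close>, a congruence transform of \<open>S\<^sup>-\<^sup>1\<close>.\<close>
lemma (in linear_observation) posterior_le_prior: "pos_semidef m (P - P')"
proof -
  have "pos_semidef m ((P * C\<^sup>T) * matinv S * (P * C\<^sup>T)\<^sup>T)"
    using dims by (intro pos_semidef_congruence[OF pos_def_imp_pos_semidef[OF
        pos_def_inverse[OF pos_def_innovation]]]) auto
  moreover have "(P * C\<^sup>T) * matinv S * (P * C\<^sup>T)\<^sup>T = P - P'"
  proof -
    have "(P * C\<^sup>T) * matinv S * (P * C\<^sup>T)\<^sup>T = K * (C * P)"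
      unfolding gain_eq using dims' by (simp add: transpose_mult_dim mult_assoc_dim)
    also have "\<dots> = (P' + K * (C * P)) - P'" using dims' gain_dims by (intro eq_matI) auto
    also have "\<dots> = P - P'" unfolding posterior_gain[symmetric] ..
    finally show ?thesis .
  qed
  ultimately show ?thesis by simp
qed

text \<open>A step multiplies the determinant by the quotient of the prior and the posterior variance of a
  scalar signal.\<close>
lemma det_pos_def: assumes "pos_def n S" shows "0 < det S"
proof (rule pos_def_rank_one_induct[OF assms])
  fix c :: real assume "0 < c"
  then show "0 < det (c \<cdot>\<^sub>m 1\<^sub>m n)" by simp
next
  fix X p C :: "real mat" assume "pos_def n X" "pos_def 1 p" "C \<in> carrier_mat n 1" and X: "0 < det X"
  then interpret linear_observation 1 n p X C by unfold_locales
  show "0 < det (innovation_cov p X C)"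
    using det_posterior_innovation X pos_def_dim1[OF P] pos_def_dim1[OF pos_def_posterior]
    by (metis mult_pos_pos zero_less_mult_pos)
qed

text \<open>The same quotient is at least 1, because an observation does not increase the variance.\<close>
lemma det_mono:
  assumes A: "pos_def n A" and B: "B \<in> carrier_mat n n" and AB: "pos_semidef n (B - A)"
  shows "det A \<le> det B"
proof -
  have "pos_def n B \<and> det A \<le> det B"
  proof (rule loewner_rank_one_induct[OF A B AB])
    show "pos_def n A \<and> det A \<le> det A" using A by simp
    fix X p C :: "real mat" assume "pos_def n X" "pos_def 1 p" "C \<in> carrier_mat n 1" and X: "pos_def n X \<and>
        det A \<le> det X"
    then interpret linear_observation 1 n p X C by unfold_locales
    have "0 \<le> unit_vec 1 0 \<bullet> ((p - P') *\<^sub>v unit_vec 1 0)"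
      by (rule pos_semidef_nonneg[OF posterior_le_prior]) simp
    then have "P' $$ (0, 0) \<le> p $$ (0, 0)"
      using quadratic_form_unit[of "p - P'" 1 0] pos_semidef_dim(4)[OF posterior_le_prior] dims' by auto
    then have le: "det P' \<le> det p" using pos_def_dim1[OF P] pos_def_dim1[OF pos_def_posterior] by simp
    have "det p * det X = det P' * det S" by (rule det_posterior_innovation)
    also have "\<dots> \<le> det p * det S"
      using le det_pos_def[OF pos_def_innovation] by (intro mult_right_mono) auto
    finally have "det X \<le> det S" using det_pos_def[OF P] by simp
    then show "pos_def n (innovation_cov p X C) \<and> det A \<le> det (innovation_cov p X C)"
      using X pos_def_innovation by simp
  qed
  then show ?thesis by simp
qed

text \<open>For every \<open>y\<close>, the value \<open>v \<bullet> A\<^sup>-\<^sup>1 v\<close> is at least \<open>2 (y \<bullet> v) - y \<bullet> A y\<close>. At \<open>y = B\<^sup>-\<^sup>1 v\<close> the latter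
  is at least \<open>v \<bullet> B\<^sup>-\<^sup>1 v\<close>.\<close>
lemma loewner_inverse_antimono:
  assumes A: "pos_def n A" and B: "pos_def n B" and AB: "pos_semidef n (B - A)"
  shows "pos_semidef n (matinv A - matinv B)"
  unfolding pos_semidef_def
proof (intro conjI ballI)
  note d = pos_def_dim[OF A] pos_def_dim[OF B] pos_def_matinv(3-5)[OF A] pos_def_matinv(3-5)[OF B]
  show "matinv A - matinv B \<in> carrier_mat n n" using pos_def_matinv(5)[OF B] by (rule minus_carrier_mat)
  show "(matinv A - matinv B)\<^sup>T = matinv A - matinv B"
    using d by (simp add: transpose_minus_dim matinv_symmetric[OF A] matinv_symmetric[OF B])
  fix v :: "real Matrix.vec" assume v: "v \<in> carrier_vec n"
  define x where "x = matinv A *\<^sub>v v"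
  define y where "y = matinv B *\<^sub>v v"
  have x: "x \<in> carrier_vec n" "A *\<^sub>v x = v" using v d pos_def_cancel[OF A] by (auto simp: x_def)
  have y: "y \<in> carrier_vec n" "B *\<^sub>v y = v" using v d pos_def_cancel[OF B] by (auto simp: y_def)
  have "0 \<le> (x - y) \<bullet> (A *\<^sub>v (x - y))"
    using x y by (intro pos_semidef_nonneg[OF pos_def_imp_pos_semidef[OF A]]) auto
  also have "\<dots> = x \<bullet> v - 2 * (y \<bullet> v) + y \<bullet> (A *\<^sub>v y)"
    using x y d v transpose_scalar_dim[of A y x]
    by (simp add: mult_vec_minus_dim scalar_minus_left_dim scalar_minus_right_dim scalar_comm_dim[of v y])
  finally have 1: "2 * (y \<bullet> v) \<le> x \<bullet> v + y \<bullet> (A *\<^sub>v y)" by simp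
  have "0 \<le> y \<bullet> ((B - A) *\<^sub>v y)" by (rule pos_semidef_nonneg[OF AB y(1)])
  also have "\<dots> = y \<bullet> v - y \<bullet> (A *\<^sub>v y)"
    using y d v by (simp add: minus_mult_vec_dim scalar_minus_right_dim)
  finally have "y \<bullet> v \<le> x \<bullet> v" using 1 by simp
  then show "0 \<le> v \<bullet> ((matinv A - matinv B) *\<^sub>v v)"
    using v d x y by (simp add: minus_mult_vec_dim scalar_minus_right_dim x_def[symmetric]
        y_def[symmetric] scalar_comm_dim[of v])
qed

section \<open>Lebesgue measure and Gaussian densities on vectors\<close>

lemma space_borel_vec [simp]: "space (borel_vec m) = carrier_vec m"
  by (simp add: borel_vec_def)

lemma measurable_vec_index:
  assumes "i < m" shows "(\<lambda>v. v $ i) \<in> borel_vec m \<rightarrow>\<^sub>M borel"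
proof -
  have "(\<lambda>v. \<lambda>i\<in>{..<m}. v $ i) \<in> borel_vec m \<rightarrow>\<^sub>M (\<Pi>\<^sub>M i\<in>{..<m}. (borel :: real measure))"
    unfolding borel_vec_def by (rule measurable_vimage_algebra1) (auto simp: space_PiM)
  from measurable_compose[OF this measurable_component_singleton[of i]] assms show ?thesis by simp
qed

lemma measurable_vec_index' [measurable (raw)]:
  assumes "f \<in> M \<rightarrow>\<^sub>M borel_vec m" "i < m" shows "(\<lambda>\<omega>. f \<omega> $ i) \<in> M \<rightarrow>\<^sub>M borel"
  using measurable_compose[OF assms(1) measurable_vec_index[OF assms(2)]] .

lemma measurable_into_borel_vec:
  assumes "\<And>\<omega>. \<omega> \<in> space M \<Longrightarrow> f \<omega> \<in> carrier_vec m"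
    and "\<And>i. i < m \<Longrightarrow> (\<lambda>\<omega>. f \<omega> $ i) \<in> M \<rightarrow>\<^sub>M borel"
  shows "f \<in> M \<rightarrow>\<^sub>M borel_vec m"
  unfolding borel_vec_def
  using assms by (intro measurable_vimage_algebra2 measurable_restrict) auto

lemma measurable_borel_vec_carrier: "f \<in> M \<rightarrow>\<^sub>M borel_vec m \<Longrightarrow> \<omega> \<in> space M \<Longrightarrow> f \<omega> \<in> carrier_vec m"
  using measurable_space[of f M "borel_vec m" \<omega>] by simp

lemma measurable_borel_vec_dim: "f \<in> M \<rightarrow>\<^sub>M borel_vec m \<Longrightarrow> \<omega> \<in> space M \<Longrightarrow> dim_vec (f \<omega>) = m"
  using measurable_borel_vec_carrier[of f M m \<omega>] by simp

lemma measurable_mult_mat_vec: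
  assumes A: "A \<in> carrier_mat r m" and f: "f \<in> M \<rightarrow>\<^sub>M borel_vec m"
  shows "(\<lambda>\<omega>. A *\<^sub>v f \<omega>) \<in> M \<rightarrow>\<^sub>M borel_vec r"
proof (rule measurable_into_borel_vec)
  fix i assume i: "i < r"
  have "(\<lambda>\<omega>. \<Sum>j\<in>{0..<m}. A $$ (i, j) * f \<omega> $ j) \<in> M \<rightarrow>\<^sub>M borel"
    using f by (intro borel_measurable_sum borel_measurable_times measurable_vec_index') auto
  then show "(\<lambda>\<omega>. (A *\<^sub>v f \<omega>) $ i) \<in> M \<rightarrow>\<^sub>M borel"
    by (rule measurable_cong[THEN iffD1, rotated])
       (use i A in \<open>auto simp: scalar_prod_def measurable_borel_vec_dim[OF f] intro!: sum.cong\<close>)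
qed (use A measurable_borel_vec_carrier[OF f] in auto)

lemma measurable_add_vec:
  assumes f: "f \<in> M \<rightarrow>\<^sub>M borel_vec m" and g: "g \<in> M \<rightarrow>\<^sub>M borel_vec m"
  shows "(\<lambda>\<omega>. f \<omega> + g \<omega>) \<in> M \<rightarrow>\<^sub>M borel_vec m"
proof (rule measurable_into_borel_vec)
  fix i assume i: "i < m"
  have "(\<lambda>\<omega>. f \<omega> $ i + g \<omega> $ i) \<in> M \<rightarrow>\<^sub>M borel" using f g i by measurable
  then show "(\<lambda>\<omega>. (f \<omega> + g \<omega>) $ i) \<in> M \<rightarrow>\<^sub>M borel"
    by (rule measurable_cong[THEN iffD1, rotated])
       (use i in \<open>simp add: measurable_borel_vec_dim[OF f] measurable_borel_vec_dim[OF g]\<close>)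
qed (use measurable_borel_vec_carrier[OF f] measurable_borel_vec_carrier[OF g] in auto)

lemma measurable_minus_vec:
  assumes f: "f \<in> M \<rightarrow>\<^sub>M borel_vec m" and g: "g \<in> M \<rightarrow>\<^sub>M borel_vec m"
  shows "(\<lambda>\<omega>. f \<omega> - g \<omega>) \<in> M \<rightarrow>\<^sub>M borel_vec m"
proof (rule measurable_into_borel_vec)
  fix i assume i: "i < m"
  have "(\<lambda>\<omega>. f \<omega> $ i - g \<omega> $ i) \<in> M \<rightarrow>\<^sub>M borel" using f g i by measurable
  then show "(\<lambda>\<omega>. (f \<omega> - g \<omega>) $ i) \<in> M \<rightarrow>\<^sub>M borel"
    by (rule measurable_cong[THEN iffD1, rotated])
       (use i in \<open>simp add: measurable_borel_vec_dim[OF f] measurable_borel_vec_dim[OF g]\<close>)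
qed (use measurable_borel_vec_carrier[OF f] measurable_borel_vec_carrier[OF g] in \<open>auto intro!: minus_carrier_vec\<close>)

lemma measurable_scalar_prod:
  assumes f: "f \<in> M \<rightarrow>\<^sub>M borel_vec m" and g: "g \<in> M \<rightarrow>\<^sub>M borel_vec m"
  shows "(\<lambda>\<omega>. f \<omega> \<bullet> g \<omega>) \<in> M \<rightarrow>\<^sub>M borel"
proof -
  have "(\<lambda>\<omega>. \<Sum>i\<in>{0..<m}. f \<omega> $ i * g \<omega> $ i) \<in> M \<rightarrow>\<^sub>M borel"
    using f g by (intro borel_measurable_sum borel_measurable_times measurable_vec_index') auto
  then show ?thesis
    by (rule measurable_cong[THEN iffD1, rotated])
       (simp add: scalar_prod_def measurable_borel_vec_dim[OF g])
qed

lemma measurable_gaussian_density: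
  assumes S: "pos_def m S" and f: "f \<in> M \<rightarrow>\<^sub>M borel_vec m"
  shows "(\<lambda>\<omega>. gaussian_density S (f \<omega>)) \<in> M \<rightarrow>\<^sub>M borel"
proof -
  have [measurable]: "(\<lambda>\<omega>. f \<omega> \<bullet> (matinv S *\<^sub>v f \<omega>)) \<in> M \<rightarrow>\<^sub>M borel"
    by (intro measurable_scalar_prod[OF f] measurable_mult_mat_vec[OF _ f] pos_def_matinv(5)[OF S])
  show ?thesis unfolding gaussian_density_def by measurable
qed

lemma measurable_vec [measurable]: "Matrix.vec m \<in> (\<Pi>\<^sub>M i\<in>{..<m}. (borel :: real measure)) \<rightarrow>\<^sub>M borel_vec m"
  by (rule measurable_into_borel_vec) (auto intro!: measurable_component_singleton)

lemma sets_PiM_lborel: "sets (\<Pi>\<^sub>M i\<in>I. (lborel :: real measure)) = sets (\<Pi>\<^sub>M i\<in>I. borel)"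
  by (intro sets_PiM_cong) auto

lemma measurable_vec_lborel: "Matrix.vec m \<in> (\<Pi>\<^sub>M i\<in>{..<m}. (lborel :: real measure)) \<rightarrow>\<^sub>M borel_vec m"
  using measurable_vec by (simp cong: measurable_cong_sets add: measurable_cong_sets[OF sets_PiM_lborel refl])

lemma sets_lborel_vec [simp, measurable_cong]: "sets (lborel_vec m) = sets (borel_vec m)"
  by (simp add: lborel_vec_def)

lemma space_lborel_vec [simp]: "space (lborel_vec m) = carrier_vec m"
  by (simp add: lborel_vec_def)

interpretation lborel_product: product_sigma_finite "\<lambda>i::nat. lborel :: real measure"
  by unfold_locales

lemma nn_integral_lborel_vec:
  assumes "f \<in> borel_measurable (borel_vec m)"
  shows "(\<integral>\<^sup>+v. f v \<partial>lborel_vec m) = (\<integral>\<^sup>+x. f (Matrix.vec m x) \<partial>(\<Pi>\<^sub>M i\<in>{..<m}. lborel))"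
  unfolding lborel_vec_def using assms by (intro nn_integral_distr measurable_vec_lborel) auto

text \<open>The coordinates push this measure forward to the product of lines, and a measure with a
  sigma-finite image is sigma-finite.\<close>
lemma sigma_finite_lborel_vec: "sigma_finite_measure (lborel_vec m)"
proof -
  interpret finite_product_sigma_finite "\<lambda>i::nat. lborel :: real measure" "{..<m}"
    by standard auto
  let ?P = "\<Pi>\<^sub>M i\<in>{..<m}. (lborel :: real measure)"
  have \<phi>: "(\<lambda>v. \<lambda>i\<in>{..<m}. v $ i) \<in> lborel_vec m \<rightarrow>\<^sub>M ?P"
    by (auto intro!: measurable_restrict measurable_vec_index simp: measurable_lborel1
        cong: measurable_cong_sets)
  have "distr (lborel_vec m) ?P (\<lambda>v. \<lambda>i\<in>{..<m}. v $ i) = distr ?P ?P (\<lambda>x. x)"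
  proof -
    have "distr (lborel_vec m) ?P (\<lambda>v. \<lambda>i\<in>{..<m}. v $ i) = distr ?P ?P ((\<lambda>v. \<lambda>i\<in>{..<m}. v $ i) \<circ> Matrix.vec m)"
      unfolding lborel_vec_def using \<phi>
      by (intro distr_distr measurable_vec_lborel) (simp add: measurable_cong_sets[OF sets_lborel_vec refl])
    also have "\<dots> = distr ?P ?P (\<lambda>x. x)"
      by (intro distr_cong) (auto simp: space_PiM fun_eq_iff PiE_def extensional_def)
    finally show ?thesis .
  qed
  also have "\<dots> = ?P" by (rule distr_id2) simp
  finally have "sigma_finite_measure (distr (lborel_vec m) ?P (\<lambda>v. \<lambda>i\<in>{..<m}. v $ i))"
    using sigma_finite_measure_axioms by simp
  then show ?thesis using \<phi> by (rule sigma_finite_measure_distr)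
qed

lemma measurable_PiM_lborel_translate:
  fixes a :: "nat \<Rightarrow> real"
  shows "(\<lambda>x. \<lambda>i\<in>I. a i + x i) \<in> (\<Pi>\<^sub>M i\<in>I. (lborel::real measure)) \<rightarrow>\<^sub>M (\<Pi>\<^sub>M i\<in>I. lborel)"
proof (rule measurable_restrict)
  fix i assume "i \<in> I"
  then have "(\<lambda>x. x i) \<in> (\<Pi>\<^sub>M i\<in>I. (lborel::real measure)) \<rightarrow>\<^sub>M lborel" by (rule measurable_component_singleton)
  then show "(\<lambda>x. a i + x i) \<in> (\<Pi>\<^sub>M i\<in>I. (lborel::real measure)) \<rightarrow>\<^sub>M lborel" by simp
qed

lemma distr_PiM_lborel_translate:
  fixes a :: "nat \<Rightarrow> real"
  assumes I: "finite I"
  shows "distr (\<Pi>\<^sub>M i\<in>I. lborel) (\<Pi>\<^sub>M i\<in>I. lborel) (\<lambda>x. \<lambda>i\<in>I. a i + x i) = (\<Pi>\<^sub>M i\<in>I. lborel)"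
proof (rule lborel_product.PiM_eqI[OF I])
  show "sets (distr (\<Pi>\<^sub>M i\<in>I. lborel) (\<Pi>\<^sub>M i\<in>I. lborel) (\<lambda>x. \<lambda>i\<in>I. a i + x i)) = sets (\<Pi>\<^sub>M i\<in>I. lborel)" by simp
  fix A :: "nat \<Rightarrow> real set" assume A: "\<And>i. i \<in> I \<Longrightarrow> A i \<in> sets lborel"
  have m: "(\<lambda>x. \<lambda>i\<in>I. a i + x i) \<in> (\<Pi>\<^sub>M i\<in>I. (lborel::real measure)) \<rightarrow>\<^sub>M (\<Pi>\<^sub>M i\<in>I. lborel)"
    by (rule measurable_PiM_lborel_translate)
  have B: "(+) (a i) -` A i \<in> sets lborel" if "i \<in> I" for i
    using A[OF that] measurable_sets_borel[of "(+) (a i)" borel "A i"] by simp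
  have e: "emeasure lborel ((+) (a i) -` A i) = emeasure lborel (A i)" if "i \<in> I" for i
  proof -
    have "emeasure lborel (A i) = emeasure (distr lborel borel ((+) (a i))) (A i)" by (simp only: lborel_distr_plus)
    also have "\<dots> = emeasure lborel ((+) (a i) -` A i)" using A[OF that] by (subst emeasure_distr) auto
    finally show ?thesis by simp
  qed
  have "emeasure (distr (\<Pi>\<^sub>M i\<in>I. lborel) (\<Pi>\<^sub>M i\<in>I. lborel) (\<lambda>x. \<lambda>i\<in>I. a i + x i)) (Pi\<^sub>E I A)
     = emeasure (\<Pi>\<^sub>M i\<in>I. lborel) ((\<lambda>x. \<lambda>i\<in>I. a i + x i) -` Pi\<^sub>E I A \<inter> space (\<Pi>\<^sub>M i\<in>I. lborel))"
    using m I A by (intro emeasure_distr) (auto intro!: sets_PiM_I_finite)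
  also have "(\<lambda>x. \<lambda>i\<in>I. a i + x i) -` Pi\<^sub>E I A \<inter> space (\<Pi>\<^sub>M i\<in>I. lborel) = (\<Pi>\<^sub>E i\<in>I. (+) (a i) -` A i)"
    by (auto simp: space_PiM PiE_def Pi_def extensional_def)
  also have "emeasure (\<Pi>\<^sub>M i\<in>I. lborel) \<dots> = (\<Prod>i\<in>I. emeasure lborel ((+) (a i) -` A i))"
    using I B by (intro lborel_product.emeasure_PiM) auto
  also have "\<dots> = (\<Prod>i\<in>I. emeasure lborel (A i))" by (intro prod.cong e) auto
  finally show "emeasure (distr (\<Pi>\<^sub>M i\<in>I. lborel) (\<Pi>\<^sub>M i\<in>I. lborel) (\<lambda>x. \<lambda>i\<in>I. a i + x i)) (Pi\<^sub>E I A) =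
     (\<Prod>i\<in>I. emeasure lborel (A i))" .
qed

lemma nn_integral_lborel_vec_translate:
  assumes f: "f \<in> borel_measurable (borel_vec m)" and a: "a \<in> carrier_vec m"
  shows "(\<integral>\<^sup>+v. f (v + a) \<partial>lborel_vec m) = (\<integral>\<^sup>+v. f v \<partial>lborel_vec m)"
proof -
  let ?P = "\<Pi>\<^sub>M i\<in>{..<m}. (lborel :: real measure)"
  have fa: "(\<lambda>v. f (v + a)) \<in> borel_measurable (borel_vec m)"
    using a by (intro measurable_compose[OF measurable_add_vec[OF measurable_ident_sets[OF refl]
        measurable_const] f]) simp
  have g: "(\<lambda>x. f (Matrix.vec m x)) \<in> borel_measurable ?P"
    by (rule measurable_compose[OF measurable_vec_lborel f])
  have m: "(\<lambda>x. \<lambda>i\<in>{..<m}. a $ i + x i) \<in> ?P \<rightarrow>\<^sub>M ?P"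
    by (rule measurable_PiM_lborel_translate)
  have "(\<integral>\<^sup>+v. f v \<partial>lborel_vec m) = (\<integral>\<^sup>+x. f (Matrix.vec m x) \<partial>?P)" by (rule nn_integral_lborel_vec[OF f])
  also have "\<dots> = (\<integral>\<^sup>+x. f (Matrix.vec m x) \<partial>distr ?P ?P (\<lambda>x. \<lambda>i\<in>{..<m}. a $ i + x i))"
    by (subst distr_PiM_lborel_translate) auto
  also have "\<dots> = (\<integral>\<^sup>+x. f (Matrix.vec m (\<lambda>i\<in>{..<m}. a $ i + x i)) \<partial>?P)" using g m by (intro nn_integral_distr) auto
  also have "\<dots> = (\<integral>\<^sup>+x. f (Matrix.vec m x + a) \<partial>?P)"
    using a by (intro nn_integral_cong arg_cong[of _ _ f] eq_vecI) auto
  also have "\<dots> = (\<integral>\<^sup>+v. f (v + a) \<partial>lborel_vec m)" by (rule nn_integral_lborel_vec[OF fa, symmetric])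
  finally show ?thesis by simp
qed

definition gaussian_measure :: "nat \<Rightarrow> real mat \<Rightarrow> real Matrix.vec measure" where
  "gaussian_measure m S = density (lborel_vec m) (\<lambda>v. ennreal (gaussian_density S v))"

lemma sets_gaussian_measure [simp, measurable_cong]: "sets (gaussian_measure m S) = sets (borel_vec m)"
  by (simp add: gaussian_measure_def)

lemma space_gaussian_measure [simp]: "space (gaussian_measure m S) = carrier_vec m"
  by (simp add: gaussian_measure_def)

lemma gaussian_density_nonneg: "pos_def m S \<Longrightarrow> 0 < gaussian_density S v"
  unfolding gaussian_density_def using det_pos_def[of m S] by simp

lemma nn_integral_gaussian_measure:
  assumes S: "pos_def m S" and f: "f \<in> borel_measurable (borel_vec m)"
  shows "(\<integral>\<^sup>+v. f v \<partial>gaussian_measure m S) = (\<integral>\<^sup>+v. ennreal (gaussian_density S v) * f v \<partial>lborel_vec m)"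
  unfolding gaussian_measure_def using measurable_gaussian_density[OF S measurable_ident_sets[OF refl]] f
  by (intro nn_integral_density) (auto cong: measurable_cong_sets)

text \<open>Bayes' rule: prior times likelihood is posterior times evidence.\<close>
lemma (in linear_observation) gaussian_density_factor:
  assumes e: "dim_vec e = m" and u: "dim_vec u = r"
  shows "gaussian_density P e * gaussian_density V (u - C *\<^sub>v e) =
    gaussian_density P' (e - K *\<^sub>v u) * gaussian_density S u"
proof -
  let ?q = "\<lambda>A v. v \<bullet> (matinv A *\<^sub>v v)"
  have "exp (- ?q P e / 2) * exp (- ?q V (u - C *\<^sub>v e) / 2) = exp (- (?q P e + ?q V (u - C *\<^sub>v e)) / 2)"
    by (simp add: exp_add[symmetric] field_simps)
  also have "\<dots> = exp (- ?q P' (e - K *\<^sub>v u) / 2) * exp (- ?q S u / 2)"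
    unfolding complete_square[OF e u] by (simp add: exp_add[symmetric] field_simps)
  finally have 1: "exp (- ?q P e / 2) * exp (- ?q V (u - C *\<^sub>v e) / 2) = exp (- ?q P' (e - K *\<^sub>v u) / 2) *
      exp (- ?q S u / 2)" .
  have "sqrt ((2 * pi) ^ m * det P) * sqrt ((2 * pi) ^ r * det V) = sqrt
      ((2 * pi) ^ m * (2 * pi) ^ r * (det P * det V))"
    by (simp add: real_sqrt_mult)
  also have "\<dots> = sqrt ((2 * pi) ^ m * det P') * sqrt ((2 * pi) ^ r * det S)"
    unfolding det_posterior_innovation by (simp add: real_sqrt_mult)
  finally have 2: "sqrt ((2 * pi) ^ m * det P) * sqrt ((2 * pi) ^ r * det V) =
     sqrt ((2 * pi) ^ m * det P') * sqrt ((2 * pi) ^ r * det S)" .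
  show ?thesis unfolding gaussian_density_def times_divide_times_eq dims' 1 2 ..
qed

lemma (in linear_observation) measurable_innovation_map:
  assumes f: "f \<in> N \<rightarrow>\<^sub>M borel_vec m" and g: "g \<in> N \<rightarrow>\<^sub>M borel_vec r"
  shows "(\<lambda>z. (f z - K *\<^sub>v (C *\<^sub>v f z + g z), C *\<^sub>v f z + g z)) \<in> N \<rightarrow>\<^sub>M borel_vec m \<Otimes>\<^sub>M borel_vec r"
proof -
  have K: "K \<in> carrier_mat m r" using gain_dims by auto
  show ?thesis
    by (intro measurable_Pair measurable_minus_vec measurable_add_vec measurable_mult_mat_vec[OF C]
        measurable_mult_mat_vec[OF K] f g)
qed

text \<open>The joint density is rewritten by \<open>gaussian_density_factor\<close> between two translations of Lebesgue
  measure, \<open>v = u - C e\<close> before and \<open>e + K u\<close> after. Total mass 1 is not presupposed: the instance with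
  constant \<open>f\<close> is what normalizes the densities below.\<close>
lemma (in linear_observation) nn_integral_gaussian_update:
  assumes f: "f \<in> borel_measurable (borel_vec m \<Otimes>\<^sub>M borel_vec r)"
  shows "(\<integral>\<^sup>+e. \<integral>\<^sup>+v. f (e - K *\<^sub>v (C *\<^sub>v e + v), C *\<^sub>v e + v) \<partial>gaussian_measure r V \<partial>gaussian_measure m P) =
    (\<integral>\<^sup>+u. \<integral>\<^sup>+e. f (e, u) \<partial>gaussian_measure m P' \<partial>gaussian_measure r S)"
proof -
  have K: "K \<in> carrier_mat m r" using gain_dims by auto
  interpret m: sigma_finite_measure "lborel_vec m" by (rule sigma_finite_lborel_vec)
  interpret r: sigma_finite_measure "lborel_vec r" by (rule sigma_finite_lborel_vec)
  interpret mr: pair_sigma_finite "lborel_vec m" "lborel_vec r" ..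
  let ?g = "\<lambda>S v. ennreal (gaussian_density S v)"
  have fst: "fst \<in> borel_vec m \<Otimes>\<^sub>M borel_vec r \<rightarrow>\<^sub>M borel_vec m" and snd: "snd \<in> borel_vec m \<Otimes>\<^sub>M borel_vec
      r \<rightarrow>\<^sub>M borel_vec r"
    by measurable
  define F where "F = (\<lambda>(e, u). f (e - K *\<^sub>v u, u) * (?g P e * ?g V (u - C *\<^sub>v e)))"
  have "(\<lambda>z. (fst z - K *\<^sub>v snd z, snd z)) \<in> borel_vec m \<Otimes>\<^sub>M borel_vec r \<rightarrow>\<^sub>M borel_vec m \<Otimes>\<^sub>M borel_vec r"
    by (intro measurable_Pair measurable_minus_vec measurable_mult_mat_vec[OF K] fst snd)
  from measurable_compose[OF this f]
  have Ff: "F \<in> borel_measurable (borel_vec m \<Otimes>\<^sub>M borel_vec r)"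
    unfolding F_def split_beta
    by (intro borel_measurable_times_ennreal measurable_ennreal measurable_compose[OF _ measurable_ennreal]
       measurable_gaussian_density[OF P] measurable_gaussian_density[OF V] measurable_minus_vec
           measurable_mult_mat_vec[OF C] fst snd)
  have sec: "(\<lambda>u. F (e, u)) \<in> borel_measurable (borel_vec r)" if "e \<in> carrier_vec m" for e
    using measurable_compose[OF measurable_Pair1'[of e "borel_vec m" "borel_vec r"] Ff] that by simp
  have sec2: "(\<lambda>e. F (e, u)) \<in> borel_measurable (borel_vec m)" if "u \<in> carrier_vec r" for u
    using measurable_compose[OF measurable_Pair2'[of u "borel_vec r" "borel_vec m"] Ff] that by simp
  have fs: "(\<lambda>e. f (e, u)) \<in> borel_measurable (borel_vec m)" if "u \<in> carrier_vec r" for u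
    using measurable_compose[OF measurable_Pair2'[of u "borel_vec r" "borel_vec m"] f] that by simp
  have trans: "(\<lambda>z. (fst z - K *\<^sub>v (C *\<^sub>v fst z + snd z), C *\<^sub>v fst z + snd z)) \<in> borel_vec m \<Otimes>\<^sub>M
      borel_vec r \<rightarrow>\<^sub>M borel_vec m \<Otimes>\<^sub>M borel_vec r"
    by (rule measurable_innovation_map[OF fst snd])
  have fh: "(\<lambda>v. f (e - K *\<^sub>v (C *\<^sub>v e + v), C *\<^sub>v e + v)) \<in> borel_measurable (borel_vec r)" if "e \<in>
      carrier_vec m" for e
    using measurable_compose[OF measurable_Pair1'[of e "borel_vec m" "borel_vec r"]
        measurable_compose[OF trans f]] that by simp
  have gV: "(\<lambda>v. ?g V v) \<in> borel_measurable (borel_vec r)"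
    by (intro measurable_compose[OF _ measurable_ennreal] measurable_gaussian_density[OF V]
        measurable_ident_sets[OF refl])
  have inner: "?g P e * (\<integral>\<^sup>+v. f (e - K *\<^sub>v (C *\<^sub>v e + v), C *\<^sub>v e + v) \<partial>gaussian_measure r V) =
      (\<integral>\<^sup>+u. F (e, u) \<partial>lborel_vec r)"
    if e: "e \<in> carrier_vec m" for e
  proof -
    have "?g P e * (\<integral>\<^sup>+v. f (e - K *\<^sub>v (C *\<^sub>v e + v), C *\<^sub>v e + v) \<partial>gaussian_measure r V)
      = (\<integral>\<^sup>+v. ?g P e * (?g V v * f (e - K *\<^sub>v (C *\<^sub>v e + v), C *\<^sub>v e + v)) \<partial>lborel_vec r)"
      using fh[OF e] gV by (subst nn_integral_gaussian_measure[OF V])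
          (auto intro!: nn_integral_cmult[symmetric] cong: measurable_cong_sets)
    also have "\<dots> = (\<integral>\<^sup>+v. F (e, v + C *\<^sub>v e) \<partial>lborel_vec r)"
    proof (intro nn_integral_cong)
      fix v assume "v \<in> space (lborel_vec r)"
      then have v: "v \<in> carrier_vec r" by simp
      have "v + C *\<^sub>v e - C *\<^sub>v e = v" "v + C *\<^sub>v e = C *\<^sub>v e + v" using v e C by auto
      then show "?g P e * (?g V v * f (e - K *\<^sub>v (C *\<^sub>v e + v), C *\<^sub>v e + v)) = F (e, v + C *\<^sub>v e)"
        by (simp add: F_def mult_ac)
    qed
    also have "\<dots> = (\<integral>\<^sup>+u. F (e, u) \<partial>lborel_vec r)"
      using e C by (intro nn_integral_lborel_vec_translate sec) auto
    finally show ?thesis .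
  qed
  have inner2: "(\<integral>\<^sup>+e. F (e, u) \<partial>lborel_vec m) = ?g S u * (\<integral>\<^sup>+e. f (e, u) \<partial>gaussian_measure m P')"
    if u: "u \<in> carrier_vec r" for u
  proof -
    have "(\<integral>\<^sup>+e. F (e, u) \<partial>lborel_vec m) = (\<integral>\<^sup>+e. F (e + K *\<^sub>v u, u) \<partial>lborel_vec m)"
      using u K by (intro nn_integral_lborel_vec_translate[symmetric] sec2) auto
    also have "\<dots> = (\<integral>\<^sup>+e. ?g S u * (?g P' e * f (e, u)) \<partial>lborel_vec m)"
    proof (intro nn_integral_cong)
      fix e assume "e \<in> space (lborel_vec m)"
      then have e: "e \<in> carrier_vec m" by simp
      have *: "e + K *\<^sub>v u - K *\<^sub>v u = e" using u e K by auto
      have "gaussian_density P (e + K *\<^sub>v u) * gaussian_density V (u - C *\<^sub>v (e + K *\<^sub>v u)) =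
          gaussian_density P' e * gaussian_density S u"
        using gaussian_density_factor[of "e + K *\<^sub>v u" u] u e K by (simp add: *)
      then have "?g P (e + K *\<^sub>v u) * ?g V (u - C *\<^sub>v (e + K *\<^sub>v u)) = ?g P' e * ?g S u"
        using gaussian_density_nonneg[OF P] gaussian_density_nonneg[OF V]
            gaussian_density_nonneg[OF pos_def_posterior] gaussian_density_nonneg[OF pos_def_innovation]
        by (simp add: ennreal_mult[symmetric] less_imp_le)
      then show "F (e + K *\<^sub>v u, u) = ?g S u * (?g P' e * f (e, u))"
        unfolding F_def by (simp add: * mult_ac)
    qed
    also have "\<dots> = ?g S u * (\<integral>\<^sup>+e. ?g P' e * f (e, u) \<partial>lborel_vec m)"
      using fs[OF u] measurable_gaussian_density[OF pos_def_posterior measurable_ident_sets[OF refl]]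
      by (intro nn_integral_cmult) (auto cong: measurable_cong_sets)
    also have "\<dots> = ?g S u * (\<integral>\<^sup>+e. f (e, u) \<partial>gaussian_measure m P')"
      by (subst nn_integral_gaussian_measure[OF pos_def_posterior fs[OF u]]) simp
    finally show ?thesis .
  qed
  have F': "case_prod (\<lambda>e u. F (e, u)) \<in> borel_measurable (lborel_vec m \<Otimes>\<^sub>M lborel_vec r)"
    using Ff by (simp add: measurable_cong_sets[OF sets_pair_measure_cong[OF sets_lborel_vec sets_lborel_vec] refl])
  have "(\<integral>\<^sup>+e. \<integral>\<^sup>+v. f (e - K *\<^sub>v (C *\<^sub>v e + v), C *\<^sub>v e + v) \<partial>gaussian_measure r V \<partial>gaussian_measure m P)
    = (\<integral>\<^sup>+e. ?g P e * (\<integral>\<^sup>+v. f (e - K *\<^sub>v (C *\<^sub>v e + v), C *\<^sub>v e + v) \<partial>gaussian_measure r V) \<partial>lborel_vec m)"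
  proof (rule nn_integral_gaussian_measure[OF P])
    have gmV: "sigma_finite_measure (gaussian_measure r V)"
      unfolding gaussian_measure_def using gV by (subst r.sigma_finite_iff_density_finite)
          (auto cong: measurable_cong_sets)
    show "(\<lambda>e. \<integral>\<^sup>+v. f (e - K *\<^sub>v (C *\<^sub>v e + v), C *\<^sub>v e + v) \<partial>gaussian_measure r V) \<in> borel_measurable
        (borel_vec m)"
      using sigma_finite_measure.borel_measurable_nn_integral_fst[OF gmV, of "\<lambda>z. f
          (fst z - K *\<^sub>v (C *\<^sub>v fst z + snd z), C *\<^sub>v fst z + snd z)" "borel_vec m"]
        measurable_compose[OF trans f]
      by (simp add: measurable_cong_sets[OF sets_pair_measure_cong[OF refl sets_gaussian_measure] refl])
  qed
  also have "\<dots> = (\<integral>\<^sup>+e. \<integral>\<^sup>+u. F (e, u) \<partial>lborel_vec r \<partial>lborel_vec m)"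
    by (intro nn_integral_cong inner) auto
  also have "\<dots> = (\<integral>\<^sup>+u. \<integral>\<^sup>+e. F (e, u) \<partial>lborel_vec m \<partial>lborel_vec r)"
    by (rule mr.Fubini'[OF F', symmetric])
  also have "\<dots> = (\<integral>\<^sup>+u. ?g S u * (\<integral>\<^sup>+e. f (e, u) \<partial>gaussian_measure m P') \<partial>lborel_vec r)"
    by (intro nn_integral_cong inner2) auto
  also have "\<dots> = (\<integral>\<^sup>+u. \<integral>\<^sup>+e. f (e, u) \<partial>gaussian_measure m P' \<partial>gaussian_measure r S)"
  proof (rule nn_integral_gaussian_measure[OF pos_def_innovation, symmetric])
    have "(\<lambda>v. ?g P' v) \<in> borel_measurable (borel_vec m)"
      by (intro measurable_compose[OF _ measurable_ennreal]
          measurable_gaussian_density[OF pos_def_posterior] measurable_ident_sets[OF refl])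
    then have "sigma_finite_measure (gaussian_measure m P')"
      unfolding gaussian_measure_def by (subst m.sigma_finite_iff_density_finite) (auto cong: measurable_cong_sets)
    from sigma_finite_measure.borel_measurable_nn_integral_fst[OF this, of "\<lambda>(u, e). f (e, u)" "borel_vec r"]
    show "(\<lambda>u. \<integral>\<^sup>+e. f (e, u) \<partial>gaussian_measure m P') \<in> borel_measurable (borel_vec r)"
      using measurable_pair_swap[OF f]
      by (simp add: measurable_cong_sets[OF sets_pair_measure_cong[OF refl sets_gaussian_measure] refl])
  qed
  finally show ?thesis .
qed

section \<open>Gaussian measures\<close>

lemma matinv_smult_one: "0 < c \<Longrightarrow> matinv (c \<cdot>\<^sub>m 1\<^sub>m n) = (1 / c) \<cdot>\<^sub>m 1\<^sub>m n"
proof (rule matinv_unique[OF pos_def_smult_one])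
  assume c: "0 < c"
  have "(c \<cdot>\<^sub>m 1\<^sub>m n) * ((1 / c) \<cdot>\<^sub>m 1\<^sub>m n) = (1 / c) \<cdot>\<^sub>m ((c \<cdot>\<^sub>m 1\<^sub>m n) * 1\<^sub>m n)"
    by (rule mult_smult_distrib[of _ n n]) auto
  also have "\<dots> = 1\<^sub>m n" using c by (intro eq_matI) auto
  finally show "(c \<cdot>\<^sub>m 1\<^sub>m n) * ((1 / c) \<cdot>\<^sub>m 1\<^sub>m n) = 1\<^sub>m n" .
qed auto

lemma has_bochner_integral_eqI:
  assumes "has_bochner_integral M f x" "\<And>z. z \<in> space M \<Longrightarrow> f z = g z"
  shows "has_bochner_integral M g x"
  by (rule iffD1[OF has_bochner_integral_cong[OF refl assms(2) refl] assms(1)])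

lemma gaussian_density_scalar:
  assumes c: "0 < c"
  shows "gaussian_density (c \<cdot>\<^sub>m 1\<^sub>m n) (Matrix.vec n x) = (\<Prod>i<n. normal_density 0 (sqrt c) (x i))"
proof -
  let ?v = "Matrix.vec n x"
  have q: "?v \<bullet> (((1 / c) \<cdot>\<^sub>m 1\<^sub>m n) *\<^sub>v ?v) = (\<Sum>i<n. (x i)\<^sup>2 / c)"
    by (simp add: smult_one_mult_vec[of _ n]) (simp add: scalar_prod_def atLeast0LessThan power2_eq_square
        sum_divide_distrib)
  have e: "exp (- (\<Sum>i<n. (x i)\<^sup>2 / c) / 2) = (\<Prod>i<n. exp (- (x i)\<^sup>2 / (2 * c)))"
    by (simp add: exp_sum[symmetric] sum_negf[symmetric] sum_divide_distrib mult.commute)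
  have s: "sqrt ((2 * pi) ^ n * c ^ n) = (\<Prod>i<n. sqrt (2 * pi * c))"
    by (simp only: power_mult_distrib[of "2 * pi" c n, symmetric] real_sqrt_power prod_constant card_lessThan)
  show ?thesis
    unfolding gaussian_density_def matinv_smult_one[OF c] q e normal_density_def using c s
    by (simp add: prod_dividef mult.commute)
qed

lemma nn_integral_normal_density: "0 < \<sigma> \<Longrightarrow> (\<integral>\<^sup>+x. ennreal (normal_density \<mu> \<sigma> x) \<partial>lborel) = 1"
  by (subst nn_integral_eq_integral) auto

lemma nn_integral_gaussian_scalar:
  assumes c: "0 < c"
  shows "(\<integral>\<^sup>+v. 1 \<partial>gaussian_measure n (c \<cdot>\<^sub>m 1\<^sub>m n)) = 1"
proof -
  let ?S = "c \<cdot>\<^sub>m 1\<^sub>m n"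
  have S: "pos_def n ?S" by (rule pos_def_smult_one[OF c])
  have gS: "(\<lambda>v. ennreal (gaussian_density ?S v)) \<in> borel_measurable (borel_vec n)"
    by (intro measurable_compose[OF _ measurable_ennreal] measurable_gaussian_density[OF S]
        measurable_ident_sets[OF refl])
  have "(\<integral>\<^sup>+v. 1 \<partial>gaussian_measure n ?S) = (\<integral>\<^sup>+v. ennreal (gaussian_density ?S v) \<partial>lborel_vec n)"
    by (subst nn_integral_gaussian_measure[OF S]) auto
  also have "\<dots> = (\<integral>\<^sup>+x. (\<Prod>i<n. ennreal (normal_density 0 (sqrt c) (x i))) \<partial>(\<Pi>\<^sub>M i\<in>{..<n}. lborel))"
    unfolding nn_integral_lborel_vec[OF gS] by (simp add: gaussian_density_scalar[OF c] prod_ennreal)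
  also have "\<dots> = (\<Prod>i<n. \<integral>\<^sup>+x. ennreal (normal_density 0 (sqrt c) x) \<partial>lborel)"
    by (intro lborel_product.product_nn_integral_prod) auto
  also have "\<dots> = 1" using c by (simp add: nn_integral_normal_density)
  finally show ?thesis .
qed

text \<open>The product of the total masses for \<open>P\<close> and \<open>V\<close> equals that for the posterior and the innovation
  covariance. If the signal is one-dimensional, its prior and posterior have mass 1 as normal
  distributions on the line, so the mass for \<open>V\<close> survives a rank-one update. The induction starts at
  multiples of the identity, whose densities are products of one-dimensional ones.\<close>
lemma prob_space_gaussian_measure:
  assumes S: "pos_def n S"
  shows "prob_space (gaussian_measure n S)"
proof -
  have "(\<integral>\<^sup>+v. 1 \<partial>gaussian_measure n S) = 1"
  proof (rule pos_def_rank_one_induct[OF S, where Q="\<lambda>S. (\<integral>\<^sup>+v. 1 \<partial>gaussian_measure n S) = 1"])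
    show "(\<integral>\<^sup>+v. 1 \<partial>gaussian_measure n (c \<cdot>\<^sub>m 1\<^sub>m n)) = 1" if "0 < c" for c
      using nn_integral_gaussian_scalar[OF that] .
    fix X p C :: "real mat" assume a: "pos_def n X" "pos_def 1 p" "C \<in> carrier_mat n 1"
      and X: "(\<integral>\<^sup>+v. 1 \<partial>gaussian_measure n X) = 1"
    then interpret linear_observation 1 n p X C by unfold_locales
    have one: "(\<integral>\<^sup>+v. 1 \<partial>gaussian_measure 1 q) = 1" if "pos_def 1 q" for q
      using nn_integral_gaussian_scalar[OF pos_def_dim1(1)[OF that], of 1] pos_def_dim1(3)[OF that] by simp
    have "(\<integral>\<^sup>+e. \<integral>\<^sup>+v. 1 \<partial>gaussian_measure n X \<partial>gaussian_measure 1 p) =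
      (\<integral>\<^sup>+u. \<integral>\<^sup>+e. 1 \<partial>gaussian_measure 1 P' \<partial>gaussian_measure n (innovation_cov p X C))"
      using nn_integral_gaussian_update[of "\<lambda>_. 1"] by simp
    then show "(\<integral>\<^sup>+v. 1 \<partial>gaussian_measure n (innovation_cov p X C)) = 1"
      unfolding X one[OF a(2)] one[OF pos_def_posterior] by simp
  qed
  then show ?thesis by (intro prob_spaceI) simp
qed

lemma measurable_gaussian_pair:
  "fst \<in> gaussian_measure m P \<Otimes>\<^sub>M gaussian_measure r V \<rightarrow>\<^sub>M borel_vec m"
  "snd \<in> gaussian_measure m P \<Otimes>\<^sub>M gaussian_measure r V \<rightarrow>\<^sub>M borel_vec r"
  by (simp_all cong: measurable_cong_sets sets_pair_measure_cong add: measurable_fst' measurable_snd')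

text \<open>The product form says that the error of the linear estimate \<open>K u\<close> of \<open>e\<close> is independent of the
  observation \<open>u = C e + v\<close>. The whole filter rests on this independence.\<close>
lemma (in linear_observation) distr_gaussian_update:
  "distr (gaussian_measure m P \<Otimes>\<^sub>M gaussian_measure r V) (borel_vec m \<Otimes>\<^sub>M borel_vec r)
     (\<lambda>(e, v). (e - K *\<^sub>v (C *\<^sub>v e + v), C *\<^sub>v e + v)) = gaussian_measure m P' \<Otimes>\<^sub>M gaussian_measure r S"
  (is "distr ?N ?B ?f = ?R")
proof (rule measure_eqI)
  interpret P: prob_space "gaussian_measure m P" by (rule prob_space_gaussian_measure[OF P])
  interpret V: prob_space "gaussian_measure r V" by (rule prob_space_gaussian_measure[OF V])
  interpret P': prob_space "gaussian_measure m P'" by (rule prob_space_gaussian_measure[OF pos_def_posterior])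
  interpret S: prob_space "gaussian_measure r S" by (rule prob_space_gaussian_measure[OF pos_def_innovation])
  interpret PS: pair_sigma_finite "gaussian_measure m P'" "gaussian_measure r S" ..
  show "sets (distr ?N ?B ?f) = sets ?R" by (simp cong: sets_pair_measure_cong)
  fix A assume "A \<in> sets (distr ?N ?B ?f)"
  then have A: "A \<in> sets ?B" by simp
  have iA: "indicator A \<in> borel_measurable ?B" using A by simp
  have iA': "indicator A \<in> borel_measurable ?R"
    using A by (simp add: sets_pair_measure_cong[OF sets_gaussian_measure sets_gaussian_measure])
  have fst: "fst \<in> ?N \<rightarrow>\<^sub>M borel_vec m" and snd: "snd \<in> ?N \<rightarrow>\<^sub>M borel_vec r"
    by (rule measurable_gaussian_pair)+
  have f: "?f \<in> ?N \<rightarrow>\<^sub>M ?B"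
    unfolding split_beta
    by (rule measurable_innovation_map[OF fst snd])
  have "emeasure (distr ?N ?B ?f) A = (\<integral>\<^sup>+z. indicator A z \<partial>distr ?N ?B ?f)" using A by simp
  also have "\<dots> = (\<integral>\<^sup>+z. indicator A (?f z) \<partial>?N)" using f A by (intro nn_integral_distr) auto
  also have "\<dots> = (\<integral>\<^sup>+e. \<integral>\<^sup>+v. indicator A (?f (e, v)) \<partial>gaussian_measure r V \<partial>gaussian_measure m P)"
    by (rule V.nn_integral_fst[symmetric]) (rule measurable_compose[OF f iA])
  also have "\<dots> = (\<integral>\<^sup>+u. \<integral>\<^sup>+e. indicator A (e, u) \<partial>gaussian_measure m P' \<partial>gaussian_measure r S)"
    using nn_integral_gaussian_update[OF iA] by simp
  also have "\<dots> = (\<integral>\<^sup>+z. indicator A z \<partial>?R)" by (rule PS.nn_integral_snd[OF iA'])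
  also have "\<dots> = emeasure ?R A" using A by (simp add: sets_pair_measure_cong[OF sets_gaussian_measure
      sets_gaussian_measure])
  finally show "emeasure (distr ?N ?B ?f) A = emeasure ?R A" .
qed

lemma distr_pair_snd_prob:
  assumes "prob_space M" "prob_space N"
  shows "distr (M \<Otimes>\<^sub>M N) N snd = N"
proof (rule measure_eqI)
  interpret M: prob_space M by fact
  interpret N: prob_space N by fact
  fix A assume "A \<in> sets (distr (M \<Otimes>\<^sub>M N) N snd)"
  then have A: "A \<in> sets N" by simp
  then have "snd -` A \<inter> space (M \<Otimes>\<^sub>M N) = space M \<times> A"
    using sets.sets_into_space[OF A] by (auto simp: space_pair_measure)
  then show "emeasure (distr (M \<Otimes>\<^sub>M N) N snd) A = emeasure N A"
    using A by (simp add: emeasure_distr N.emeasure_pair_measure_Times M.emeasure_space_1)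
qed simp

lemma (in linear_observation) distr_gaussian_innovation:
  "distr (gaussian_measure m P \<Otimes>\<^sub>M gaussian_measure r V) (borel_vec r) (\<lambda>(e, v). C *\<^sub>v e + v) =
      gaussian_measure r S"
proof -
  let ?N = "gaussian_measure m P \<Otimes>\<^sub>M gaussian_measure r V" and ?B = "borel_vec m \<Otimes>\<^sub>M borel_vec r"
  let ?f = "\<lambda>(e, v). (e - K *\<^sub>v (C *\<^sub>v e + v), C *\<^sub>v e + v)"
  have fst: "fst \<in> ?N \<rightarrow>\<^sub>M borel_vec m" and snd: "snd \<in> ?N \<rightarrow>\<^sub>M borel_vec r"
    by (rule measurable_gaussian_pair)+
  have f: "?f \<in> ?N \<rightarrow>\<^sub>M ?B"
    unfolding split_beta
    by (rule measurable_innovation_map[OF fst snd])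
  have "distr ?N (borel_vec r) (\<lambda>(e, v). C *\<^sub>v e + v) = distr (distr ?N ?B ?f) (borel_vec r) snd"
    by (subst distr_distr[OF _ f]) (auto intro!: distr_cong)
  also have "\<dots> = distr (gaussian_measure m P' \<Otimes>\<^sub>M gaussian_measure r S) (gaussian_measure r S) snd"
    unfolding distr_gaussian_update by (intro distr_cong) auto
  also have "\<dots> = gaussian_measure r S"
    by (intro distr_pair_snd_prob prob_space_gaussian_measure pos_def_posterior pos_def_innovation)
  finally show ?thesis .
qed

lemma gaussian_measure_coordinate:
  assumes c: "0 < c"
  shows "distr (gaussian_measure 1 (c \<cdot>\<^sub>m 1\<^sub>m 1)) borel (\<lambda>v. v $ 0) = density lborel
      (\<lambda>x. ennreal (normal_density 0 (sqrt c) x))"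
  (is "?L = ?R")
proof (rule measure_eqI)
  let ?S = "c \<cdot>\<^sub>m 1\<^sub>m 1"
  have S: "pos_def 1 ?S" by (rule pos_def_smult_one[OF c])
  show "sets ?L = sets ?R" by simp
  fix A assume "A \<in> sets ?L"
  then have A: "A \<in> sets borel" by simp
  have v0: "(\<lambda>v. v $ 0) \<in> borel_vec 1 \<rightarrow>\<^sub>M borel" by (rule measurable_vec_index) simp
  have iA: "(\<lambda>v. indicator A (v $ 0) :: ennreal) \<in> borel_measurable (borel_vec 1)"
    by (rule measurable_compose[OF v0]) (use A in simp)
  have gA: "(\<lambda>v. ennreal (gaussian_density ?S v) * indicator A (v $ 0)) \<in> borel_measurable (borel_vec 1)"
    by (intro borel_measurable_times_ennreal iA measurable_compose[OF _ measurable_ennreal]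
        measurable_gaussian_density[OF S] measurable_ident_sets[OF refl])
  have "emeasure ?L A = (\<integral>\<^sup>+z. indicator A z \<partial>?L)" using A by simp
  also have "\<dots> = (\<integral>\<^sup>+v. indicator A (v $ 0) \<partial>gaussian_measure 1 ?S)"
    using v0 A by (intro nn_integral_distr) (auto cong: measurable_cong_sets)
  also have "\<dots> = (\<integral>\<^sup>+v. ennreal (gaussian_density ?S v) * indicator A (v $ 0) \<partial>lborel_vec 1)"
    by (rule nn_integral_gaussian_measure[OF S iA])
  also have "\<dots> = (\<integral>\<^sup>+x. ennreal (normal_density 0 (sqrt c) (x 0)) * indicator A (x 0) \<partial>(\<Pi>\<^sub>M i\<in>{0::nat}. lborel))"
    unfolding nn_integral_lborel_vec[OF gA] gaussian_density_scalar[OF c] by (simp add: lessThan_Suc)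
  also have "\<dots> = (\<integral>\<^sup>+x. ennreal (normal_density 0 (sqrt c) x) * indicator A x \<partial>lborel)"
    using A by (intro lborel_product.product_nn_integral_singleton[of "\<lambda>x. ennreal
        (normal_density 0 (sqrt c) x) * indicator A x" 0]) auto
  also have "\<dots> = emeasure ?R A" using A by (simp add: emeasure_density)
  finally show "emeasure ?L A = emeasure ?R A" .
qed

lemma gaussian_measure_coordinate_moments:
  assumes c: "0 < c"
  shows "has_bochner_integral (gaussian_measure 1 (c \<cdot>\<^sub>m 1\<^sub>m 1)) (\<lambda>v. v $ 0) 0"
    "has_bochner_integral (gaussian_measure 1 (c \<cdot>\<^sub>m 1\<^sub>m 1)) (\<lambda>v. (v $ 0)\<^sup>2) c"
proof -
  let ?G = "gaussian_measure 1 (c \<cdot>\<^sub>m 1\<^sub>m 1)" and ?D = "density lborel (\<lambda>x. ennreal (normal_density 0 (sqrt c) x))"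
  have v0: "(\<lambda>v. v $ 0) \<in> ?G \<rightarrow>\<^sub>M borel" using measurable_vec_index[of 0 1] by (simp cong: measurable_cong_sets)
  have *: "has_bochner_integral ?G (\<lambda>v. f (v $ 0)) x" if "has_bochner_integral lborel
      (\<lambda>y. normal_density 0 (sqrt c) y * f y) x"
    and f: "f \<in> borel_measurable borel" for f :: "real \<Rightarrow> real" and x
  proof -
    have "has_bochner_integral ?D f x"
      using that by (intro has_bochner_integral_density) auto
    then have "has_bochner_integral (distr ?G borel (\<lambda>v. v $ 0)) f x" unfolding gaussian_measure_coordinate[OF c] .
    then show ?thesis using f v0 by (simp add: has_bochner_integral_iff integrable_distr_eq integral_distr)
  qed
  show "has_bochner_integral ?G (\<lambda>v. v $ 0) 0"
    using *[of "\<lambda>x. x" 0] normal_moment_nz_1[of "sqrt c" 0] c by simp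
  show "has_bochner_integral ?G (\<lambda>v. (v $ 0)\<^sup>2) c"
    using *[of "\<lambda>x. x\<^sup>2" c] normal_moment_even[of "sqrt c" 0 1] c by simp
qed

text \<open>After adding an independent standard normal variable, \<open>a \<bullet> v\<close> is an observation whose law is
  \<open>N(0, a \<bullet> S a + 1)\<close> on the line. Integrating the added variable out subtracts the 1 again.\<close>
lemma gaussian_measure_linear_moments:
  assumes S: "pos_def n S" and a: "a \<in> carrier_vec n"
  shows "has_bochner_integral (gaussian_measure n S) (\<lambda>v. a \<bullet> v) 0"
    "has_bochner_integral (gaussian_measure n S) (\<lambda>v. (a \<bullet> v)\<^sup>2) (a \<bullet> (S *\<^sub>v a))"
proof -
  define C where "C = mat 1 n (\<lambda>(i, j). a $ j)"
  have C: "C \<in> carrier_mat 1 n" by (simp add: C_def)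
  have one: "1\<^sub>m 1 = (1::real) \<cdot>\<^sub>m 1\<^sub>m 1" by (intro eq_matI) auto
  have I: "pos_def 1 (1\<^sub>m 1)" by (subst one) (rule pos_def_smult_one, simp)
  interpret linear_observation n 1 S "1\<^sub>m 1" C using S I C by unfold_locales
  let ?S = "innovation_cov S (1\<^sub>m 1) C"
  define q where "q = a \<bullet> (S *\<^sub>v a)"
  have q0: "0 \<le> q" unfolding q_def using pos_semidef_nonneg[OF pos_def_imp_pos_semidef[OF S] a] .
  have rowC: "Matrix.row C 0 = a" using a by (intro eq_vecI) (auto simp: C_def)
  have "C * S * C\<^sup>T = C * (S * C\<^sup>T)" using dims by (simp add: mult_assoc_dim)
  moreover have "(C * (S * C\<^sup>T)) $$ (0, 0) = Matrix.row C 0 \<bullet> col (S * C\<^sup>T) 0" using dims by simp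
  moreover have "col (S * C\<^sup>T) 0 = S *\<^sub>v col (C\<^sup>T) 0" using pos_def_dim(4)[OF S] C by
      (intro col_mult2[of _ n n _ 1]) auto
  moreover have "col (C\<^sup>T) 0 = a" using rowC C by simp
  ultimately have "?S $$ (0, 0) = q + 1" using dims rowC by (simp add: innovation_cov_def q_def)
  then have Sq: "?S = (q + 1) \<cdot>\<^sub>m 1\<^sub>m 1" using pos_def_dim1(3)[OF pos_def_innovation] by simp
  let ?G = "gaussian_measure n S" and ?H = "gaussian_measure 1 (1\<^sub>m 1)"
  let ?N = "?G \<Otimes>\<^sub>M ?H"
  let ?U = "\<lambda>z. a \<bullet> fst z + snd z $ 0"
  interpret G: prob_space ?G by (rule prob_space_gaussian_measure[OF S])
  interpret H: prob_space ?H by (rule prob_space_gaussian_measure[OF I])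
  interpret GH: pair_sigma_finite ?G ?H ..
  have mom1: "has_bochner_integral ?H (\<lambda>v. v $ 0) 0" "has_bochner_integral ?H (\<lambda>v. (v $ 0)\<^sup>2) 1"
    using gaussian_measure_coordinate_moments[of 1] unfolding one[symmetric] by simp_all
  note momq = gaussian_measure_coordinate_moments[of "q + 1"]
  have q1: "0 < q + 1" using q0 by simp
  have fst: "fst \<in> ?N \<rightarrow>\<^sub>M borel_vec n" and snd: "snd \<in> ?N \<rightarrow>\<^sub>M borel_vec 1"
    by (rule measurable_gaussian_pair)+
  have g: "(\<lambda>(e, v). C *\<^sub>v e + v) \<in> ?N \<rightarrow>\<^sub>M borel_vec 1"
    unfolding split_beta by (intro measurable_add_vec measurable_mult_mat_vec[OF C] fst snd)
  have v0: "(\<lambda>v. v $ 0) \<in> borel_vec 1 \<rightarrow>\<^sub>M borel" by (rule measurable_vec_index) simp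
  have av: "(\<lambda>v. a \<bullet> v) \<in> borel_measurable ?G"
  proof -
    have "(\<lambda>v. a \<bullet> v) \<in> borel_measurable (borel_vec n)"
      using a by (intro measurable_scalar_prod[of _ _ n] measurable_ident_sets[OF refl] measurable_const) auto
    then show ?thesis by (simp cong: measurable_cong_sets)
  qed
  have avf: "(\<lambda>z. a \<bullet> fst z) \<in> borel_measurable ?N"
    using measurable_compose[OF measurable_fst av] .
  have vs: "(\<lambda>z. snd z $ 0) \<in> borel_measurable ?N" using measurable_compose[OF snd v0] .
  have gU: "(case z of (e, v) \<Rightarrow> C *\<^sub>v e + v) $ 0 = ?U z" if "z \<in> space ?N" for z
    using that rowC C by (auto simp: space_pair_measure)
  have pull: "has_bochner_integral ?N (\<lambda>z. f (?U z)) x"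
    if hb: "has_bochner_integral (gaussian_measure 1 ((q + 1) \<cdot>\<^sub>m 1\<^sub>m 1)) (\<lambda>v. f (v $ 0)) x"
      and f: "f \<in> borel_measurable borel" for f :: "real \<Rightarrow> real" and x
  proof -
    have fv: "(\<lambda>v. f (v $ 0)) \<in> borel_measurable (borel_vec 1)" by (rule measurable_compose[OF v0 f])
    have "has_bochner_integral (distr ?N (borel_vec 1) (\<lambda>(e, v). C *\<^sub>v e + v)) (\<lambda>v. f (v $ 0)) x"
      unfolding distr_gaussian_innovation Sq by (rule hb)
    then have "has_bochner_integral ?N (\<lambda>z. f ((case z of (e, v) \<Rightarrow> C *\<^sub>v e + v) $ 0)) x"
      using integrable_distr_eq[OF g fv] integral_distr[OF g fv] by (simp add: has_bochner_integral_iff)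
    then show ?thesis
      by (rule has_bochner_integral_eqI) (simp add: gU)
  qed
  have U1: "has_bochner_integral ?N ?U 0" using pull[of "\<lambda>x. x"] momq(1)[OF q1] by simp
  have U2: "has_bochner_integral ?N (\<lambda>z. (?U z)\<^sup>2) (q + 1)" using pull[of "\<lambda>x. x\<^sup>2"] momq(2)[OF q1] by simp
  have Hconst: "has_bochner_integral ?H (\<lambda>v. t) t" for t :: real
    using H.integrable_const[of t] H.prob_space
    by (simp add: has_bochner_integral_iff del: space_gaussian_measure One_nat_def)
  have inner1: "has_bochner_integral ?H (\<lambda>v. t + v $ 0) t" for t
  proof -
    have "has_bochner_integral ?H (\<lambda>v. t) t" by (rule Hconst)
    from has_bochner_integral_add[OF this mom1(1)] show ?thesis by simp
  qed
  have inner2: "has_bochner_integral ?H (\<lambda>v. (t + v $ 0)\<^sup>2) (t\<^sup>2 + 1)" for t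
  proof -
    have "has_bochner_integral ?H (\<lambda>v. t\<^sup>2) (t\<^sup>2)" by (rule Hconst)
    moreover have "has_bochner_integral ?H (\<lambda>v. 2 * t * v $ 0) (2 * t * 0)"
      by (intro has_bochner_integral_mult_right mom1)
    ultimately have "has_bochner_integral ?H (\<lambda>v. t\<^sup>2 + (v $ 0)\<^sup>2 + 2 * t * v $ 0) (t\<^sup>2 + 1 + 2 * t * 0)"
      by (intro has_bochner_integral_add mom1)
    then
    show ?thesis by (simp add: power2_sum add_ac)
  qed
  have inner3: "(\<integral>\<^sup>+v. ennreal ((t + v $ 0)\<^sup>2) \<partial>?H) = ennreal (t\<^sup>2) + 1" for t
    using inner2[of t] by (subst nn_integral_eq_integral) (auto simp: has_bochner_integral_iff ennreal_plus)
  have "ennreal (q + 1) = (\<integral>\<^sup>+z. ennreal ((?U z)\<^sup>2) \<partial>?N)"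
    using U2 q0 by (subst nn_integral_eq_integral) (auto simp: has_bochner_integral_iff)
  also have "\<dots> = (\<integral>\<^sup>+e. \<integral>\<^sup>+v. ennreal ((a \<bullet> e + v $ 0)\<^sup>2) \<partial>?H \<partial>?G)"
    using H.nn_integral_fst[of "\<lambda>z. ennreal ((?U z)\<^sup>2)" ?G] avf vs by simp
  also have "\<dots> = (\<integral>\<^sup>+e. ennreal ((a \<bullet> e)\<^sup>2) + 1 \<partial>?G)" unfolding inner3 ..
  also have "\<dots> = (\<integral>\<^sup>+e. ennreal ((a \<bullet> e)\<^sup>2) \<partial>?G) + 1"
    using av by (subst nn_integral_add) (auto simp: G.emeasure_space_1[simplified])
  finally have F: "ennreal (q + 1) = (\<integral>\<^sup>+e. ennreal ((a \<bullet> e)\<^sup>2) \<partial>?G) + 1" .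
  have "ennreal (q + 1) = ennreal q + ennreal 1" using q0 by (intro ennreal_plus) auto
  then have "ennreal (q + 1) = ennreal q + 1" unfolding ennreal_1 .
  from F[symmetric, THEN trans, OF this]
  have "(\<integral>\<^sup>+e. ennreal ((a \<bullet> e)\<^sup>2) \<partial>?G) + 1 = ennreal q + 1" .
  then have "(\<integral>\<^sup>+e. ennreal ((a \<bullet> e)\<^sup>2) \<partial>?G) = ennreal q"
    by (simp only: add.commute[of _ "1::ennreal"] ennreal_add_left_cancel) simp
  note X = this
  have sq: "(\<lambda>v. (a \<bullet> v)\<^sup>2) \<in> borel_measurable ?G" using av by (rule borel_measurable_power)
  have int: "integrable ?G (\<lambda>v. (a \<bullet> v)\<^sup>2) \<and> (\<integral>v. (a \<bullet> v)\<^sup>2 \<partial>?G) = q"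
    by (rule iffD1[OF nn_integral_eq_integrable[OF sq _ q0] X]) simp
  then show "has_bochner_integral ?G (\<lambda>v. (a \<bullet> v)\<^sup>2) (a \<bullet> (S *\<^sub>v a))"
    unfolding has_bochner_integral_iff q_def .
  have "integrable ?G (\<lambda>v. a \<bullet> v)"
    using int by (intro G.square_integrable_imp_integrable[OF av]) blast
  moreover have "(\<integral>e. a \<bullet> e \<partial>?G) = 0"
  proof -
    have i: "(\<integral>v. t + v $ 0 \<partial>?H) = t" for t using inner1 by (rule has_bochner_integral_integral_eq)
    have "(\<integral>e. (\<integral>v. ?U (e, v) \<partial>?H) \<partial>?G) = integral\<^sup>L ?N ?U"
      using U1 by (intro GH.integral_fst') (simp only: has_bochner_integral_iff)
    also have "\<dots> = 0" using U1 by (rule has_bochner_integral_integral_eq)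
    finally show ?thesis by (simp only: fst_conv snd_conv i)
  qed
  ultimately show "has_bochner_integral ?G (\<lambda>v. a \<bullet> v) 0" unfolding has_bochner_integral_iff by blast
qed

lemma gaussian_measure_mean:
  assumes S: "pos_def n S" and i: "i < n"
  shows "has_bochner_integral (gaussian_measure n S) (\<lambda>v. v $ i) 0"
proof (rule has_bochner_integral_eqI[OF gaussian_measure_linear_moments(1)[OF S, of "unit_vec n i"]])
  fix z assume "z \<in> space (gaussian_measure n S)"
  then show "unit_vec n i \<bullet> z = z $ i" using i by simp
qed simp

text \<open>Polarization of the second moments of linear forms.\<close>
lemma gaussian_measure_covariance:
  assumes S: "pos_def n S" and i: "i < n" and j: "j < n"
  shows "has_bochner_integral (gaussian_measure n S) (\<lambda>v. v $ i * v $ j) (S $$ (i, j))"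
proof -
  let ?u = "unit_vec n :: nat \<Rightarrow> real Matrix.vec"
  note d = pos_def_dim[OF S]
  have sym: "S $$ (j, i) = S $$ (i, j)" using d(1-3) i j by (metis index_transpose_mat(1))
  have qe: "?u k \<bullet> (S *\<^sub>v ?u l) = S $$ (k, l)" if "k < n" "l < n" for k l using that d by simp
  have "has_bochner_integral (gaussian_measure n S)
      (\<lambda>v. (((?u i + ?u j) \<bullet> v)\<^sup>2 - (?u i \<bullet> v)\<^sup>2 - (?u j \<bullet> v)\<^sup>2) / 2)
      (((?u i + ?u j) \<bullet> (S *\<^sub>v (?u i + ?u j)) - ?u i \<bullet> (S *\<^sub>v ?u i) - ?u j \<bullet> (S *\<^sub>v ?u j)) / 2)"
    by (intro has_bochner_integral_divide_zero has_bochner_integral_diff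
        gaussian_measure_linear_moments(2)[OF S]) auto
  moreover have "((?u i + ?u j) \<bullet> (S *\<^sub>v (?u i + ?u j)) - ?u i \<bullet> (S *\<^sub>v ?u i) - ?u j \<bullet> (S *\<^sub>v ?u j)) / 2 =
      S $$ (i, j)"
    using d i j sym by (simp add: mult_vec_add_dim scalar_add_left_dim scalar_add_right_dim qe del:
        scalar_prod_left_unit)
  moreover have "(((?u i + ?u j) \<bullet> v)\<^sup>2 - (?u i \<bullet> v)\<^sup>2 - (?u j \<bullet> v)\<^sup>2) / 2 = v $ i * v $ j"
    if "v \<in> space (gaussian_measure n S)" for v
    using that i j by (simp add: scalar_add_left_dim power2_sum)
  ultimately show ?thesis by (metis (no_types, lifting) has_bochner_integral_eqI)
qed

lemma gaussian_measure_quadratic: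
  assumes S: "pos_def n S" and B: "B \<in> carrier_mat n n"
  shows "has_bochner_integral (gaussian_measure n S) (\<lambda>v. v \<bullet> (B *\<^sub>v v)) (mtrace (B * S))"
proof -
  note d = pos_def_dim[OF S]
  have "has_bochner_integral (gaussian_measure n S) (\<lambda>v. \<Sum>i<n. \<Sum>j<n. B $$ (i, j) * (v $ i * v $ j))
     (\<Sum>i<n. \<Sum>j<n. B $$ (i, j) * S $$ (i, j))"
    by (intro has_bochner_integral_sum has_bochner_integral_mult_right gaussian_measure_covariance[OF S]) auto
  moreover have "(\<Sum>i<n. \<Sum>j<n. B $$ (i, j) * S $$ (i, j)) = mtrace (B * S)"
  proof -
    have "S $$ (i, j) = S $$ (j, i)" if "i < n" "j < n" for i j using that d(1-3) by (metis index_transpose_mat(1))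
    then show ?thesis unfolding mtrace_def using B d
      by (auto simp: scalar_prod_def atLeast0LessThan intro!: sum.cong)
  qed
  moreover have "(\<Sum>i<n. \<Sum>j<n. B $$ (i, j) * (v $ i * v $ j)) = v \<bullet> (B *\<^sub>v v)"
    if "v \<in> space (gaussian_measure n S)" for v
    using that scalar_mult_mat_vec_sum[OF B, of v v] by (simp add: mult_ac)
  ultimately show ?thesis by (metis (no_types, lifting) has_bochner_integral_eqI)
qed

section \<open>Independent pairs and the Gaussian estimation error\<close>

lemma distr_pair_fst_prob:
  assumes "prob_space M" "prob_space N"
  shows "distr (M \<Otimes>\<^sub>M N) M fst = M"
proof (rule measure_eqI)
  interpret M: prob_space M by fact
  interpret N: prob_space N by fact
  fix A assume "A \<in> sets (distr (M \<Otimes>\<^sub>M N) M fst)"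
  then have A: "A \<in> sets M" by simp
  then have "fst -` A \<inter> space (M \<Otimes>\<^sub>M N) = A \<times> space N"
    using sets.sets_into_space[OF A] by (auto simp: space_pair_measure)
  then show "emeasure (distr (M \<Otimes>\<^sub>M N) M fst) A = emeasure M A"
    using A by (simp add: emeasure_distr N.emeasure_pair_measure_Times N.emeasure_space_1)
qed simp

context prob_space
begin

text \<open>Independence as a product joint law; the two value types may differ.\<close>
definition indep_pair :: "'b measure \<Rightarrow> ('a \<Rightarrow> 'b) \<Rightarrow> 'c measure \<Rightarrow> ('a \<Rightarrow> 'c) \<Rightarrow> bool" where
  "indep_pair S X T Y \<longleftrightarrow> random_variable S X \<and> random_variable T Y \<and>
     distr M S X \<Otimes>\<^sub>M distr M T Y = distr M (S \<Otimes>\<^sub>M T) (\<lambda>\<omega>. (X \<omega>, Y \<omega>))"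

lemma indep_pair_cong_space:
  assumes "indep_pair S X T Y" "\<And>\<omega>. \<omega> \<in> space M \<Longrightarrow> X \<omega> = X' \<omega>" "\<And>\<omega>. \<omega> \<in> space M \<Longrightarrow> Y \<omega> = Y' \<omega>"
  shows "indep_pair S X' T Y'"
proof -
  have "random_variable S X' \<longleftrightarrow> random_variable S X" "random_variable T Y' \<longleftrightarrow> random_variable T Y"
    using assms(2,3) by (simp_all cong: measurable_cong)
  moreover have "distr M S X' = distr M S X" "distr M T Y' = distr M T Y"
    "distr M (S \<Otimes>\<^sub>M T) (\<lambda>\<omega>. (X' \<omega>, Y' \<omega>)) = distr M (S \<Otimes>\<^sub>M T) (\<lambda>\<omega>. (X \<omega>, Y \<omega>))"
    using assms(2,3) by (auto intro!: distr_cong)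
  ultimately show ?thesis using assms(1) unfolding indep_pair_def by simp
qed

lemma indep_pair_swap:
  assumes "indep_pair S X T Y" shows "indep_pair T Y S X"
proof -
  have X: "random_variable S X" and Y: "random_variable T Y"
    and XY: "distr M S X \<Otimes>\<^sub>M distr M T Y = distr M (S \<Otimes>\<^sub>M T) (\<lambda>\<omega>. (X \<omega>, Y \<omega>))"
    using assms by (auto simp: indep_pair_def)
  interpret X: prob_space "distr M S X" by (rule prob_space_distr[OF X])
  interpret Y: prob_space "distr M T Y" by (rule prob_space_distr[OF Y])
  interpret YX: pair_prob_space "distr M T Y" "distr M S X" ..
  have "distr M T Y \<Otimes>\<^sub>M distr M S X = distr (distr M (S \<Otimes>\<^sub>M T) (\<lambda>\<omega>. (X \<omega>, Y \<omega>)))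
      (distr M T Y \<Otimes>\<^sub>M distr M S X) (\<lambda>(x, y). (y, x))"
    using YX.distr_pair_swap unfolding XY .
  also have "\<dots> = distr (distr M (S \<Otimes>\<^sub>M T) (\<lambda>\<omega>. (X \<omega>, Y \<omega>))) (T \<Otimes>\<^sub>M S) (\<lambda>(x, y). (y, x))"
    by (intro distr_cong refl sets_pair_measure_cong) auto
  also have "\<dots> = distr M (T \<Otimes>\<^sub>M S) (\<lambda>\<omega>. (Y \<omega>, X \<omega>))"
    using X Y by (subst distr_distr) (auto simp: comp_def)
  finally show ?thesis using X Y by (simp add: indep_pair_def)
qed

lemma indep_pair_compose:
  assumes "indep_pair S X T Y" and f: "f \<in> S \<rightarrow>\<^sub>M S'" and g: "g \<in> T \<rightarrow>\<^sub>M T'"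
  shows "indep_pair S' (f \<circ> X) T' (g \<circ> Y)"
proof -
  have X: "random_variable S X" and Y: "random_variable T Y"
    and XY: "distr M S X \<Otimes>\<^sub>M distr M T Y = distr M (S \<Otimes>\<^sub>M T) (\<lambda>\<omega>. (X \<omega>, Y \<omega>))"
    using assms by (auto simp: indep_pair_def)
  have fX: "random_variable S' (f \<circ> X)" and gY: "random_variable T' (g \<circ> Y)"
    using measurable_comp[OF X f] measurable_comp[OF Y g] by auto
  have dX: "distr M S' (f \<circ> X) = distr (distr M S X) S' f" using X f by (simp add: distr_distr)
  have dY: "distr M T' (g \<circ> Y) = distr (distr M T Y) T' g" using Y g by (simp add: distr_distr)
  have "sigma_finite_measure (distr M T' (g \<circ> Y))"
    using prob_space_distr[OF gY] by (intro prob_space_imp_sigma_finite)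
  then have "distr M S' (f \<circ> X) \<Otimes>\<^sub>M distr M T' (g \<circ> Y) =
     distr (distr M S X \<Otimes>\<^sub>M distr M T Y) (S' \<Otimes>\<^sub>M T') (\<lambda>(x, y). (f x, g y))"
    unfolding dX dY using f g by (intro pair_measure_distr) auto
  also have "\<dots> = distr M (S' \<Otimes>\<^sub>M T') (\<lambda>\<omega>. ((f \<circ> X) \<omega>, (g \<circ> Y) \<omega>))"
  proof -
    have "(\<lambda>p. (f (fst p), g (snd p))) \<in> S \<Otimes>\<^sub>M T \<rightarrow>\<^sub>M S' \<Otimes>\<^sub>M T'"
      by (intro measurable_Pair measurable_compose[OF measurable_fst f] measurable_compose[OF measurable_snd g])
    then show ?thesis unfolding XY using X Y
      by (subst distr_distr) (auto simp: comp_def split_beta)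
  qed
  finally show ?thesis using fX gY by (simp add: indep_pair_def)
qed

text \<open>The triple has the product law under either bracketing, by Fubini's theorem. This is the step that
  moves an independent component from one side to the other.\<close>
lemma indep_pair_regroup:
  assumes XY: "indep_pair A X B Y" and XYZ: "indep_pair (A \<Otimes>\<^sub>M B) (\<lambda>\<omega>. (X \<omega>, Y \<omega>)) C Z"
  shows "indep_pair A X (B \<Otimes>\<^sub>M C) (\<lambda>\<omega>. (Y \<omega>, Z \<omega>))"
proof -
  have X: "random_variable A X" and Y: "random_variable B Y" and Z: "random_variable C Z"
    using XY XYZ by (auto simp: indep_pair_def)
  have "indep_pair B (snd \<circ> (\<lambda>\<omega>. (X \<omega>, Y \<omega>))) C (id \<circ> Z)"
    by (rule indep_pair_compose[OF XYZ]) auto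
  then have YZ: "indep_pair B Y C Z" by (simp add: comp_def)
  let ?X = "distr M A X" and ?Y = "distr M B Y" and ?Z = "distr M C Z"
  interpret X: prob_space ?X by (rule prob_space_distr[OF X])
  interpret Y: prob_space ?Y by (rule prob_space_distr[OF Y])
  interpret Z: prob_space ?Z by (rule prob_space_distr[OF Z])
  interpret YZ: pair_prob_space ?Y ?Z ..
  have dYZ: "distr M (B \<Otimes>\<^sub>M C) (\<lambda>\<omega>. (Y \<omega>, Z \<omega>)) = ?Y \<Otimes>\<^sub>M ?Z"
    using YZ by (simp add: indep_pair_def)
  have dXYZ: "distr M ((A \<Otimes>\<^sub>M B) \<Otimes>\<^sub>M C) (\<lambda>\<omega>. ((X \<omega>, Y \<omega>), Z \<omega>)) = (?X \<Otimes>\<^sub>M ?Y) \<Otimes>\<^sub>M ?Z"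
    using XY XYZ by (simp add: indep_pair_def)
  have "distr M (A \<Otimes>\<^sub>M (B \<Otimes>\<^sub>M C)) (\<lambda>\<omega>. (X \<omega>, Y \<omega>, Z \<omega>)) = ?X \<Otimes>\<^sub>M (?Y \<Otimes>\<^sub>M ?Z)"
  proof (rule measure_eqI)
    have s1: "sets (A \<Otimes>\<^sub>M (B \<Otimes>\<^sub>M C)) = sets (?X \<Otimes>\<^sub>M (?Y \<Otimes>\<^sub>M ?Z))"
      by (intro sets_pair_measure_cong) auto
    have s2: "sets ((A \<Otimes>\<^sub>M B) \<Otimes>\<^sub>M C) = sets ((?X \<Otimes>\<^sub>M ?Y) \<Otimes>\<^sub>M ?Z)"
      by (intro sets_pair_measure_cong) auto
    show "sets (distr M (A \<Otimes>\<^sub>M (B \<Otimes>\<^sub>M C)) (\<lambda>\<omega>. (X \<omega>, Y \<omega>, Z \<omega>))) = sets (?X \<Otimes>\<^sub>M (?Y \<Otimes>\<^sub>M ?Z))"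
      using s1 by simp
    fix U assume "U \<in> sets (distr M (A \<Otimes>\<^sub>M (B \<Otimes>\<^sub>M C)) (\<lambda>\<omega>. (X \<omega>, Y \<omega>, Z \<omega>)))"
    then have U: "U \<in> sets (A \<Otimes>\<^sub>M (B \<Otimes>\<^sub>M C))" by simp
    have iU: "indicator U \<in> borel_measurable (A \<Otimes>\<^sub>M (B \<Otimes>\<^sub>M C))" using U by simp
    have as: "(\<lambda>p. (fst (fst p), snd (fst p), snd p)) \<in> (A \<Otimes>\<^sub>M B) \<Otimes>\<^sub>M C \<rightarrow>\<^sub>M A \<Otimes>\<^sub>M (B \<Otimes>\<^sub>M C)" by measurable
    define g where "g p = (indicator U (fst (fst p), snd (fst p), snd p) :: ennreal)" for p
    have g: "g \<in> borel_measurable ((A \<Otimes>\<^sub>M B) \<Otimes>\<^sub>M C)"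
      unfolding g_def by (rule measurable_compose[OF as iU])
    have g': "g \<in> borel_measurable ((?X \<Otimes>\<^sub>M ?Y) \<Otimes>\<^sub>M ?Z)" using g by (simp add: measurable_cong_sets[OF s2 refl])
    have iU': "indicator U \<in> borel_measurable (?X \<Otimes>\<^sub>M (?Y \<Otimes>\<^sub>M ?Z))" using iU by
        (simp add: measurable_cong_sets[OF s1 refl])
    have XYZm: "(\<lambda>\<omega>. (X \<omega>, Y \<omega>, Z \<omega>)) \<in> M \<rightarrow>\<^sub>M A \<Otimes>\<^sub>M (B \<Otimes>\<^sub>M C)" and XYZm': "(\<lambda>\<omega>. ((X \<omega>, Y \<omega>), Z \<omega>)) \<in> M \<rightarrow>\<^sub>M
        (A \<Otimes>\<^sub>M B) \<Otimes>\<^sub>M C"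
      using X Y Z by measurable
    have "emeasure (distr M (A \<Otimes>\<^sub>M (B \<Otimes>\<^sub>M C)) (\<lambda>\<omega>. (X \<omega>, Y \<omega>, Z \<omega>))) U
      = (\<integral>\<^sup>+p. indicator U p \<partial>distr M (A \<Otimes>\<^sub>M (B \<Otimes>\<^sub>M C)) (\<lambda>\<omega>. (X \<omega>, Y \<omega>, Z \<omega>)))" using U by simp
    also have "\<dots> = (\<integral>\<^sup>+\<omega>. g ((X \<omega>, Y \<omega>), Z \<omega>) \<partial>M)"
      using XYZm iU by (subst nn_integral_distr) (auto simp: g_def)
    also have "\<dots> = (\<integral>\<^sup>+p. g p \<partial>distr M ((A \<Otimes>\<^sub>M B) \<Otimes>\<^sub>M C) (\<lambda>\<omega>. ((X \<omega>, Y \<omega>), Z \<omega>)))"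
      using XYZm' g by (subst nn_integral_distr) auto
    also have "\<dots> = (\<integral>\<^sup>+p. \<integral>\<^sup>+z. g (p, z) \<partial>?Z \<partial>(?X \<Otimes>\<^sub>M ?Y))"
      unfolding dXYZ by (rule Z.nn_integral_fst[OF g', symmetric])
    also have "\<dots> = (\<integral>\<^sup>+x. \<integral>\<^sup>+y. \<integral>\<^sup>+z. g ((x, y), z) \<partial>?Z \<partial>?Y \<partial>?X)"
      by (rule Y.nn_integral_fst[symmetric]) (rule Z.borel_measurable_nn_integral_fst[OF g'])
    also have "\<dots> = (\<integral>\<^sup>+x. \<integral>\<^sup>+q. indicator U (x, q) \<partial>(?Y \<Otimes>\<^sub>M ?Z) \<partial>?X)"
    proof (intro nn_integral_cong)
      fix x assume "x \<in> space ?X"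
      then have "(\<lambda>q. indicator U (x, q) :: ennreal) \<in> borel_measurable (?Y \<Otimes>\<^sub>M ?Z)"
        by (intro measurable_compose[OF measurable_Pair1' iU']) simp
      from Z.nn_integral_fst[OF this]
      show "(\<integral>\<^sup>+y. \<integral>\<^sup>+z. g ((x, y), z) \<partial>?Z \<partial>?Y) = (\<integral>\<^sup>+q. indicator U (x, q) \<partial>(?Y \<Otimes>\<^sub>M ?Z))"
        by (simp add: g_def)
    qed
    also have "\<dots> = (\<integral>\<^sup>+p. indicator U p \<partial>(?X \<Otimes>\<^sub>M (?Y \<Otimes>\<^sub>M ?Z)))"
      by (rule YZ.nn_integral_fst[OF iU'])
    also have "\<dots> = emeasure (?X \<Otimes>\<^sub>M (?Y \<Otimes>\<^sub>M ?Z)) U"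
      by (rule nn_integral_indicator) (use U in \<open>simp only: s1\<close>)
    finally show "emeasure (distr M (A \<Otimes>\<^sub>M (B \<Otimes>\<^sub>M C)) (\<lambda>\<omega>. (X \<omega>, Y \<omega>, Z \<omega>))) U = emeasure (?X \<Otimes>\<^sub>M (?Y \<Otimes>\<^sub>M ?Z)) U" .
  qed
  then show ?thesis unfolding indep_pair_def dYZ using X Y Z by simp
qed

text \<open>The invariant of the Kalman filter: the estimate \<open>h (Z)\<close> of \<open>X\<close> from the data \<open>Z\<close> has an error that is
  \<open>N(0, P)\<close> and independent of the data. It says that \<open>N(h (Z), P)\<close> is the conditional law of \<open>X\<close> given
  \<open>Z\<close> without referring to a density of the data.\<close>
definition gaussian_error ::
  "nat \<Rightarrow> real mat \<Rightarrow> ('a \<Rightarrow> real Matrix.vec) \<Rightarrow> 'b measure \<Rightarrow> ('a \<Rightarrow> 'b) \<Rightarrow> ('b \<Rightarrow> real Matrix.vec) \<Rightarrow> bool" where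
  "gaussian_error n P X N Z h \<longleftrightarrow> X \<in> M \<rightarrow>\<^sub>M borel_vec n \<and> h \<in> N \<rightarrow>\<^sub>M borel_vec n \<and>
     indep_pair (borel_vec n) (\<lambda>\<omega>. X \<omega> - h (Z \<omega>)) N Z \<and>
     distr M (borel_vec n) (\<lambda>\<omega>. X \<omega> - h (Z \<omega>)) = gaussian_measure n P"

lemma gaussian_errorD:
  assumes "gaussian_error n P X N Z h"
  shows "X \<in> M \<rightarrow>\<^sub>M borel_vec n" "h \<in> N \<rightarrow>\<^sub>M borel_vec n" "Z \<in> M \<rightarrow>\<^sub>M N"
    "indep_pair (borel_vec n) (\<lambda>\<omega>. X \<omega> - h (Z \<omega>)) N Z"
    "distr M (borel_vec n) (\<lambda>\<omega>. X \<omega> - h (Z \<omega>)) = gaussian_measure n P"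
    "(\<lambda>\<omega>. X \<omega> - h (Z \<omega>)) \<in> M \<rightarrow>\<^sub>M borel_vec n"
    "\<And>\<omega>. \<omega> \<in> space M \<Longrightarrow> X \<omega> \<in> carrier_vec n" "\<And>\<omega>. \<omega> \<in> space M \<Longrightarrow> h (Z \<omega>) \<in> carrier_vec n"
proof -
  show 1: "X \<in> M \<rightarrow>\<^sub>M borel_vec n" "h \<in> N \<rightarrow>\<^sub>M borel_vec n" "indep_pair (borel_vec n) (\<lambda>\<omega>. X \<omega> - h (Z \<omega>)) N Z"
    "distr M (borel_vec n) (\<lambda>\<omega>. X \<omega> - h (Z \<omega>)) = gaussian_measure n P"
    using assms by (auto simp: gaussian_error_def)
  then show 2: "Z \<in> M \<rightarrow>\<^sub>M N" "(\<lambda>\<omega>. X \<omega> - h (Z \<omega>)) \<in> M \<rightarrow>\<^sub>M borel_vec n" by (auto simp: indep_pair_def)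
  show "X \<omega> \<in> carrier_vec n" "h (Z \<omega>) \<in> carrier_vec n" if "\<omega> \<in> space M" for \<omega>
    using measurable_borel_vec_carrier[OF 1(1) that] measurable_borel_vec_carrier[OF
        measurable_compose[OF 2(1) 1(2)] that]
    by auto
qed

text \<open>The error is a function of \<open>(X, Z)\<close>, so the noise is independent of error and data jointly, and
  regrouping the three independent variables gives both claims.\<close>
lemma gaussian_error_noise:
  assumes G: "gaussian_error n P X N Z h"
    and ind: "indep_pair (borel_vec n \<Otimes>\<^sub>M N) (\<lambda>\<omega>. (X \<omega>, Z \<omega>)) (borel_vec r) V"
  shows "indep_pair (borel_vec n) (\<lambda>\<omega>. X \<omega> - h (Z \<omega>)) (borel_vec r) V"
    "indep_pair N Z (borel_vec n \<Otimes>\<^sub>M borel_vec r) (\<lambda>\<omega>. (X \<omega> - h (Z \<omega>), V \<omega>))"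
proof -
  note g = gaussian_errorD[OF G]
  have f: "fst \<in> borel_vec n \<Otimes>\<^sub>M N \<rightarrow>\<^sub>M borel_vec n" and s: "(\<lambda>p. h (snd p)) \<in> borel_vec n \<Otimes>\<^sub>M N \<rightarrow>\<^sub>M borel_vec n"
    using measurable_compose[OF measurable_snd g(2)] by auto
  have m: "(\<lambda>p. (snd p, fst p - h (snd p))) \<in> borel_vec n \<Otimes>\<^sub>M N \<rightarrow>\<^sub>M N \<Otimes>\<^sub>M borel_vec n"
    by (intro measurable_Pair measurable_minus_vec f s measurable_snd)
  have "indep_pair (N \<Otimes>\<^sub>M borel_vec n) ((\<lambda>p. (snd p, fst p - h (snd p))) \<circ> (\<lambda>\<omega>. (X \<omega>, Z \<omega>))) (borel_vec r) (id \<circ> V)"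
    by (rule indep_pair_compose[OF ind m]) simp
  then have 1: "indep_pair (N \<Otimes>\<^sub>M borel_vec n) (\<lambda>\<omega>. (Z \<omega>, X \<omega> - h (Z \<omega>))) (borel_vec r) V" by (simp add: comp_def)
  then show "indep_pair N Z (borel_vec n \<Otimes>\<^sub>M borel_vec r) (\<lambda>\<omega>. (X \<omega> - h (Z \<omega>), V \<omega>))"
    by (rule indep_pair_regroup[OF indep_pair_swap[OF g(4)]])
  have "indep_pair (borel_vec n) (snd \<circ> (\<lambda>\<omega>. (Z \<omega>, X \<omega> - h (Z \<omega>)))) (borel_vec r) (id \<circ> V)"
    by (rule indep_pair_compose[OF 1]) auto
  then show "indep_pair (borel_vec n) (\<lambda>\<omega>. X \<omega> - h (Z \<omega>)) (borel_vec r) V" by (simp add: comp_def)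
qed

text \<open>The new error is \<open>A\<close> times the old one plus the noise, and the old error and the noise together are
  independent of the data.\<close>
lemma gaussian_error_time_update:
  assumes G: "gaussian_error n P X N Z h"
    and ind: "indep_pair (borel_vec n \<Otimes>\<^sub>M N) (\<lambda>\<omega>. (X \<omega>, Z \<omega>)) (borel_vec r) w"
    and w: "distr M (borel_vec r) w = gaussian_measure r W"
    and P: "pos_def n P" and W: "pos_def r W" and A: "A \<in> carrier_mat r n"
    and X': "\<And>\<omega>. \<omega> \<in> space M \<Longrightarrow> X' \<omega> = A *\<^sub>v X \<omega> + w \<omega>"
  shows "gaussian_error r (innovation_cov P W A) X' N Z (\<lambda>z. A *\<^sub>v h z)"
proof -
  interpret linear_observation n r P W A using P W A by unfold_locales
  note g = gaussian_errorD[OF G]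
  have wm: "w \<in> M \<rightarrow>\<^sub>M borel_vec r" using ind by (auto simp: indep_pair_def)
  let ?E = "\<lambda>\<omega>. X \<omega> - h (Z \<omega>)"
  have X'm: "X' \<in> M \<rightarrow>\<^sub>M borel_vec r"
  proof -
    have "(\<lambda>\<omega>. A *\<^sub>v X \<omega> + w \<omega>) \<in> M \<rightarrow>\<^sub>M borel_vec r"
      by (intro measurable_add_vec measurable_mult_mat_vec[OF A] g(1) wm)
    then show ?thesis using X' by (simp cong: measurable_cong)
  qed
  have eq: "A *\<^sub>v ?E \<omega> + w \<omega> = X' \<omega> - A *\<^sub>v h (Z \<omega>)" if o: "\<omega> \<in> space M" for \<omega>
    using g(7,8)[OF o] measurable_borel_vec_carrier[OF wm o] A X'[OF o]
    by (intro eq_vecI) (auto simp: mult_minus_distrib_mat_vec[OF A])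
  have m: "(\<lambda>p. A *\<^sub>v fst p + snd p) \<in> borel_vec n \<Otimes>\<^sub>M borel_vec r \<rightarrow>\<^sub>M borel_vec r"
    by (intro measurable_add_vec measurable_mult_mat_vec[OF A] measurable_fst measurable_snd)
  have "indep_pair (borel_vec r) ((\<lambda>p. A *\<^sub>v fst p + snd p) \<circ> (\<lambda>\<omega>. (?E \<omega>, w \<omega>))) N (id \<circ> Z)"
    by (rule indep_pair_compose[OF indep_pair_swap[OF gaussian_error_noise(2)[OF G ind]] m]) simp
  then have i: "indep_pair (borel_vec r) (\<lambda>\<omega>. X' \<omega> - A *\<^sub>v h (Z \<omega>)) N Z"
    by (rule indep_pair_cong_space) (auto simp: eq)
  have "distr M (borel_vec n \<Otimes>\<^sub>M borel_vec r) (\<lambda>\<omega>. (?E \<omega>, w \<omega>)) = gaussian_measure n P \<Otimes>\<^sub>M gaussian_measure r W"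
    using gaussian_error_noise(1)[OF G ind] unfolding indep_pair_def g(5) w by simp
  moreover have "distr M (borel_vec r) (\<lambda>\<omega>. X' \<omega> - A *\<^sub>v h (Z \<omega>)) =
     distr (distr M (borel_vec n \<Otimes>\<^sub>M borel_vec r) (\<lambda>\<omega>. (?E \<omega>, w \<omega>))) (borel_vec r) (\<lambda>p. A *\<^sub>v fst p + snd p)"
    using g(6) wm by (subst distr_distr[OF m]) (auto intro!: distr_cong simp: eq)
  ultimately have "distr M (borel_vec r) (\<lambda>\<omega>. X' \<omega> - A *\<^sub>v h (Z \<omega>)) = gaussian_measure r S"
    using distr_gaussian_innovation[unfolded case_prod_unfold] by simp
  then show ?thesis unfolding gaussian_error_def using i X'm measurable_mult_mat_vec[OF A g(2)] by simp
qed

text \<open>Let \<open>E\<close> be the old error and \<open>I = C E + v\<close> the innovation. The new error \<open>E - K I\<close> is independent of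
  \<open>I\<close> by \<open>distr_gaussian_update\<close>, and both are functions of \<open>(E, v)\<close>, which is independent of \<open>Z\<close>. Hence the new
  error is independent of \<open>(I, Z)\<close>, and the enlarged data are a function of this pair.\<close>
lemma gaussian_error_measurement_update:
  assumes G: "gaussian_error n P X N Z h"
    and ind: "indep_pair (borel_vec n \<Otimes>\<^sub>M N) (\<lambda>\<omega>. (X \<omega>, Z \<omega>)) (borel_vec r) v"
    and v: "distr M (borel_vec r) v = gaussian_measure r V"
    and P: "pos_def n P" and V: "pos_def r V" and C: "C \<in> carrier_mat r n"
  shows "gaussian_error n (posterior_cov P V C) X (borel_vec r \<Otimes>\<^sub>M N) (\<lambda>\<omega>. (C *\<^sub>v X \<omega> + v \<omega>, Z \<omega>))
    (\<lambda>(y, z). h z + kalman_gain P V C *\<^sub>v (y - C *\<^sub>v h z))"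
proof -
  interpret linear_observation n r P V C using P V C by unfold_locales
  have K: "K \<in> carrier_mat n r" using gain_dims by auto
  note g = gaussian_errorD[OF G]
  have vm: "v \<in> M \<rightarrow>\<^sub>M borel_vec r" using ind by (auto simp: indep_pair_def)
  define E where "E \<omega> = X \<omega> - h (Z \<omega>)" for \<omega>
  define I where "I \<omega> = C *\<^sub>v E \<omega> + v \<omega>" for \<omega>
  define E' where "E' \<omega> = E \<omega> - K *\<^sub>v I \<omega>" for \<omega>
  have Em: "E \<in> M \<rightarrow>\<^sub>M borel_vec n" using g(6) by (simp add: E_def[abs_def])
  have Im: "I \<in> M \<rightarrow>\<^sub>M borel_vec r" unfolding I_def[abs_def] by
      (intro measurable_add_vec measurable_mult_mat_vec[OF C] Em vm)
  have E'm: "E' \<in> M \<rightarrow>\<^sub>M borel_vec n" unfolding E'_def[abs_def] by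
      (intro measurable_minus_vec measurable_mult_mat_vec[OF K] Em Im)
  let ?f = "\<lambda>(e, v). (e - K *\<^sub>v (C *\<^sub>v e + v), C *\<^sub>v e + v)"
  have f: "?f \<in> borel_vec n \<Otimes>\<^sub>M borel_vec r \<rightarrow>\<^sub>M borel_vec n \<Otimes>\<^sub>M borel_vec r"
    unfolding split_beta
    by (rule measurable_innovation_map[OF measurable_fst measurable_snd])
  have "distr M (borel_vec n \<Otimes>\<^sub>M borel_vec r) (\<lambda>\<omega>. (E \<omega>, v \<omega>)) = gaussian_measure n P \<Otimes>\<^sub>M gaussian_measure r V"
    using gaussian_error_noise(1)[OF G ind] unfolding indep_pair_def g(5) v E_def by simp
  moreover have "distr M (borel_vec n \<Otimes>\<^sub>M borel_vec r) (\<lambda>\<omega>. (E' \<omega>, I \<omega>)) =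
     distr (distr M (borel_vec n \<Otimes>\<^sub>M borel_vec r) (\<lambda>\<omega>. (E \<omega>, v \<omega>))) (borel_vec n \<Otimes>\<^sub>M borel_vec r) ?f"
    using Em vm by (subst distr_distr[OF f]) (auto intro!: distr_cong simp: E'_def I_def)
  ultimately have joint: "distr M (borel_vec n \<Otimes>\<^sub>M borel_vec r) (\<lambda>\<omega>. (E' \<omega>, I \<omega>)) = gaussian_measure n P'
      \<Otimes>\<^sub>M gaussian_measure r S"
    using distr_gaussian_update by simp
  have pP': "prob_space (gaussian_measure n P')" and pS: "prob_space (gaussian_measure r S)"
    by (intro prob_space_gaussian_measure pos_def_posterior pos_def_innovation)+
  have dE': "distr M (borel_vec n) E' = gaussian_measure n P'"
  proof -
    have "distr M (borel_vec n) E' = distr (distr M (borel_vec n \<Otimes>\<^sub>M borel_vec r) (\<lambda>\<omega>. (E' \<omega>, I \<omega>)))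
        (borel_vec n) fst"
      using E'm Im by (subst distr_distr) (auto simp: comp_def)
    also have "\<dots> = distr (gaussian_measure n P' \<Otimes>\<^sub>M gaussian_measure r S) (gaussian_measure n P') fst"
      unfolding joint by (intro distr_cong) auto
    finally show ?thesis unfolding distr_pair_fst_prob[OF pP' pS] .
  qed
  have dI: "distr M (borel_vec r) I = gaussian_measure r S"
  proof -
    have "distr M (borel_vec r) I = distr (distr M (borel_vec n \<Otimes>\<^sub>M borel_vec r) (\<lambda>\<omega>. (E' \<omega>, I \<omega>)))
        (borel_vec r) snd"
      using E'm Im by (subst distr_distr) (auto simp: comp_def)
    also have "\<dots> = distr (gaussian_measure n P' \<Otimes>\<^sub>M gaussian_measure r S) (gaussian_measure r S) snd"
      unfolding joint by (intro distr_cong) auto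
    finally show ?thesis unfolding distr_pair_snd_prob[OF pP' pS] .
  qed
  have E'I: "indep_pair (borel_vec n) E' (borel_vec r) I"
    unfolding indep_pair_def joint dE' dI using E'm Im by simp
  have "indep_pair (borel_vec n \<Otimes>\<^sub>M borel_vec r) (?f \<circ> (\<lambda>\<omega>. (X \<omega> - h (Z \<omega>), v \<omega>))) N (id \<circ> Z)"
    by (rule indep_pair_compose[OF indep_pair_swap[OF gaussian_error_noise(2)[OF G ind]] f]) simp
  then have "indep_pair (borel_vec n \<Otimes>\<^sub>M borel_vec r) (\<lambda>\<omega>. (E' \<omega>, I \<omega>)) N Z"
    by (simp add: comp_def E'_def[abs_def] I_def[abs_def] E_def[abs_def])
  from indep_pair_regroup[OF E'I this]
  have E'IZ: "indep_pair (borel_vec n) E' (borel_vec r \<Otimes>\<^sub>M N) (\<lambda>\<omega>. (I \<omega>, Z \<omega>))" .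
  have hs: "(\<lambda>p. h (snd p)) \<in> borel_vec r \<Otimes>\<^sub>M N \<rightarrow>\<^sub>M borel_vec n" using measurable_compose[OF measurable_snd g(2)] .
  have m: "(\<lambda>p. (C *\<^sub>v h (snd p) + fst p, snd p)) \<in> borel_vec r \<Otimes>\<^sub>M N \<rightarrow>\<^sub>M borel_vec r \<Otimes>\<^sub>M N"
    by (intro measurable_Pair measurable_add_vec measurable_mult_mat_vec[OF C] hs measurable_fst measurable_snd)
  have "indep_pair (borel_vec n) (id \<circ> E') (borel_vec r \<Otimes>\<^sub>M N)
      ((\<lambda>p. (C *\<^sub>v h (snd p) + fst p, snd p)) \<circ> (\<lambda>\<omega>. (I \<omega>, Z \<omega>)))"
    by (rule indep_pair_compose[OF E'IZ _ m]) simp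
  then have i: "indep_pair (borel_vec n) E' (borel_vec r \<Otimes>\<^sub>M N) (\<lambda>\<omega>. (C *\<^sub>v h (Z \<omega>) + I \<omega>, Z \<omega>))"
    by (simp add: comp_def)
  let ?Z = "\<lambda>\<omega>. (C *\<^sub>v X \<omega> + v \<omega>, Z \<omega>)" and ?h = "\<lambda>(y, z). h z + K *\<^sub>v (y - C *\<^sub>v h z)"
  have eqY: "C *\<^sub>v h (Z \<omega>) + I \<omega> = C *\<^sub>v X \<omega> + v \<omega>" if o: "\<omega> \<in> space M" for \<omega>
    using g(7,8)[OF o] measurable_borel_vec_carrier[OF vm o] C unfolding I_def E_def
    by (intro eq_vecI) (auto simp: mult_minus_distrib_mat_vec[OF C])
  have eqI: "C *\<^sub>v X \<omega> + v \<omega> - C *\<^sub>v h (Z \<omega>) = I \<omega>" if o: "\<omega> \<in> space M" for \<omega>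
    using g(7,8)[OF o] measurable_borel_vec_carrier[OF vm o] C unfolding I_def E_def
    by (intro eq_vecI) (auto simp: mult_minus_distrib_mat_vec[OF C])
  have eqE: "E' \<omega> = X \<omega> - ?h (?Z \<omega>)" if o: "\<omega> \<in> space M" for \<omega>
    using g(7,8)[OF o] measurable_borel_vec_carrier[OF Im o] K unfolding E'_def E_def split eqI[OF o]
    by (intro eq_vecI) auto
  have hm: "?h \<in> borel_vec r \<Otimes>\<^sub>M N \<rightarrow>\<^sub>M borel_vec n"
    unfolding split_beta
    by (intro measurable_add_vec measurable_mult_mat_vec[OF K] measurable_minus_vec
        measurable_mult_mat_vec[OF C] hs measurable_fst)
  show ?thesis unfolding gaussian_error_def
  proof (intro conjI)
    show "X \<in> M \<rightarrow>\<^sub>M borel_vec n" by (rule g)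
    show "?h \<in> borel_vec r \<Otimes>\<^sub>M N \<rightarrow>\<^sub>M borel_vec n" by (rule hm)
    show "indep_pair (borel_vec n) (\<lambda>\<omega>. X \<omega> - ?h (?Z \<omega>)) (borel_vec r \<Otimes>\<^sub>M N) ?Z"
      by (rule indep_pair_cong_space[OF i]) (auto simp: eqE eqY)
    have "distr M (borel_vec n) (\<lambda>\<omega>. X \<omega> - ?h (?Z \<omega>)) = distr M (borel_vec n) E'"
      by (intro distr_cong) (auto simp: eqE)
    then show "distr M (borel_vec n) (\<lambda>\<omega>. X \<omega> - ?h (?Z \<omega>)) = gaussian_measure n P'" unfolding dE' .
  qed
qed

lemma gaussian_error_reparam:
  assumes G: "gaussian_error n P X N Z h" and f: "f \<in> N \<rightarrow>\<^sub>M N'" and h': "h' \<in> N' \<rightarrow>\<^sub>M borel_vec n"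
    and Z': "\<And>\<omega>. \<omega> \<in> space M \<Longrightarrow> Z' \<omega> = f (Z \<omega>)"
    and hh': "\<And>\<omega>. \<omega> \<in> space M \<Longrightarrow> h' (Z' \<omega>) = h (Z \<omega>)"
  shows "gaussian_error n P X N' Z' h'"
proof -
  note g = gaussian_errorD[OF G]
  have "indep_pair (borel_vec n) (id \<circ> (\<lambda>\<omega>. X \<omega> - h (Z \<omega>))) N' (f \<circ> Z)"
    by (rule indep_pair_compose[OF g(4) _ f]) simp
  then have "indep_pair (borel_vec n) (\<lambda>\<omega>. X \<omega> - h' (Z' \<omega>)) N' Z'"
    by (rule indep_pair_cong_space) (auto simp: hh' Z'[symmetric])
  moreover have "distr M (borel_vec n) (\<lambda>\<omega>. X \<omega> - h' (Z' \<omega>)) = gaussian_measure n P"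
    unfolding g(5)[symmetric] by (intro distr_cong) (auto simp: hh')
  ultimately show ?thesis unfolding gaussian_error_def using g(1) h' by simp
qed

end

section \<open>Mutual information and conditional expectation\<close>

lemma has_bochner_integral_of_law:
  fixes f :: "'b \<Rightarrow> real"
  assumes Y: "Y \<in> M \<rightarrow>\<^sub>M N" and law: "distr M N Y = L" and hb: "has_bochner_integral L f c"
    and f: "f \<in> borel_measurable N"
  shows "has_bochner_integral M (\<lambda>\<omega>. f (Y \<omega>)) c"
  using hb integrable_distr_eq[OF Y f] integral_distr[OF Y f] unfolding law[symmetric] by
      (simp add: has_bochner_integral_iff)

lemma ln_gaussian_density:
  assumes S: "pos_def n S"
  shows "ln (gaussian_density S v) = - (v \<bullet> (matinv S *\<^sub>v v)) / 2 - (real n * ln (2 * pi) + ln (det S)) / 2"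
proof -
  have "0 < det S" by (rule det_pos_def[OF S])
  then have "ln (sqrt ((2 * pi) ^ n * det S)) = (real n * ln (2 * pi) + ln (det S)) / 2"
    by (simp add: ln_sqrt ln_mult ln_realpow algebra_simps)
  then show ?thesis
    unfolding gaussian_density_def using \<open>0 < det S\<close> pos_def_dim[OF S]
    by (subst ln_div) auto
qed

lemma gaussian_measure_mahalanobis:
  assumes S: "pos_def n S"
  shows "has_bochner_integral (gaussian_measure n S) (\<lambda>v. v \<bullet> (matinv S *\<^sub>v v)) (real n)"
  using gaussian_measure_quadratic[OF S pos_def_matinv(5)[OF S]]
  unfolding pos_def_matinv(2)[OF S] by (simp add: mtrace_def)

lemma measurable_quadratic:
  assumes B: "B \<in> carrier_mat n n"
  shows "(\<lambda>v. v \<bullet> (B *\<^sub>v v)) \<in> borel_measurable (borel_vec n)"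
  by (intro measurable_scalar_prod[of _ _ n] measurable_mult_mat_vec[OF B] measurable_ident_sets[OF refl])

context prob_space
begin

text \<open>Given \<open>z\<close>, the variable \<open>X\<close> is the error translated by \<open>h z\<close>, with Lebesgue density
  \<open>x \<mapsto> N(x - h z; P)\<close>. The reference law has a positive density, so the quotient is defined everywhere.\<close>
lemma gaussian_error_joint_density:
  assumes G: "gaussian_error n P X N Z h" and P: "pos_def n P" and S: "pos_def n S"
  shows "distr M (borel_vec n \<Otimes>\<^sub>M N) (\<lambda>\<omega>. (X \<omega>, Z \<omega>)) =
    density (gaussian_measure n S \<Otimes>\<^sub>M distr M N Z)
      (\<lambda>(x, z). ennreal (gaussian_density P (x - h z) / gaussian_density S x))"
    (is "?J = density ?R ?f")
proof (rule measure_eqI)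
  note g = gaussian_errorD[OF G]
  let ?gS = "gaussian_measure n S" and ?gP = "gaussian_measure n P" and ?nu = "distr M N Z"
  interpret gS: prob_space ?gS by (rule prob_space_gaussian_measure[OF S])
  interpret gP: prob_space ?gP by (rule prob_space_gaussian_measure[OF P])
  interpret nu: prob_space ?nu by (rule prob_space_distr[OF g(3)])
  interpret R: pair_sigma_finite ?gS ?nu ..
  interpret PN: pair_sigma_finite ?gP ?nu ..
  have sR: "sets ?R = sets (borel_vec n \<Otimes>\<^sub>M N)" by (intro sets_pair_measure_cong) auto
  have sPN: "sets (?gP \<Otimes>\<^sub>M ?nu) = sets (borel_vec n \<Otimes>\<^sub>M N)" by (intro sets_pair_measure_cong) auto
  show "sets ?J = sets (density ?R ?f)" using sR by simp
  fix U assume "U \<in> sets ?J"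
  then have U: "U \<in> sets (borel_vec n \<Otimes>\<^sub>M N)" by simp
  have iU: "(indicator U :: _ \<Rightarrow> ennreal) \<in> borel_measurable (borel_vec n \<Otimes>\<^sub>M N)" using U by simp
  have hs: "(\<lambda>p. h (snd p)) \<in> borel_vec n \<Otimes>\<^sub>M N \<rightarrow>\<^sub>M borel_vec n" using measurable_compose[OF measurable_snd g(2)] .
  have fm: "?f \<in> borel_measurable (borel_vec n \<Otimes>\<^sub>M N)"
    unfolding split_beta
    by (intro measurable_compose[OF _ measurable_ennreal] borel_measurable_divide measurable_gaussian_density[OF P]
        measurable_gaussian_density[OF S] measurable_minus_vec measurable_fst hs)
  have fm': "?f \<in> borel_measurable ?R" using fm by (simp add: measurable_cong_sets[OF sR refl])
  have sh: "(\<lambda>p. (fst p + h (snd p), snd p)) \<in> borel_vec n \<Otimes>\<^sub>M N \<rightarrow>\<^sub>M borel_vec n \<Otimes>\<^sub>M N"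
    by (intro measurable_Pair measurable_add_vec measurable_fst hs measurable_snd)
  have ish: "(\<lambda>p. indicator U (fst p + h (snd p), snd p) :: ennreal) \<in> borel_measurable (borel_vec n \<Otimes>\<^sub>M N)"
    by (rule measurable_compose[OF sh iU])
  have EZ: "(\<lambda>\<omega>. (X \<omega> - h (Z \<omega>), Z \<omega>)) \<in> M \<rightarrow>\<^sub>M borel_vec n \<Otimes>\<^sub>M N" by (intro measurable_Pair g)
  have XZ: "(\<lambda>\<omega>. (X \<omega>, Z \<omega>)) \<in> M \<rightarrow>\<^sub>M borel_vec n \<Otimes>\<^sub>M N" by (intro measurable_Pair g)
  have EZd: "distr M (borel_vec n \<Otimes>\<^sub>M N) (\<lambda>\<omega>. (X \<omega> - h (Z \<omega>), Z \<omega>)) = ?gP \<Otimes>\<^sub>M ?nu"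
    using g(4) unfolding indep_pair_def g(5) by simp
  have "emeasure ?J U = (\<integral>\<^sup>+p. indicator U p \<partial>?J)" using U by simp
  also have "\<dots> = (\<integral>\<^sup>+\<omega>. indicator U (X \<omega>, Z \<omega>) \<partial>M)" using iU by (intro nn_integral_distr XZ) simp
  also have "\<dots> = (\<integral>\<^sup>+\<omega>. indicator U (X \<omega> - h (Z \<omega>) + h (Z \<omega>), Z \<omega>) \<partial>M)"
  proof (rule nn_integral_cong)
    fix \<omega> assume o: "\<omega> \<in> space M"
    have "X \<omega> - h (Z \<omega>) + h (Z \<omega>) = X \<omega>" using g(7,8)[OF o] by (intro eq_vecI) auto
    then show "indicator U (X \<omega>, Z \<omega>) = (indicator U (X \<omega> - h (Z \<omega>) + h (Z \<omega>), Z \<omega>) :: ennreal)" by simp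
  qed
  also have "\<dots> = (\<integral>\<^sup>+p. indicator U (fst p + h (snd p), snd p) \<partial>distr M (borel_vec n \<Otimes>\<^sub>M N)
      (\<lambda>\<omega>. (X \<omega> - h (Z \<omega>), Z \<omega>)))"
    using ish by (subst nn_integral_distr[OF EZ]) simp_all
  also have "\<dots> = (\<integral>\<^sup>+z. \<integral>\<^sup>+e. indicator U (e + h z, z) \<partial>?gP \<partial>?nu)"
    unfolding EZd using PN.nn_integral_snd[of "\<lambda>p. indicator U (fst p + h (snd p), snd p)"] ish
    by (simp add: measurable_cong_sets[OF sPN refl])
  also have "\<dots> = (\<integral>\<^sup>+z. \<integral>\<^sup>+x. ?f (x, z) * indicator U (x, z) \<partial>?gS \<partial>?nu)"
  proof (rule nn_integral_cong)
    fix z assume "z \<in> space ?nu"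
    then have z: "z \<in> space N" by simp
    then have hz: "h z \<in> carrier_vec n" using measurable_borel_vec_carrier[OF g(2)] by simp
    have sec: "(\<lambda>x. F (x, z)) \<in> borel_measurable (borel_vec n)" if "F \<in> borel_measurable
        (borel_vec n \<Otimes>\<^sub>M N)" for F :: "_ \<Rightarrow> ennreal"
      using measurable_compose[OF measurable_Pair2'[OF z, of "borel_vec n"] that] .
    have gm: "(\<lambda>x. ennreal (gaussian_density P (x - h z))) \<in> borel_measurable (borel_vec n)"
      using hz by (intro measurable_compose[OF _ measurable_ennreal] measurable_gaussian_density[OF P]
          measurable_minus_vec measurable_ident_sets[OF refl] measurable_const) auto
    have "(\<integral>\<^sup>+e. indicator U (e + h z, z) \<partial>?gP) = (\<integral>\<^sup>+e. ennreal (gaussian_density P e) * indicator U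
        (e + h z, z) \<partial>lborel_vec n)"
      using sec[OF ish] by (intro nn_integral_gaussian_measure[OF P]) simp
    also have "\<dots> = (\<integral>\<^sup>+e. ennreal (gaussian_density P (e + h z - h z)) * indicator U (e + h z, z) \<partial>lborel_vec n)"
    proof (rule nn_integral_cong)
      fix e assume "e \<in> space (lborel_vec n)"
      then have "e + h z - h z = e" using hz by (intro eq_vecI) auto
      then show "ennreal (gaussian_density P e) * indicator U (e + h z, z) = ennreal
          (gaussian_density P (e + h z - h z)) * indicator U (e + h z, z)" by simp
    qed
    also have "\<dots> = (\<integral>\<^sup>+x. ennreal (gaussian_density P (x - h z)) * indicator U (x, z) \<partial>lborel_vec n)"
      by (rule nn_integral_lborel_vec_translate[OF borel_measurable_times_ennreal[OF gm sec[OF iU]] hz])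
    also have "\<dots> = (\<integral>\<^sup>+x. ennreal (gaussian_density S x) * (?f (x, z) * indicator U (x, z)) \<partial>lborel_vec n)"
    proof (rule nn_integral_cong)
      fix x
      have p: "0 < gaussian_density P (x - h z)" "0 < gaussian_density S x" using gaussian_density_nonneg
          P S by auto
      then have "ennreal (gaussian_density S x) * ennreal
          (gaussian_density P (x - h z) / gaussian_density S x) = ennreal (gaussian_density P (x - h z))"
        by (subst ennreal_mult[symmetric]) auto
      then show "ennreal (gaussian_density P (x - h z)) * indicator U (x, z) = ennreal
          (gaussian_density S x) * (?f (x, z) * indicator U (x, z))"
        by (simp add: mult.assoc[symmetric])
    qed
    also have "\<dots> = (\<integral>\<^sup>+x. ?f (x, z) * indicator U (x, z) \<partial>?gS)"
      by (rule nn_integral_gaussian_measure[OF S, symmetric])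
          (rule sec[OF borel_measurable_times_ennreal[OF fm iU]])
    finally show "(\<integral>\<^sup>+e. indicator U (e + h z, z) \<partial>?gP) = (\<integral>\<^sup>+x. ?f (x, z) * indicator U (x, z) \<partial>?gS)" .
  qed
  also have "\<dots> = (\<integral>\<^sup>+p. ?f p * indicator U p \<partial>?R)"
    using borel_measurable_times_ennreal[OF fm iU]
    by (intro R.nn_integral_snd) (simp only: measurable_cong_sets[OF sR refl])
  also have "\<dots> = emeasure (density ?R ?f) U" by (rule emeasure_density[OF fm', symmetric])
      (use U in \<open>simp only: sR\<close>)
  finally show "emeasure ?J U = emeasure (density ?R ?f) U" .
qed

text \<open>The divergence is the mean of the logarithm of \<open>N(X - h (Z); P) / N(X; S)\<close>. The two quadratic forms in
  the exponents both have mean \<open>n\<close> and cancel, which leaves the normalizing constants.\<close>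
lemma gaussian_error_mutual_information:
  assumes G: "gaussian_error n P X N Z h" and P: "pos_def n P" and S: "pos_def n S"
    and X: "distr M (borel_vec n) X = gaussian_measure n S"
  shows "mutual_information (exp 1) (borel_vec n) N X Z = (ln (det S) - ln (det P)) / 2"
proof -
  note g = gaussian_errorD[OF G]
  let ?gS = "gaussian_measure n S" and ?nu = "distr M N Z"
  interpret gS: prob_space ?gS by (rule prob_space_gaussian_measure[OF S])
  interpret nu: prob_space ?nu by (rule prob_space_distr[OF g(3)])
  interpret R: pair_prob_space ?gS ?nu ..
  define f where "f = (\<lambda>(x, z). gaussian_density P (x - h z) / gaussian_density S x)"
  let ?R = "?gS \<Otimes>\<^sub>M ?nu" and ?J = "distr M (borel_vec n \<Otimes>\<^sub>M N) (\<lambda>\<omega>. (X \<omega>, Z \<omega>))"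
  have sR: "sets ?R = sets (borel_vec n \<Otimes>\<^sub>M N)" by (intro sets_pair_measure_cong) auto
  have hs: "(\<lambda>p. h (snd p)) \<in> borel_vec n \<Otimes>\<^sub>M N \<rightarrow>\<^sub>M borel_vec n" using measurable_compose[OF measurable_snd g(2)] .
  have fm: "f \<in> borel_measurable (borel_vec n \<Otimes>\<^sub>M N)"
    unfolding split_beta f_def
    by (intro borel_measurable_divide measurable_gaussian_density[OF P]
        measurable_gaussian_density[OF S] measurable_minus_vec measurable_fst hs)
  have fm': "f \<in> borel_measurable ?R" using fm by (simp add: measurable_cong_sets[OF sR refl])
  have fpos: "0 < f p" for p unfolding f_def split_beta using gaussian_density_nonneg P S by
      (intro divide_pos_pos) auto
  have fnn: "0 \<le> f p" for p using fpos[of p] by simp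
  have XZ: "(\<lambda>\<omega>. (X \<omega>, Z \<omega>)) \<in> M \<rightarrow>\<^sub>M borel_vec n \<Otimes>\<^sub>M N" by (intro measurable_Pair g)
  have J: "?J = density ?R (\<lambda>p. ennreal (f p))"
    unfolding gaussian_error_joint_density[OF G P S] f_def case_prod_unfold ..
  have lnm: "(\<lambda>p. ln (f p)) \<in> borel_measurable (borel_vec n \<Otimes>\<^sub>M N)" using fm by measurable
  have lnm': "(\<lambda>p. ln (f p)) \<in> borel_measurable ?R" using lnm by (simp add: measurable_cong_sets[OF sR refl])
  have "mutual_information (exp 1) (borel_vec n) N X Z = KL_divergence (exp 1) ?R ?J"
    unfolding mutual_information_def X ..
  also have "\<dots> = (\<integral>p. f p * log (exp 1) (f p) \<partial>?R)"
    unfolding J by (intro R.KL_density fm' AE_I2 fnn) simp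
  also have "\<dots> = (\<integral>p. f p * ln (f p) \<partial>?R)" by (simp add: log_def)
  also have "\<dots> = (\<integral>p. ln (f p) \<partial>?J)"
    unfolding J using lnm' fm' by (subst integral_density) (auto intro!: AE_I2 fnn)
  also have "\<dots> = (\<integral>\<omega>. ln (f (X \<omega>, Z \<omega>)) \<partial>M)" by (rule integral_distr[OF XZ lnm])
  also have "\<dots> = (\<integral>\<omega>. (X \<omega> \<bullet> (matinv S *\<^sub>v X \<omega>)) / 2 - ((X \<omega> - h (Z \<omega>)) \<bullet> (matinv P *\<^sub>v (X \<omega> - h (Z \<omega>)))) / 2
      + (ln (det S) - ln (det P)) / 2 \<partial>M)"
  proof (rule Bochner_Integration.integral_cong[OF refl])
    fix \<omega>
    have "ln (f (X \<omega>, Z \<omega>)) = ln (gaussian_density P (X \<omega> - h (Z \<omega>))) - ln (gaussian_density S (X \<omega>))"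
      using gaussian_density_nonneg[OF P, of "X \<omega> - h (Z \<omega>)"] gaussian_density_nonneg[OF S, of "X \<omega>"]
      by (simp add: f_def ln_div)
    then show "ln (f (X \<omega>, Z \<omega>)) = (X \<omega> \<bullet> (matinv S *\<^sub>v X \<omega>)) / 2 -
        ((X \<omega> - h (Z \<omega>)) \<bullet> (matinv P *\<^sub>v (X \<omega> - h (Z \<omega>)))) / 2
      + (ln (det S) - ln (det P)) / 2"
      by (simp add: ln_gaussian_density[OF P] ln_gaussian_density[OF S] field_simps)
  qed
  also have "\<dots> = real n / 2 - real n / 2 + (ln (det S) - ln (det P)) / 2"
  proof -
    have "has_bochner_integral M (\<lambda>\<omega>. X \<omega> \<bullet> (matinv S *\<^sub>v X \<omega>) / 2) (real n / 2)"
      by (intro has_bochner_integral_divide_zero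
          has_bochner_integral_of_law[OF g(1) X gaussian_measure_mahalanobis[OF S]
              measurable_quadratic[OF pos_def_matinv(5)[OF S]]])
    moreover have "has_bochner_integral M (\<lambda>\<omega>. (X \<omega> - h (Z \<omega>)) \<bullet> (matinv P *\<^sub>v (X \<omega> - h (Z \<omega>))) / 2) (real n / 2)"
      by (intro has_bochner_integral_divide_zero
          has_bochner_integral_of_law[OF g(6,5) gaussian_measure_mahalanobis[OF P]
              measurable_quadratic[OF pos_def_matinv(5)[OF P]]])
    moreover have "has_bochner_integral M (\<lambda>\<omega>. (ln (det S) - ln (det P)) / 2) ((ln (det S) - ln (det P)) / 2)"
      by (simp add: has_bochner_integral_iff prob_space)
    ultimately show ?thesis
      by (intro has_bochner_integral_integral_eq[OF has_bochner_integral_add] has_bochner_integral_diff)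
  qed
  finally show ?thesis by simp
qed

text \<open>\<open>X\<close> and \<open>h (Z)\<close> have the same integral over every event determined by \<open>Z\<close>, because the error is
  centred and independent of the indicator of the event.\<close>
lemma gaussian_error_cond_exp:
  assumes G: "gaussian_error n P X N Z h" and P: "pos_def n P" and i: "i < n"
    and int: "integrable M (\<lambda>\<omega>. X \<omega> $ i)"
  shows "AE \<omega> in M. real_cond_exp M (vimage_algebra (space M) Z N) (\<lambda>\<omega>. X \<omega> $ i) \<omega> = h (Z \<omega>) $ i"
proof -
  note g = gaussian_errorD[OF G]
  let ?F = "vimage_algebra (space M) Z N"
  have Zs: "Z \<in> space M \<rightarrow> space N" using g(3) by (auto simp: measurable_def)
  have sF: "sets ?F = {Z -` B \<inter> space M |B. B \<in> sets N}" by (rule sets_vimage_algebra2[OF Zs])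
  have sub: "subalgebra M ?F" unfolding subalgebra_def sF using g(3) by (auto simp: measurable_sets)
  interpret finite_measure_subalgebra M ?F using sub by unfold_locales
  have ZF: "Z \<in> ?F \<rightarrow>\<^sub>M N" by (rule measurable_vimage_algebra1[OF Zs])
  have hi: "(\<lambda>z. h z $ i) \<in> borel_measurable N" by (rule measurable_vec_index'[OF g(2) i])
  have E: "has_bochner_integral M (\<lambda>\<omega>. (X \<omega> - h (Z \<omega>)) $ i) 0"
    by (rule has_bochner_integral_of_law[OF g(6,5) gaussian_measure_mean[OF P i] measurable_vec_index[OF i]])
  have Ei: "(X \<omega> - h (Z \<omega>)) $ i = X \<omega> $ i - h (Z \<omega>) $ i" if "\<omega> \<in> space M" for \<omega>
    using g(7,8)[OF that] i by auto
  have E': "has_bochner_integral M (\<lambda>\<omega>. X \<omega> $ i - h (Z \<omega>) $ i) 0"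
    by (rule has_bochner_integral_eqI[OF E Ei])
  have "integrable M (\<lambda>\<omega>. X \<omega> $ i - (X \<omega> $ i - h (Z \<omega>) $ i))"
    by (rule Bochner_Integration.integrable_diff[OF int conjunct1[OF E'[unfolded has_bochner_integral_iff]]])
  then have hint: "integrable M (\<lambda>\<omega>. h (Z \<omega>) $ i)" by (simp only: diff_diff_eq2 add_diff_cancel_left')
  show ?thesis
  proof (rule real_cond_exp_charact)
    show "integrable M (\<lambda>\<omega>. X \<omega> $ i)" "integrable M (\<lambda>\<omega>. h (Z \<omega>) $ i)" by fact+
    show "(\<lambda>\<omega>. h (Z \<omega>) $ i) \<in> borel_measurable ?F" by (rule measurable_compose[OF ZF hi])
    fix A assume "A \<in> sets ?F"
    then obtain B where B: "B \<in> sets N" "A = Z -` B \<inter> space M" by (auto simp: sF)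
    have A: "A \<in> sets M" using B g(3) by (auto simp: measurable_sets)
    have ind: "indep_pair borel ((\<lambda>v. v $ i) \<circ> (\<lambda>\<omega>. X \<omega> - h (Z \<omega>))) borel ((indicator B :: _ \<Rightarrow> real) \<circ> Z)"
      using B by (intro indep_pair_compose[OF g(4)] measurable_vec_index[OF i]) simp
    then have "indep_var borel ((\<lambda>v. v $ i) \<circ> (\<lambda>\<omega>. X \<omega> - h (Z \<omega>))) borel ((indicator B :: _ \<Rightarrow> real) \<circ> Z)"
      by (simp only: indep_pair_def indep_var_distribution_eq)
    then have iv: "indep_var borel (\<lambda>\<omega>. (X \<omega> - h (Z \<omega>)) $ i) borel (\<lambda>\<omega>. indicator B (Z \<omega>) :: real)" by
        (simp only: comp_def)
    have iB: "integrable M (\<lambda>\<omega>. indicator B (Z \<omega>) :: real)"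
      using B by (intro integrable_const_bound[where B=1] measurable_compose[OF g(3)]) (auto simp: indicator_def)
    have "(\<integral>\<omega>. (X \<omega> - h (Z \<omega>)) $ i * indicator B (Z \<omega>) \<partial>M) = 0"
      using indep_var_lebesgue_integral[OF iv _ iB] E by (simp add: has_bochner_integral_iff)
    moreover have "(\<integral>\<omega>. (X \<omega> - h (Z \<omega>)) $ i * indicator B (Z \<omega>) \<partial>M) =
        (\<integral>\<omega>. indicator A \<omega> *\<^sub>R X \<omega> $ i - indicator A \<omega> *\<^sub>R h (Z \<omega>) $ i \<partial>M)"
      by (rule Bochner_Integration.integral_cong) (auto simp: Ei B indicator_def)
    moreover have "\<dots> = (\<integral>\<omega>\<in>A. X \<omega> $ i \<partial>M) - (\<integral>\<omega>\<in>A. h (Z \<omega>) $ i \<partial>M)"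
      unfolding set_lebesgue_integral_def
      using integrable_mult_indicator[OF A int] integrable_mult_indicator[OF A hint] by simp
    ultimately show "(\<integral>\<omega>\<in>A. X \<omega> $ i \<partial>M) = (\<integral>\<omega>\<in>A. h (Z \<omega>) $ i \<partial>M)" by simp
  qed
qed

lemma gaussian_error_mean_square:
  assumes G: "gaussian_error n P X N Z h" and P: "pos_def n P"
    and int: "\<And>i. i < n \<Longrightarrow> integrable M (\<lambda>\<omega>. X \<omega> $ i)" and \<Theta>: "pos_semidef n \<Theta>"
  shows "(\<integral>\<omega>. (weighted_norm \<Theta> (X \<omega> - Matrix.vec n (\<lambda>i. real_cond_exp M (vimage_algebra (space M) Z N)
      (\<lambda>\<omega>'. X \<omega>' $ i) \<omega>)))\<^sup>2 \<partial>M)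
    = mtrace (\<Theta> * P)"
proof -
  note g = gaussian_errorD[OF G]
  let ?F = "vimage_algebra (space M) Z N"
  let ?c = "\<lambda>\<omega>. Matrix.vec n (\<lambda>i. real_cond_exp M ?F (\<lambda>\<omega>'. X \<omega>' $ i) \<omega>)"
  have th: "\<Theta> \<in> carrier_mat n n" using pos_semidef_dim[OF \<Theta>] by simp
  have cm: "?c \<in> M \<rightarrow>\<^sub>M borel_vec n"
    by (rule measurable_into_borel_vec) auto
  have sq: "(weighted_norm \<Theta> v)\<^sup>2 = v \<bullet> (\<Theta> *\<^sub>v v)" if "v \<in> carrier_vec n" for v
    unfolding weighted_norm_def using pos_semidef_nonneg[OF \<Theta> that] by simp
  have qm: "(\<lambda>\<omega>. Y \<omega> \<bullet> (\<Theta> *\<^sub>v Y \<omega>)) \<in> borel_measurable M" if "Y \<in> M \<rightarrow>\<^sub>M borel_vec n" for Y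
    using measurable_compose[OF that measurable_quadratic[OF th]] .
  have d: "(\<lambda>\<omega>. X \<omega> - ?c \<omega>) \<in> M \<rightarrow>\<^sub>M borel_vec n" by (intro measurable_minus_vec g cm)
  have "(\<integral>\<omega>. (weighted_norm \<Theta> (X \<omega> - ?c \<omega>))\<^sup>2 \<partial>M) = (\<integral>\<omega>. (X \<omega> - ?c \<omega>) \<bullet> (\<Theta> *\<^sub>v (X \<omega> - ?c \<omega>)) \<partial>M)"
    by (rule Bochner_Integration.integral_cong[OF refl]) (rule sq, rule measurable_borel_vec_carrier[OF d])
  also have "\<dots> = (\<integral>\<omega>. (X \<omega> - h (Z \<omega>)) \<bullet> (\<Theta> *\<^sub>v (X \<omega> - h (Z \<omega>))) \<partial>M)"
  proof (rule integral_cong_AE[OF qm[OF d] qm[OF g(6)]])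
    have "AE \<omega> in M. \<forall>i\<in>{..<n}. real_cond_exp M ?F (\<lambda>\<omega>. X \<omega> $ i) \<omega> = h (Z \<omega>) $ i"
      using gaussian_error_cond_exp[OF G P _ int] by (intro AE_finite_allI) auto
    moreover have "AE \<omega> in M. \<omega> \<in> space M" by simp
    ultimately show "AE \<omega> in M. (X \<omega> - ?c \<omega>) \<bullet> (\<Theta> *\<^sub>v (X \<omega> - ?c \<omega>)) = (X \<omega> - h (Z \<omega>)) \<bullet> (\<Theta> *\<^sub>v (X \<omega> - h (Z \<omega>)))"
    proof eventually_elim
      fix \<omega> assume *: "\<forall>i\<in>{..<n}. real_cond_exp M ?F (\<lambda>\<omega>. X \<omega> $ i) \<omega> = h (Z \<omega>) $ i" "\<omega> \<in> space M"
      then have "?c \<omega> = h (Z \<omega>)" using g(8)[of \<omega>] by (intro eq_vecI) auto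
      then show "(X \<omega> - ?c \<omega>) \<bullet> (\<Theta> *\<^sub>v (X \<omega> - ?c \<omega>)) = (X \<omega> - h (Z \<omega>)) \<bullet> (\<Theta> *\<^sub>v (X \<omega> - h (Z \<omega>)))" by simp
    qed
  qed
  also have "\<dots> = mtrace (\<Theta> * P)"
    by (rule has_bochner_integral_integral_eq, rule has_bochner_integral_of_law[OF g(6,5)
        gaussian_measure_quadratic[OF P th] measurable_quadratic[OF th]])
  finally show ?thesis .
qed

end

section \<open>The determinant maximization problem\<close>

context linear_observation
begin

lemma prior_minus_posterior_quadratic:
  assumes a: "a \<in> carrier_vec m"
  shows "a \<bullet> ((P - P') *\<^sub>v a) = (C *\<^sub>v (P *\<^sub>v a)) \<bullet> (matinv S *\<^sub>v (C *\<^sub>v (P *\<^sub>v a)))"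
proof -
  define c where "c = C *\<^sub>v (P *\<^sub>v a)"
  have dc: "dim_vec c = r" using dims by (simp add: c_def)
  have da: "dim_vec a = m" using a by simp
  have "(P - P') *\<^sub>v a = P *\<^sub>v a - P' *\<^sub>v a" using da dims' by (intro minus_mult_vec_dim) auto
  also have "P' *\<^sub>v a = P *\<^sub>v a - P *\<^sub>v (C\<^sup>T *\<^sub>v (matinv S *\<^sub>v c))"
    unfolding posterior_eq c_def using da dims' by (simp add: minus_mult_vec_dim mult_mat_vec_assoc_dim
        mult_assoc_dim)
  also have "P *\<^sub>v a - (P *\<^sub>v a - P *\<^sub>v (C\<^sup>T *\<^sub>v (matinv S *\<^sub>v c))) = P *\<^sub>v (C\<^sup>T *\<^sub>v (matinv S *\<^sub>v c))"
    using dims by (intro eq_vecI) auto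
  finally have "a \<bullet> ((P - P') *\<^sub>v a) = a \<bullet> (P *\<^sub>v (C\<^sup>T *\<^sub>v (matinv S *\<^sub>v c)))" by simp
  also have "\<dots> = (P *\<^sub>v a) \<bullet> (C\<^sup>T *\<^sub>v (matinv S *\<^sub>v c))"
    using transpose_scalar_dim[of P "C\<^sup>T *\<^sub>v (matinv S *\<^sub>v c)" a] dims da by simp
  also have "\<dots> = c \<bullet> (matinv S *\<^sub>v c)"
    using transpose_scalar_dim[of "C\<^sup>T" "matinv S *\<^sub>v c" "P *\<^sub>v a"] dims' by (simp add: c_def)
  finally show ?thesis unfolding c_def .
qed

abbreviation "lmi Q \<equiv> four_block_mat (P - Q) (P * C\<^sup>T) (C * P) (V + C * P * C\<^sup>T)"

text \<open>Completing the square in \<open>b\<close>. The Schur complement of \<open>S\<close> in the block matrix is \<open>P' - Q\<close>, so the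
  matrix inequality says exactly that \<open>Q\<close> is below the posterior covariance.\<close>
lemma lmi_quadratic:
  assumes Q: "Q \<in> carrier_mat m m" and a: "a \<in> carrier_vec m" and b: "b \<in> carrier_vec r"
  shows "(a @\<^sub>v b) \<bullet> (lmi Q *\<^sub>v (a @\<^sub>v b)) = a \<bullet> ((P' - Q) *\<^sub>v a) +
     (matinv S *\<^sub>v (C *\<^sub>v (P *\<^sub>v a)) + b) \<bullet> (S *\<^sub>v (matinv S *\<^sub>v (C *\<^sub>v (P *\<^sub>v a)) + b))"
proof -
  define c where "c = C *\<^sub>v (P *\<^sub>v a)"
  have da: "dim_vec a = m" and db: "dim_vec b = r" and dc: "dim_vec c = r" and dQ: "dim_row Q = m" "dim_col Q = m"
    using a b Q dims by (auto simp: c_def)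
  have VS: "V + C * P * C\<^sup>T = S" unfolding innovation_cov_def using dims by (intro add_comm_dim) auto
  have "lmi Q *\<^sub>v (a @\<^sub>v b) = ((P - Q) *\<^sub>v a + (P * C\<^sup>T) *\<^sub>v b) @\<^sub>v ((C * P) *\<^sub>v a + S *\<^sub>v b)"
    unfolding VS using pos_def_dim(4)[OF P] C pos_def_dim(4)[OF pos_def_innovation] Q a b
    by (intro four_block_mat_mult_vec[of _ m m _ r _ r]) (auto intro!: minus_carrier_mat)
  moreover have "(a @\<^sub>v b) \<bullet> (((P - Q) *\<^sub>v a + (P * C\<^sup>T) *\<^sub>v b) @\<^sub>v ((C * P) *\<^sub>v a + S *\<^sub>v b)) =
     a \<bullet> ((P - Q) *\<^sub>v a + (P * C\<^sup>T) *\<^sub>v b) + b \<bullet> ((C * P) *\<^sub>v a + S *\<^sub>v b)"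
    using a b dQ dims dims' by (intro scalar_prod_append[of _ m _ r] add_carrier_vec carrier_vecI) auto
  moreover have "a \<bullet> ((P - Q) *\<^sub>v a + (P * C\<^sup>T) *\<^sub>v b) = a \<bullet> ((P - Q) *\<^sub>v a) + c \<bullet> b"
  proof -
    have "a \<bullet> ((P * C\<^sup>T) *\<^sub>v b) = a \<bullet> (P *\<^sub>v (C\<^sup>T *\<^sub>v b))" using dims db by (simp add: mult_mat_vec_assoc_dim)
    also have "\<dots> = (P *\<^sub>v a) \<bullet> (C\<^sup>T *\<^sub>v b)" using transpose_scalar_dim[of P "C\<^sup>T *\<^sub>v b" a] dims da by simp
    also have "\<dots> = c \<bullet> b" using transpose_scalar_dim[of "C\<^sup>T" b "P *\<^sub>v a"] dims db by (simp add: c_def)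
    finally show ?thesis using da dims dQ by (simp add: scalar_add_right_dim)
  qed
  moreover have "b \<bullet> ((C * P) *\<^sub>v a + S *\<^sub>v b) = c \<bullet> b + b \<bullet> (S *\<^sub>v b)"
    using da db dims' scalar_comm_dim[of b c] dc by (simp add: scalar_add_right_dim mult_mat_vec_assoc_dim c_def)
  moreover have "a \<bullet> ((P - Q) *\<^sub>v a) = a \<bullet> ((P' - Q) *\<^sub>v a) + c \<bullet> (matinv S *\<^sub>v c)"
    using prior_minus_posterior_quadratic[OF a] da dQ dims'
    by (simp add: minus_mult_vec_dim scalar_minus_right_dim c_def)
  moreover have "(matinv S *\<^sub>v c + b) \<bullet> (S *\<^sub>v (matinv S *\<^sub>v c + b)) = c \<bullet> (matinv S *\<^sub>v c) + 2 * (c \<bullet> b)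
      + b \<bullet> (S *\<^sub>v b)"
  proof -
    have SS: "S *\<^sub>v (matinv S *\<^sub>v c) = c" by (rule pos_def_cancel(3)[OF pos_def_innovation dc])
    have 1: "(matinv S *\<^sub>v c) \<bullet> (S *\<^sub>v b) = c \<bullet> b"
      using transpose_scalar_dim[of S b "matinv S *\<^sub>v c"] dims' db SS by simp
    have 2: "(matinv S *\<^sub>v c) \<bullet> c = c \<bullet> (matinv S *\<^sub>v c)" "b \<bullet> c = c \<bullet> b"
      using scalar_comm_dim dims' dc db by auto
    show ?thesis using db dc dims'
      by (simp add: mult_vec_add_dim scalar_add_left_dim scalar_add_right_dim SS 1 2)
  qed
  ultimately show ?thesis unfolding c_def by simp
qed

lemma lmi_carrier: "Q \<in> carrier_mat m m \<Longrightarrow> lmi Q \<in> carrier_mat (m + r) (m + r)"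
  using pos_def_dim(4)[OF P] dims by (intro four_block_carrier_mat minus_carrier_mat) auto

lemma lmi_posterior: "pos_semidef (m + r) (lmi P')"
  unfolding pos_semidef_def
proof (intro conjI ballI)
  show "lmi P' \<in> carrier_mat (m + r) (m + r)" by (rule lmi_carrier[OF pos_def_dim(4)[OF pos_def_posterior]])
  have "(lmi P')\<^sup>T = four_block_mat (P - P')\<^sup>T (C * P)\<^sup>T (P * C\<^sup>T)\<^sup>T (V + C * P * C\<^sup>T)\<^sup>T"
    using dims' by (intro transpose_four_block_mat[of _ m m _ r _ r] carrier_matI) auto
  also have "\<dots> = lmi P'" using dims' by (simp add: transpose_mult_dim transpose_add_dim
      transpose_minus_dim mult_assoc_dim)
  finally show "(lmi P')\<^sup>T = lmi P'" .
  fix v :: "real Matrix.vec" assume v: "v \<in> carrier_vec (m + r)"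
  define a b where "a = vec_first v m" and "b = vec_last v r"
  have ab: "v = a @\<^sub>v b" "a \<in> carrier_vec m" "b \<in> carrier_vec r" using v by (auto simp: a_def b_def)
  have P'c: "P' \<in> carrier_mat m m" by (rule pos_def_dim(4)[OF pos_def_posterior])
  have z: "a \<bullet> ((P' - P') *\<^sub>v a) = 0"
    using ab(2) dims' by (simp add: minus_mult_vec_dim scalar_minus_right_dim)
  show "0 \<le> v \<bullet> (lmi P' *\<^sub>v v)"
    unfolding ab(1) lmi_quadratic[OF P'c ab(2,3)] z using ab dims'
    by (intro add_nonneg_nonneg pos_semidef_nonneg[OF pos_def_imp_pos_semidef[OF pos_def_innovation]])
        (auto intro!: carrier_vecI)
qed

lemma lmi_imp_le_posterior:
  assumes Q: "Q \<in> carrier_mat m m" "Q\<^sup>T = Q" and lmi: "pos_semidef (m + r) (lmi Q)"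
  shows "pos_semidef m (P' - Q)"
  unfolding pos_semidef_def
proof (intro conjI ballI)
  show "P' - Q \<in> carrier_mat m m" using Q(1) by (rule minus_carrier_mat)
  show "(P' - Q)\<^sup>T = P' - Q" using Q dims' by (simp add: transpose_minus_dim)
  fix a :: "real Matrix.vec" assume a: "a \<in> carrier_vec m"
  \<comment> \<open>At \<open>b = - d\<close> the square in \<open>lmi_quadratic\<close> vanishes.\<close>
  define d where "d = matinv S *\<^sub>v (C *\<^sub>v (P *\<^sub>v a))"
  have d: "d \<in> carrier_vec r" using dims' by (simp add: d_def carrier_dim_vec)
  have "0 \<le> (a @\<^sub>v (- d)) \<bullet> (lmi Q *\<^sub>v (a @\<^sub>v (- d)))" using a d by (intro pos_semidef_nonneg[OF lmi]) auto
  also have "\<dots> = a \<bullet> ((P' - Q) *\<^sub>v a) + (d + - d) \<bullet> (S *\<^sub>v (d + - d))"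
    using lmi_quadratic[OF Q(1) a, of "- d"] d by (simp add: d_def)
  also have "d + - d = 0\<^sub>v r" using d by (intro eq_vecI) auto
  also have "0\<^sub>v r \<bullet> (S *\<^sub>v 0\<^sub>v r) = 0" using dims' by (simp add: scalar_prod_def)
  finally show "0 \<le> a \<bullet> ((P' - Q) *\<^sub>v a)" by simp
qed

end

text \<open>The upper left block alone. For a feasible point this is where positive definiteness of \<open>P\<close> comes
  from.\<close>
lemma lmi_imp_le_prior:
  assumes Pc: "P \<in> carrier_mat m m" "P\<^sup>T = P" and Q: "Q \<in> carrier_mat m m" "Q\<^sup>T = Q" and C: "C \<in> carrier_mat r m"
    and V: "V \<in> carrier_mat r r"
    and lmi: "pos_semidef (m + r) (four_block_mat (P - Q) (P * C\<^sup>T) (C * P) (V + C * P * C\<^sup>T))"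
  shows "pos_semidef m (P - Q)"
  unfolding pos_semidef_def
proof (intro conjI ballI)
  show "P - Q \<in> carrier_mat m m" using Q(1) by (rule minus_carrier_mat)
  show "(P - Q)\<^sup>T = P - Q" using Q Pc by (simp add: transpose_minus_dim)
  fix a :: "real Matrix.vec" assume a: "a \<in> carrier_vec m"
  let ?L = "four_block_mat (P - Q) (P * C\<^sup>T) (C * P) (V + C * P * C\<^sup>T)"
  have "?L *\<^sub>v (a @\<^sub>v 0\<^sub>v r) = ((P - Q) *\<^sub>v a + (P * C\<^sup>T) *\<^sub>v 0\<^sub>v r) @\<^sub>v
      ((C * P) *\<^sub>v a + (V + C * P * C\<^sup>T) *\<^sub>v 0\<^sub>v r)"
    using Pc Q C V a by (intro four_block_mat_mult_vec[of _ m m _ r _ r]) (auto intro!: minus_carrier_mat)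
  then have "(a @\<^sub>v 0\<^sub>v r) \<bullet> (?L *\<^sub>v (a @\<^sub>v 0\<^sub>v r)) = a \<bullet> ((P - Q) *\<^sub>v a + (P * C\<^sup>T) *\<^sub>v 0\<^sub>v r) + 0\<^sub>v r \<bullet>
      ((C * P) *\<^sub>v a + (V + C * P * C\<^sup>T) *\<^sub>v 0\<^sub>v r)"
    using Pc Q C V a by (simp only:) (intro scalar_prod_append[of _ m _ r] add_carrier_vec carrier_vecI, auto)
  also have "(P * C\<^sup>T) *\<^sub>v 0\<^sub>v r = 0\<^sub>v m" using Pc C by (intro eq_vecI) (auto simp: scalar_prod_def)
  also have "a \<bullet> ((P - Q) *\<^sub>v a + 0\<^sub>v m) = a \<bullet> ((P - Q) *\<^sub>v a)" using a Q Pc by (simp add: scalar_add_right_dim)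
  finally have "(a @\<^sub>v 0\<^sub>v r) \<bullet> (?L *\<^sub>v (a @\<^sub>v 0\<^sub>v r)) = a \<bullet> ((P - Q) *\<^sub>v a)" using C V Pc by
      (simp add: scalar_prod_def)
  then show "0 \<le> a \<bullet> ((P - Q) *\<^sub>v a)" using pos_semidef_nonneg[OF lmi, of "a @\<^sub>v 0\<^sub>v r"] a by simp
qed

text \<open>The error covariances of the Kalman filter: a time update followed by a measurement update.\<close>
primrec kalman_cov :: "(nat \<Rightarrow> real mat) \<Rightarrow> (nat \<Rightarrow> real mat) \<Rightarrow> real mat \<Rightarrow> sensor \<Rightarrow> nat \<Rightarrow> real mat" where
  "kalman_cov A W P0 s 0 = P0"
| "kalman_cov A W P0 s (Suc t) =
     posterior_cov (A t * kalman_cov A W P0 s t * (A t)\<^sup>T + W t) (scov s (Suc t)) (sgain s (Suc t))"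

text \<open>The transition \<open>x\<^bsub>t+1\<^esub> = A\<^sub>t x\<^sub>t + w\<^sub>t\<close> is read as an observation of \<open>x\<^sub>t\<close> by its successor, and the matrix
  is the resulting posterior covariance. It is the largest \<open>\<Pi>\<^sub>t\<close> that the matrix inequality allows; at
  the horizon, where no successor exists, the constraint is \<open>\<Pi>\<^sub>T = P\<^sub>T\<close>.\<close>
definition smoothed_cov :: "nat \<Rightarrow> (nat \<Rightarrow> real mat) \<Rightarrow> (nat \<Rightarrow> real mat) \<Rightarrow> (nat \<Rightarrow> real mat) \<Rightarrow> nat \<Rightarrow> real mat" where
  "smoothed_cov T A W P t = (if t < T then posterior_cov (P t) (W t) (A t) else P t)"

locale gauss_markov_data =
  fixes T :: nat and n :: "nat \<Rightarrow> nat" and A W :: "nat \<Rightarrow> real mat" and P0 :: "real mat"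
  assumes T: "1 \<le> T"
    and A: "\<And>t. t < T \<Longrightarrow> A t \<in> carrier_mat (n (Suc t)) (n t)"
    and P0: "pos_def (n 0) P0"
    and W: "\<And>t. t < T \<Longrightarrow> pos_def (n (Suc t)) (W t)"
begin

lemma predicted_linear_observation: "t < T \<Longrightarrow> pos_def (n t) (P t) \<Longrightarrow> linear_observation (n t) (n (Suc t))
    (P t) (W t) (A t)"
  using A W by unfold_locales auto

lemma predicted_eq_innovation: "predicted_cov A W P t = innovation_cov (P t) (W t) (A t)"
  by (simp add: predicted_cov_def innovation_cov_def)

lemma pos_def_predicted: "t < T \<Longrightarrow> pos_def (n t) (P t) \<Longrightarrow> pos_def (n (Suc t)) (predicted_cov A W P t)"
  unfolding predicted_eq_innovation by (rule linear_observation.pos_def_innovation[OF predicted_linear_observation])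

lemma pos_def_smoothed:
  assumes "t \<le> T" "pos_def (n t) (P t)" shows "pos_def (n t) (smoothed_cov T A W P t)"
  unfolding smoothed_cov_def using assms linear_observation.pos_def_posterior[OF
      predicted_linear_observation] by auto

lemma kalman_cov_Suc:
  "kalman_cov A W P0 s (Suc t) = posterior_cov (predicted_cov A W (kalman_cov A W P0 s) t)
      (scov s (Suc t)) (sgain s (Suc t))"
  by (simp add: predicted_cov_def)

lemma kalman_linear_observation:
  assumes s: "admissible_sensor T n s" and t: "t < T" and P: "pos_def (n t) (kalman_cov A W P0 s t)"
  shows "linear_observation (n (Suc t)) (sdim s (Suc t)) (predicted_cov A W (kalman_cov A W P0 s) t)
      (scov s (Suc t)) (sgain s (Suc t))"
  using s t pos_def_predicted[where P="kalman_cov A W P0 s", OF t P] by (intro linear_observation.intro)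
      (auto simp: admissible_sensor_def)

lemma pos_def_kalman:
  assumes s: "admissible_sensor T n s"
  shows "t \<le> T \<Longrightarrow> pos_def (n t) (kalman_cov A W P0 s t)"
proof (induction t)
  case 0
  then show ?case using P0 by simp
next
  case (Suc t)
  then show ?case unfolding kalman_cov_Suc
    using linear_observation.pos_def_posterior[OF kalman_linear_observation[OF s]] by simp
qed

lemma kalman_maxdet_feasible:
  assumes s: "admissible_sensor T n s" and D: "\<And>t. t \<in> {1..T} \<Longrightarrow> mtrace (\<Theta> t * kalman_cov A W P0 s t) \<le> D t"
  shows "maxdet_feasible T n A W P0 \<Theta> D (kalman_cov A W P0 s) (smoothed_cov T A W (kalman_cov A W P0 s))"
proof -
  let ?K = "kalman_cov A W P0 s"
  note pd = pos_def_kalman[OF s]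
  have "loewner_le (n (Suc t)) (?K (Suc t)) (predicted_cov A W ?K t)" if t: "t < T" for t
    unfolding loewner_le_def kalman_cov_Suc
    using linear_observation.posterior_le_prior[OF kalman_linear_observation[OF s t pd]] t by simp
  moreover have "pos_semidef (n t + n (Suc t)) (four_block_mat (?K t - smoothed_cov T A W ?K t)
      (?K t * (A t)\<^sup>T) (A t * ?K t)
      (W t + A t * ?K t * (A t)\<^sup>T))" if t: "t \<in> {1..<T}" for t
    using linear_observation.lmi_posterior[OF predicted_linear_observation[of t ?K]] t pd by
        (simp add: smoothed_cov_def)
  moreover have "pos_def (n t) (smoothed_cov T A W ?K t)" if "t \<in> {1..T}" for t
    using that pd by (intro pos_def_smoothed) auto
  moreover have "?K t \<in> carrier_mat (n t) (n t) \<and> (?K t)\<^sup>T = ?K t" if "t \<in> {1..T}" for t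
    using pos_def_dim[OF pd[of t]] that by auto
  ultimately show ?thesis unfolding maxdet_feasible_def using D by (auto simp: smoothed_cov_def)
qed

text \<open>For the transition at time \<open>t\<close>, \<open>det_posterior_innovation\<close> expresses the logarithm of the determinant
  of the smoothed covariance by those of \<open>P t\<close>, of \<open>W t\<close> and of the predicted covariance of the next
  state. Summed over \<open>t\<close>, the noise terms cancel against the constant of the objective, and the predicted
  covariances, shifted by one step, meet their posteriors.\<close>
lemma maxdet_objective_smoothed:
  assumes PP0: "P 0 = P0" and P: "\<And>t. t \<le> T \<Longrightarrow> pos_def (n t) (P t)"
  shows "maxdet_objective T A W P0 (smoothed_cov T A W P) =
    (\<Sum>t=1..T. (ln (det (predicted_cov A W P (t - 1))) - ln (det (P t))) / 2)"
proof -
  obtain N where N: "T = Suc N" using T by (cases T) auto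
  let ?p = "\<lambda>t. ln (det (predicted_cov A W P t))" and ?q = "\<lambda>t. ln (det (P t))" and ?w = "\<lambda>t. ln (det (W t))"
  have q: "ln (det (smoothed_cov T A W P t)) = ?q t + ?w t - ?p t" if t: "t < T" for t
  proof -
    have Pt: "pos_def (n t) (P t)" using P t by simp
    interpret linear_observation "n t" "n (Suc t)" "P t" "W t" "A t" by
        (rule predicted_linear_observation[where P=P, OF t Pt])
    have "ln (det (P t) * det (W t)) = ln (det P' * det S)" unfolding det_posterior_innovation ..
    then have "?q t + ?w t = ln (det P') + ln (det S)"
      using det_pos_def[OF Pt] det_pos_def[OF W[OF t]] det_pos_def[OF pos_def_posterior]
          det_pos_def[OF pos_def_innovation]
      by (simp add: ln_mult)
    then show ?thesis using t by (simp add: smoothed_cov_def predicted_eq_innovation)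
  qed
  have "(\<Sum>t=1..T. ln (det (smoothed_cov T A W P t)) / 2) = (\<Sum>t=1..N. (?q t + ?w t - ?p t) / 2) + ?q T / 2"
  proof -
    have "(\<Sum>t=1..N. ln (det (smoothed_cov T A W P t)) / 2) = (\<Sum>t=1..N. (?q t + ?w t - ?p t) / 2)"
      using N by (intro sum.cong refl arg_cong2[of _ _ _ _ "(/)"] q) auto
    then show ?thesis by (simp add: N smoothed_cov_def)
  qed
  also have "\<dots> = (\<Sum>t=1..T. ?q t / 2) + (\<Sum>t=1..N. ?w t / 2) - (\<Sum>t=1..N. ?p t / 2)"
    unfolding N by (simp add: sum.distrib sum_subtractf add_divide_distrib diff_divide_distrib)
  finally have 1: "(\<Sum>t=1..T. ln (det (smoothed_cov T A W P t)) / 2) = (\<Sum>t=1..T. ?q t / 2) +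
      (\<Sum>t=1..N. ?w t / 2) - (\<Sum>t=1..N. ?p t / 2)" .
  have "(\<Sum>t=1..T. ?p (t - 1) / 2) = (\<Sum>t=0..N. ?p t / 2)"
    unfolding N by (rule sum.reindex_bij_witness[of _ Suc "\<lambda>t. t - 1"]) auto
  also have "\<dots> = ?p 0 / 2 + (\<Sum>t=1..N. ?p t / 2)" by (simp add: sum.atLeast_Suc_atMost)
  finally have 2: "(\<Sum>t=1..T. ?p (t - 1) / 2) = ?p 0 / 2 + (\<Sum>t=1..N. ?p t / 2)" .
  have "(\<Sum>t=1..T. (?p (t - 1) - ?q t) / 2) = (\<Sum>t=1..T. ?p (t - 1) / 2) - (\<Sum>t=1..T. ?q t / 2)"
    by (simp add: sum_subtractf diff_divide_distrib)
  then show ?thesis unfolding maxdet_objective_def 1 2 using N by (simp add: predicted_cov_def PP0)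
qed

lemma maxdet_feasible_pos_def:
  assumes F: "maxdet_feasible T n A W P0 \<Theta> D P Q" and t: "t \<le> T"
  shows "pos_def (n t) (P t)"
proof (cases "t = 0")
  case True
  then show ?thesis using F P0 by (simp add: maxdet_feasible_def)
next
  case False
  then have t1: "t \<in> {1..T}" using t by simp
  have Q: "pos_def (n t) (Q t)" and Pc: "P t \<in> carrier_mat (n t) (n t)" "(P t)\<^sup>T = P t" using F t1 by
      (auto simp: maxdet_feasible_def)
  show ?thesis
  proof (cases "t = T")
    case True
    then show ?thesis using F Q by (simp add: maxdet_feasible_def)
  next
    case False
    then have tT: "t < T" using t by simp
    have "pos_semidef (n t) (P t - Q t)"
      using F t1 tT pos_def_dim[OF Q] Pc
      by (intro lmi_imp_le_prior[OF _ _ _ _ A[OF tT] pos_def_dim(4)[OF W[OF tT]]]) (auto simp: maxdet_feasible_def)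
    from pos_def_add(1)[OF Q this] have "pos_def (n t) (Q t + (P t - Q t))" .
    also have "Q t + (P t - Q t) = P t" using Pc pos_def_dim(4)[OF Q] by (intro eq_matI) auto
    finally show ?thesis .
  qed
qed

lemma maxdet_feasible_le_smoothed:
  assumes F: "maxdet_feasible T n A W P0 \<Theta> D P Q" and t: "t \<in> {1..T}"
  shows "pos_semidef (n t) (smoothed_cov T A W P t - Q t)"
proof (cases "t < T")
  case True
  have Q: "pos_def (n t) (Q t)" using F t by (auto simp: maxdet_feasible_def)
  have Pt: "pos_def (n t) (P t)" using maxdet_feasible_pos_def[OF F] t by simp
  interpret linear_observation "n t" "n (Suc t)" "P t" "W t" "A t" by
      (rule predicted_linear_observation[where P=P, OF True Pt])
  show ?thesis
    using F t True pos_def_dim[OF Q] lmi_imp_le_posterior[of "Q t"] by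
        (simp add: smoothed_cov_def maxdet_feasible_def)
next
  case False
  then have tT: "t = T" using t by simp
  have Q: "pos_def (n t) (Q t)" "P t = Q t" using F t tT by (auto simp: maxdet_feasible_def)
  have "Q t - Q t = 0\<^sub>m (n t) (n t)" using pos_def_dim(4)[OF Q(1)] by (intro eq_matI) auto
  moreover have "pos_semidef (n t) (0\<^sub>m (n t) (n t))"
    unfolding pos_semidef_def by (auto simp: scalar_mult_mat_vec_sum[of _ "n t" "n t"])
  ultimately have "pos_semidef (n t) (Q t - Q t)" by simp
  then show ?thesis using False Q by (simp add: smoothed_cov_def)
qed

lemma maxdet_objective_smoothed_le:
  assumes F: "maxdet_feasible T n A W P0 \<Theta> D P Q"
  shows "maxdet_objective T A W P0 (smoothed_cov T A W P) \<le> maxdet_objective T A W P0 Q"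
proof -
  have "ln (det (Q t)) \<le> ln (det (smoothed_cov T A W P t))" if t: "t \<in> {1..T}" for t
  proof -
    have Q: "pos_def (n t) (Q t)" using F t by (auto simp: maxdet_feasible_def)
    have "pos_def (n t) (smoothed_cov T A W P t)" using t maxdet_feasible_pos_def[OF F] by
        (intro pos_def_smoothed) auto
    then show ?thesis
      using det_mono[OF Q _ maxdet_feasible_le_smoothed[OF F t]] det_pos_def[OF Q] det_pos_def
          pos_def_dim(4) by auto
  qed
  then have "(\<Sum>t=1..T. ln (det (Q t)) / 2) \<le> (\<Sum>t=1..T. ln (det (smoothed_cov T A W P t)) / 2)"
    by (intro sum_mono divide_right_mono) auto
  then show ?thesis unfolding maxdet_objective_def by simp
qed

lemma SNR_pos_semidef:
  assumes F: "maxdet_feasible T n A W P0 \<Theta> D P Q" and t: "t \<in> {1..T}"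
  shows "pos_semidef (n t) (SNR A W P t)"
proof -
  obtain u where u: "t = Suc u" using t by (cases t) auto
  then have uT: "u < T" using t by simp
  have "pos_semidef (n t) (predicted_cov A W P u - P t)"
    using F uT by (auto simp: maxdet_feasible_def loewner_le_def u)
  then show ?thesis unfolding SNR_def
    using loewner_inverse_antimono[OF maxdet_feasible_pos_def[OF F]
        pos_def_predicted[where P=P, OF uT maxdet_feasible_pos_def[OF F]]] t u by simp
qed

text \<open>In information form the measurement update adds the signal-to-noise ratio to the inverse of the
  predicted covariance, and by definition of the ratio the sum is the inverse of \<open>P t\<close>.\<close>
lemma kalman_cov_of_SNR:
  assumes F: "maxdet_feasible T n A W P0 \<Theta> D P Q"
    and snr: "\<And>t. t \<in> {1..T} \<Longrightarrow> (sgain s t)\<^sup>T * matinv (scov s t) * sgain s t = SNR A W P t"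
  shows "t \<le> T \<Longrightarrow> kalman_cov A W P0 s t = P t"
proof (induction t)
  case 0
  then show ?case using F by (simp add: maxdet_feasible_def)
next
  case (Suc t)
  then have IH: "kalman_cov A W P0 s t = P t" and tT: "t < T" by auto
  have P1: "pos_def (n (Suc t)) (P (Suc t))" using maxdet_feasible_pos_def[OF F] Suc by simp
  have R: "pos_def (n (Suc t)) (predicted_cov A W P t)" using
      pos_def_predicted[where P=P, OF tT maxdet_feasible_pos_def[OF F]] tT by simp
  have R': "predicted_cov A W (kalman_cov A W P0 s) t = predicted_cov A W P t" by (simp add: predicted_cov_def IH)
  have "kalman_cov A W P0 s (Suc t) = matinv (matinv (predicted_cov A W P t) + SNR A W P (Suc t))"
    unfolding kalman_cov_Suc posterior_cov_def R' using snr[of "Suc t"] Suc by simp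
  also have "matinv (predicted_cov A W P t) + SNR A W P (Suc t) = matinv (P (Suc t))"
    unfolding SNR_def using pos_def_matinv(3,4)[OF P1] pos_def_matinv(3,4)[OF R] by (intro eq_matI) auto
  also have "matinv \<dots> = P (Suc t)" by (rule matinv_matinv[OF P1])
  finally show ?case .
qed

end

section \<open>Sensors observing a Gauss-Markov source\<close>

lemma gaussian_law:
  assumes "gaussian M m S X"
  shows "X \<in> M \<rightarrow>\<^sub>M borel_vec m" "distr M (borel_vec m) X = gaussian_measure m S"
proof -
  have "X \<in> M \<rightarrow>\<^sub>M lborel_vec m" "distr M (lborel_vec m) X = gaussian_measure m S"
    using assms by (auto simp: gaussian_def distributed_def gaussian_measure_def)
  then show "X \<in> M \<rightarrow>\<^sub>M borel_vec m" "distr M (borel_vec m) X = gaussian_measure m S"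
    by (auto simp: measurable_cong_sets[OF refl sets_lborel_vec] intro: distr_cong[THEN trans, rotated -1])
qed

locale sensed_source = gauss_markov_data T n A W P0 + prob_space M
  for T n A W P0 and M :: "'a measure" +
  fixes x w :: "nat \<Rightarrow> 'a \<Rightarrow> real Matrix.vec" and s :: sensor and v :: "nat \<Rightarrow> 'a \<Rightarrow> real Matrix.vec"
  assumes source: "gauss_markov_source T n A W P0 M x w"
    and s: "admissible_sensor T n s"
    and noise: "sensor_noise T n M x w s v"
begin

abbreviation "driver \<equiv> case_sum (source_driver x w) v"
abbreviation "driver_space \<equiv> case_sum (\<lambda>k. borel_vec (n k)) (\<lambda>t. borel_vec (sdim s t))"
abbreviation "y \<equiv> measurement s x v"
abbreviation "K \<equiv> kalman_cov A W P0 s"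
abbreviation "state_error t P k \<equiv> gaussian_error (n t) P (x t) (history_space s k) (history y k)"

lemma dynamics: "t < T \<Longrightarrow> \<omega> \<in> space M \<Longrightarrow> x (Suc t) \<omega> = A t *\<^sub>v x t \<omega> + w t \<omega>"
  using source by (simp add: gauss_markov_source_def)

lemma sensor_dims: "t \<in> {1..T} \<Longrightarrow> sgain s t \<in> carrier_mat (sdim s t) (n t)" "t \<in> {1..T} \<Longrightarrow> pos_def
    (sdim s t) (scov s t)"
  using s by (auto simp: admissible_sensor_def)

text \<open>Independence of the driving variables passes to states and data because these are measurable functions
  of the drivers up to the present. The index set \<open>J\<close> is left open so that state and history can be
  functions of one common family.\<close>
lemma state_factors_through_drivers:
  "t \<le> T \<Longrightarrow> Inl ` {..t} \<subseteq> J \<Longrightarrow>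
    \<exists>F. F \<in> PiM J driver_space \<rightarrow>\<^sub>M borel_vec (n t) \<and> (\<forall>\<omega>\<in>space M. x t \<omega> = F (\<lambda>i\<in>J. driver i \<omega>))"
proof (induction t)
  case 0
  have "(\<lambda>\<psi>. \<psi> (Inl 0)) \<in> PiM J driver_space \<rightarrow>\<^sub>M driver_space (Inl 0)"
    using 0 by (intro measurable_component_singleton) auto
  moreover have "Inl 0 \<in> J" using 0 by auto
  ultimately show ?case
    by (intro exI[of _ "\<lambda>\<psi>. \<psi> (Inl 0)"]) (simp add: source_driver_def)
next
  case (Suc t)
  have "t \<le> T" "Inl ` {..t} \<subseteq> J" using Suc.prems by auto
  from Suc.IH[OF this] obtain F where F: "F \<in> PiM J driver_space \<rightarrow>\<^sub>M borel_vec (n t)" "\<forall>\<omega>\<in>space M. x t \<omega> =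
      F (\<lambda>i\<in>J. driver i \<omega>)"
    by blast
  have J: "Inl (Suc t) \<in> J" using Suc by auto
  have "(\<lambda>\<psi>. \<psi> (Inl (Suc t))) \<in> PiM J driver_space \<rightarrow>\<^sub>M driver_space (Inl (Suc t))"
    using J by (rule measurable_component_singleton)
  then have "(\<lambda>\<psi>. \<psi> (Inl (Suc t))) \<in> PiM J driver_space \<rightarrow>\<^sub>M borel_vec (n (Suc t))" by (simp only: sum.case)
  then have "(\<lambda>\<psi>. A t *\<^sub>v F \<psi> + \<psi> (Inl (Suc t))) \<in> PiM J driver_space \<rightarrow>\<^sub>M borel_vec (n (Suc t))"
    using A[of t] Suc.prems(1) F(1) by (intro measurable_add_vec measurable_mult_mat_vec[of _ _ "n t"]) simp_all
  moreover have "\<forall>\<omega>\<in>space M. x (Suc t) \<omega> = A t *\<^sub>v F (\<lambda>i\<in>J. driver i \<omega>) + (\<lambda>i\<in>J. driver i \<omega>) (Inl (Suc t))"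
    using dynamics[of t] Suc.prems(1) F(2) J by (simp add: source_driver_def)
  ultimately show ?case by (intro exI[of _ "\<lambda>\<psi>. A t *\<^sub>v F \<psi> + \<psi> (Inl (Suc t))"] conjI)
qed

lemma history_factors_through_drivers:
  assumes k: "k \<le> T" and J: "Inl ` {..k} \<union> Inr ` {1..k} \<subseteq> J"
  shows "\<exists>G. G \<in> PiM J driver_space \<rightarrow>\<^sub>M history_space s k \<and> (\<forall>\<omega>\<in>space M. history y k \<omega> = G (\<lambda>i\<in>J. driver i \<omega>))"
proof -
  have "\<forall>i\<in>{1..k}. \<exists>F. F \<in> PiM J driver_space \<rightarrow>\<^sub>M borel_vec (n i) \<and> (\<forall>\<omega>\<in>space M. x i \<omega> = F (\<lambda>i\<in>J. driver i \<omega>))"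
  proof
    fix i assume "i \<in> {1..k}"
    then have "i \<le> T" "Inl ` {..i} \<subseteq> J" using k J by auto
    then show "\<exists>F. F \<in> PiM J driver_space \<rightarrow>\<^sub>M borel_vec (n i) \<and> (\<forall>\<omega>\<in>space M. x i \<omega> = F (\<lambda>i\<in>J. driver i \<omega>))"
      by (rule state_factors_through_drivers)
  qed
  from bchoice[OF this] obtain F where "\<forall>i\<in>{1..k}. F i \<in> PiM J driver_space \<rightarrow>\<^sub>M borel_vec (n i) \<and>
      (\<forall>\<omega>\<in>space M. x i \<omega> = F i (\<lambda>i\<in>J. driver i \<omega>))" by blast
  then have F: "\<And>i. i \<in> {1..k} \<Longrightarrow> F i \<in> PiM J driver_space \<rightarrow>\<^sub>M borel_vec (n i)"
    "\<And>i \<omega>. i \<in> {1..k} \<Longrightarrow> \<omega> \<in> space M \<Longrightarrow> x i \<omega> = F i (\<lambda>i\<in>J. driver i \<omega>)"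
    by blast+
  define G where "G \<psi> = (\<lambda>i\<in>{1..k}. sgain s i *\<^sub>v F i \<psi> + \<psi> (Inr i))" for \<psi>
  have "G \<in> PiM J driver_space \<rightarrow>\<^sub>M history_space s k"
    unfolding G_def history_space_def
  proof (rule measurable_restrict)
    fix i assume i: "i \<in> {1..k}"
    then have "(\<lambda>\<psi>. \<psi> (Inr i)) \<in> PiM J driver_space \<rightarrow>\<^sub>M driver_space (Inr i)"
      using J by (intro measurable_component_singleton) auto
    then have "(\<lambda>\<psi>. \<psi> (Inr i)) \<in> PiM J driver_space \<rightarrow>\<^sub>M borel_vec (sdim s i)" by (simp only: sum.case)
    moreover have "sgain s i \<in> carrier_mat (sdim s i) (n i)" using sensor_dims(1)[of i] i k by simp
    ultimately show "(\<lambda>\<psi>. sgain s i *\<^sub>v F i \<psi> + \<psi> (Inr i)) \<in> PiM J driver_space \<rightarrow>\<^sub>M borel_vec (sdim s i)"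
      by (intro measurable_add_vec measurable_mult_mat_vec[of _ _ "n i"] F(1)[OF i])
  qed
  moreover have "history y k \<omega> = G (\<lambda>i\<in>J. driver i \<omega>)" if o: "\<omega> \<in> space M" for \<omega>
  proof (rule ext)
    fix i
    have "Inr i \<in> J" if "i \<in> {1..k}" using J that by auto
    then show "history y k \<omega> i = G (\<lambda>i\<in>J. driver i \<omega>) i"
      using F(2)[OF _ o] by (auto simp: history_def G_def measurement_def)
  qed
  ultimately show ?thesis by blast
qed

lemma indep_future_driver:
  assumes t: "t \<le> T" and k: "k \<le> t" and j: "j \<in> {..T} <+> {1..T}" "j \<notin> Inl ` {..t} \<union> Inr ` {1..k}"
  shows "indep_pair (borel_vec (n t) \<Otimes>\<^sub>M history_space s k) (\<lambda>\<omega>. (x t \<omega>, history y k \<omega>)) (driver_space j)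
      (driver j)"
proof -
  let ?J = "Inl ` {..t} \<union> Inr ` {1..k}"
  have ind: "indep_vars driver_space driver ({..T} <+> {1..T})"
    using noise by (simp add: sensor_noise_def)
  have "Inl ` {..t} \<subseteq> ?J" by blast
  from state_factors_through_drivers[OF t this]
  obtain F where F: "F \<in> PiM ?J driver_space \<rightarrow>\<^sub>M borel_vec (n t)" "\<forall>\<omega>\<in>space M. x t \<omega> = F (\<lambda>i\<in>?J. driver i \<omega>)"
    by blast
  have "Inl ` {..k} \<union> Inr ` {1..k} \<subseteq> ?J" using k by auto
  from history_factors_through_drivers[OF le_trans[OF k t] this]
  obtain G where G: "G \<in> PiM ?J driver_space \<rightarrow>\<^sub>M history_space s k" "\<forall>\<omega>\<in>space M. history y k \<omega> = G
      (\<lambda>i\<in>?J. driver i \<omega>)"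
    by blast
  have "indep_var (PiM ?J driver_space) (\<lambda>\<omega>. \<lambda>i\<in>?J. driver i \<omega>) (PiM {j} driver_space) (\<lambda>\<omega>. \<lambda>i\<in>{j}. driver i \<omega>)"
    using j t k by (intro indep_var_restrict[OF ind]) auto
  then have "indep_pair (PiM ?J driver_space) (\<lambda>\<omega>. \<lambda>i\<in>?J. driver i \<omega>) (PiM {j} driver_space)
      (\<lambda>\<omega>. \<lambda>i\<in>{j}. driver i \<omega>)"
    by (simp only: indep_var_distribution_eq indep_pair_def)
  then have "indep_pair (borel_vec (n t) \<Otimes>\<^sub>M history_space s k) ((\<lambda>\<psi>. (F \<psi>, G \<psi>)) \<circ> (\<lambda>\<omega>. \<lambda>i\<in>?J. driver i \<omega>))
     (driver_space j) ((\<lambda>\<psi>. \<psi> j) \<circ> (\<lambda>\<omega>. \<lambda>i\<in>{j}. driver i \<omega>))"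
    by (rule indep_pair_compose) (intro measurable_Pair F G, rule measurable_component_singleton, simp)
  then show ?thesis
    by (rule indep_pair_cong_space) (use F(2) G(2) in simp_all)
qed

lemma process_noise_law: "t < T \<Longrightarrow> distr M (borel_vec (n (Suc t))) (w t) = gaussian_measure (n (Suc t)) (W t)"
  using source by (intro gaussian_law) (auto simp: gauss_markov_source_def)

lemma sensor_noise_law: "t \<in> {1..T} \<Longrightarrow> distr M (borel_vec (sdim s t)) (v t) = gaussian_measure (sdim s t) (scov s t)"
  using noise by (intro gaussian_law) (auto simp: sensor_noise_def)

text \<open>Before the first measurement the history is constant, hence independent of everything.\<close>
lemma initial_gaussian_error:
  "state_error 0 P0 0 (\<lambda>_. 0\<^sub>v (n 0))"
proof -
  have x0: "gaussian M (n 0) P0 (x 0)" using source by (simp add: gauss_markov_source_def)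
  note law = gaussian_law[OF x0]
  \<comment> \<open>A function restricted to the empty index set is \<open>undefined\<close> everywhere.\<close>
  have h0: "history y 0 = (\<lambda>_ _. undefined)" by (auto simp: history_def fun_eq_iff)
  have sub: "x 0 \<omega> - 0\<^sub>v (n 0) = x 0 \<omega>" if "\<omega> \<in> space M" for \<omega>
    using measurable_borel_vec_carrier[OF law(1) that] by simp
  have ind: "indep_vars driver_space driver ({..T} <+> {1..T})"
    using noise by (simp add: sensor_noise_def)
  have "indep_var (PiM {Inl 0} driver_space) (\<lambda>\<omega>. \<lambda>i\<in>{Inl 0}. driver i \<omega>) (PiM {} driver_space)
      (\<lambda>\<omega>. \<lambda>i\<in>{}. driver i \<omega>)"
    by (intro indep_var_restrict[OF ind]) auto
  then have "indep_pair (PiM {Inl 0} driver_space) (\<lambda>\<omega>. \<lambda>i\<in>{Inl 0}. driver i \<omega>) (PiM {} driver_space)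
      (\<lambda>\<omega>. \<lambda>i\<in>{}. driver i \<omega>)"
    by (simp only: indep_var_distribution_eq indep_pair_def)
  then have "indep_pair (driver_space (Inl 0)) ((\<lambda>\<psi>. \<psi> (Inl 0)) \<circ> (\<lambda>\<omega>. \<lambda>i\<in>{Inl 0}. driver i \<omega>))
     (history_space s 0) ((\<lambda>_ _. undefined) \<circ> (\<lambda>\<omega>. \<lambda>i\<in>{}. driver i \<omega>))"
  proof (rule indep_pair_compose)
    show "(\<lambda>\<psi>. \<psi> (Inl 0)) \<in> PiM {Inl 0} driver_space \<rightarrow>\<^sub>M driver_space (Inl 0)"
      by (rule measurable_component_singleton) simp
    show "(\<lambda>_ _. undefined) \<in> PiM {} driver_space \<rightarrow>\<^sub>M history_space s 0"
      by (rule measurable_const) (simp add: history_space_def space_PiM)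
  qed
  then have "indep_pair (borel_vec (n 0)) (\<lambda>\<omega>. x 0 \<omega> - 0\<^sub>v (n 0)) (history_space s 0) (history y 0)"
    unfolding h0 sum.case
  proof (rule indep_pair_cong_space)
    fix \<omega> assume "\<omega> \<in> space M"
    then show "((\<lambda>\<psi>. \<psi> (Inl 0)) \<circ> (\<lambda>\<omega>. \<lambda>i\<in>{Inl 0}. driver i \<omega>)) \<omega> = x 0 \<omega> - 0\<^sub>v (n 0)"
      by (simp add: source_driver_def sub)
  qed simp
  moreover have "distr M (borel_vec (n 0)) (\<lambda>\<omega>. x 0 \<omega> - 0\<^sub>v (n 0)) = gaussian_measure (n 0) P0"
    unfolding law(2)[symmetric] by (intro distr_cong) (auto simp: sub)
  ultimately show ?thesis unfolding gaussian_error_def using law(1) by simp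
qed

lemma time_update:
  assumes t: "t < T" and k: "k \<le> t" and P: "pos_def (n t) P"
    and G: "state_error t P k h"
  shows "state_error (Suc t) (innovation_cov P (W t) (A t)) k (\<lambda>z. A t *\<^sub>v h z)"
proof (rule gaussian_error_time_update[OF G _ process_noise_law[OF t] P W[OF t] A[OF t] dynamics[OF t]])
  have "indep_pair (borel_vec (n t) \<Otimes>\<^sub>M history_space s k) (\<lambda>\<omega>. (x t \<omega>, history y k \<omega>))
      (driver_space (Inl (Suc t))) (driver (Inl (Suc t)))"
    using t k by (intro indep_future_driver) auto
  then show "indep_pair (borel_vec (n t) \<Otimes>\<^sub>M history_space s k) (\<lambda>\<omega>. (x t \<omega>, history y k \<omega>))
      (borel_vec (n (Suc t))) (w t)"
    by (simp add: source_driver_def)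
qed

text \<open>The time update with constant history: without measurements the estimate stays 0, so the state is
  its own error.\<close>
lemma state_law:
  "t \<le> T \<Longrightarrow> \<exists>S. pos_def (n t) S \<and> distr M (borel_vec (n t)) (x t) = gaussian_measure (n t) S"
proof -
  have "t \<le> T \<Longrightarrow> \<exists>S. pos_def (n t) S \<and> state_error t S 0 (\<lambda>_. 0\<^sub>v (n t))"
  proof (induction t)
    case 0
    then show ?case using initial_gaussian_error P0 by blast
  next
    case (Suc t)
    then obtain S where S: "pos_def (n t) S" and G: "state_error t S 0 (\<lambda>_. 0\<^sub>v (n t))"
      by auto
    have tT: "t < T" using Suc by simp
    have "A t *\<^sub>v 0\<^sub>v (n t) = 0\<^sub>v (n (Suc t))"
      using A[OF tT] by (intro eq_vecI) (auto simp: scalar_prod_def)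
    then have "state_error (Suc t) (innovation_cov S (W t) (A t)) 0 (\<lambda>_. 0\<^sub>v (n (Suc t)))"
      using time_update[OF tT _ S G] by simp
    moreover have "pos_def (n (Suc t)) (innovation_cov S (W t) (A t))"
      using linear_observation.pos_def_innovation[of "n t" "n (Suc t)" S "W t" "A t"] S W[OF tT] A[OF tT]
      by (simp add: linear_observation_def)
    ultimately show ?case by blast
  qed
  moreover assume "t \<le> T"
  ultimately obtain S where S: "pos_def (n t) S" and G: "state_error t S 0 (\<lambda>_. 0\<^sub>v (n t))"
    by auto
  have "distr M (borel_vec (n t)) (x t) = distr M (borel_vec (n t)) (\<lambda>\<omega>. x t \<omega> - 0\<^sub>v (n t))"
    using gaussian_errorD(7)[OF G] by (intro distr_cong) auto
  then show ?thesis using S gaussian_errorD(5)[OF G] by auto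
qed

lemma measurement_update:
  assumes t: "t < T"
    and G: "state_error t (K t) t h"
  shows "state_error (Suc t) (predicted_cov A W K t) t (\<lambda>z. A t *\<^sub>v h z)"
    "\<exists>h'. gaussian_error (n (Suc t)) (K (Suc t)) (x (Suc t)) (borel_vec (sdim s (Suc t)) \<Otimes>\<^sub>M history_space s t)
       (\<lambda>\<omega>. (y (Suc t) \<omega>, history y t \<omega>)) h'"
proof -
  have Kt: "pos_def (n t) (K t)" using pos_def_kalman[OF s] t by simp
  show 1: "state_error (Suc t) (predicted_cov A W K t) t (\<lambda>z. A t *\<^sub>v h z)"
    unfolding predicted_eq_innovation using time_update[OF t _ Kt G] by simp
  have "indep_pair (borel_vec (n (Suc t)) \<Otimes>\<^sub>M history_space s t) (\<lambda>\<omega>. (x (Suc t) \<omega>, history y t \<omega>))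
      (driver_space (Inr (Suc t))) (driver (Inr (Suc t)))"
    using t by (intro indep_future_driver) auto
  then have i: "indep_pair (borel_vec (n (Suc t)) \<Otimes>\<^sub>M history_space s t)
      (\<lambda>\<omega>. (x (Suc t) \<omega>, history y t \<omega>)) (borel_vec (sdim s (Suc t))) (v (Suc t))"
    by simp
  have t1: "Suc t \<in> {1..T}" using t by simp
  from gaussian_error_measurement_update[OF 1 i sensor_noise_law[OF t1]
      pos_def_predicted[where P=K, OF t Kt] sensor_dims(2,1)[OF t1]]
  show "\<exists>h'. gaussian_error (n (Suc t)) (K (Suc t)) (x (Suc t)) (borel_vec (sdim s (Suc t)) \<Otimes>\<^sub>M history_space s t)
       (\<lambda>\<omega>. (y (Suc t) \<omega>, history y t \<omega>)) h'"
    unfolding kalman_cov_Suc measurement_def by blast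
qed

text \<open>The measurement update has the data as a pair of new measurement and old history; a measurable
  map turns the pair into the next history, from which both parts can be read off again.\<close>
lemma kalman_filter:
  "t \<le> T \<Longrightarrow> \<exists>h. state_error t (K t) t h"
proof (induction t)
  case 0
  then show ?case using initial_gaussian_error by auto
next
  case (Suc t)
  then obtain h where "state_error t (K t) t h" by auto
  then obtain h' where G: "gaussian_error (n (Suc t)) (K (Suc t)) (x (Suc t))
      (borel_vec (sdim s (Suc t)) \<Otimes>\<^sub>M history_space s t)
       (\<lambda>\<omega>. (y (Suc t) \<omega>, history y t \<omega>)) h'"
    using measurement_update(2)[of t h] Suc by auto
  define f where "f p = (\<lambda>i\<in>{1..Suc t}. if i = Suc t then fst p else snd p i)" for p :: "real Matrix.vec \<times>
      (nat \<Rightarrow> real Matrix.vec)"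
  define h'' where "h'' H = h' (H (Suc t), restrict H {1..t})" for H
  have hs: "history_space s k = (\<Pi>\<^sub>M i\<in>{1..k}. borel_vec (sdim s i))" for k by (simp add: history_space_def)
  have fm: "f \<in> borel_vec (sdim s (Suc t)) \<Otimes>\<^sub>M history_space s t \<rightarrow>\<^sub>M history_space s (Suc t)"
    unfolding f_def hs[of "Suc t"]
  proof (rule measurable_restrict)
    fix i assume i: "i \<in> {1..Suc t}"
    show "(\<lambda>p. if i = Suc t then fst p else snd p i) \<in> borel_vec (sdim s (Suc t)) \<Otimes>\<^sub>M history_space s t
        \<rightarrow>\<^sub>M borel_vec (sdim s i)"
    proof (cases "i = Suc t")
      case True
      then show ?thesis by simp
    next
      case False
      then have "i \<in> {1..t}" using i by auto
      then have "(\<lambda>z. z i) \<in> history_space s t \<rightarrow>\<^sub>M borel_vec (sdim s i)"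
        unfolding hs by (rule measurable_component_singleton)
      from measurable_compose[OF measurable_snd this] False show ?thesis by simp
    qed
  qed
  have "(\<lambda>H. (H (Suc t), restrict H {1..t})) \<in> history_space s (Suc t) \<rightarrow>\<^sub>M borel_vec (sdim s (Suc t)) \<Otimes>\<^sub>M
      history_space s t"
  proof (rule measurable_Pair)
    show "(\<lambda>H. H (Suc t)) \<in> history_space s (Suc t) \<rightarrow>\<^sub>M borel_vec (sdim s (Suc t))"
      unfolding hs by (rule measurable_component_singleton) simp
    show "(\<lambda>H. restrict H {1..t}) \<in> history_space s (Suc t) \<rightarrow>\<^sub>M history_space s t"
      unfolding hs by (rule measurable_restrict_subset) auto
  qed
  then have hm: "h'' \<in> history_space s (Suc t) \<rightarrow>\<^sub>M borel_vec (n (Suc t))"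
    unfolding h''_def[abs_def] using gaussian_errorD(2)[OF G] by (rule measurable_compose)
  have "state_error (Suc t) (K (Suc t)) (Suc t) h''"
  proof (rule gaussian_error_reparam[OF G fm hm])
    fix \<omega>
    show "history y (Suc t) \<omega> = f (y (Suc t) \<omega>, history y t \<omega>)"
      by (auto simp: f_def history_def fun_eq_iff)
    have "history y (Suc t) \<omega> (Suc t) = y (Suc t) \<omega>" "restrict (history y (Suc t) \<omega>) {1..t} = history y t \<omega>"
      by (auto simp: history_def fun_eq_iff)
    then show "h'' (history y (Suc t) \<omega>) = h' (y (Suc t) \<omega>, history y t \<omega>)"
      by (simp add: h''_def)
  qed
  then show ?case by blast
qed

text \<open>Conditional mutual information is the information about \<open>x\<close> in measurement and history minus that in
  the history. The covariance of \<open>x\<close> itself cancels between the two.\<close>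
lemma conditional_mutual_information_step:
  assumes t: "t < T"
  shows "conditional_mutual_information (exp 1) (borel_vec (n (Suc t))) (borel_vec (sdim s (Suc t)))
      (history_space s t)
       (x (Suc t)) (y (Suc t)) (history y t) = (ln (det (predicted_cov A W K t)) - ln (det (K (Suc t)))) / 2"
proof -
  obtain h where "state_error t (K t) t h"
    using kalman_filter[of t] t by auto
  from measurement_update[OF t this] obtain h' where
    1: "state_error (Suc t) (predicted_cov A W K t) t (\<lambda>z. A t *\<^sub>v h z)" and
    2: "gaussian_error (n (Suc t)) (K (Suc t)) (x (Suc t)) (borel_vec (sdim s (Suc t)) \<Otimes>\<^sub>M history_space s t)
       (\<lambda>\<omega>. (y (Suc t) \<omega>, history y t \<omega>)) h'" by auto
  obtain S where S: "pos_def (n (Suc t)) S" "distr M (borel_vec (n (Suc t))) (x (Suc t)) =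
      gaussian_measure (n (Suc t)) S"
    using state_law[of "Suc t"] t by auto
  have Kt: "pos_def (n t) (K t)" and K1: "pos_def (n (Suc t)) (K (Suc t))"
    using pos_def_kalman[OF s, of t] pos_def_kalman[OF s, of "Suc t"] t by (simp_all del: kalman_cov.simps)
  show ?thesis
    unfolding conditional_mutual_information_def
      gaussian_error_mutual_information[OF 1 pos_def_predicted[where P=K, OF t Kt] S]
      gaussian_error_mutual_information[OF 2 K1 S]
    by (simp add: field_simps)
qed

lemma lgs_cost_eq: "lgs_cost T n M x s v = (\<Sum>t=1..T. (ln (det (predicted_cov A W K (t - 1))) - ln (det (K t))) / 2)"
  unfolding lgs_cost_def
proof (rule sum.cong[OF refl])
  fix t assume "t \<in> {1..T}"
  then obtain u where u: "t = Suc u" "u < T" by (cases t) auto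
  show "conditional_mutual_information (exp 1) (borel_vec (n t)) (borel_vec (sdim s t))
      (history_space s (t - 1)) (x t)
     (y t) (history y (t - 1)) = (ln (det (predicted_cov A W K (t - 1))) - ln (det (K t))) / 2"
    using conditional_mutual_information_step[OF u(2)] by (simp add: u)
qed

lemma estimation_error_eq:
  assumes t: "t \<in> {1..T}" and \<Theta>: "pos_semidef (n t) \<Theta>"
  shows "(\<integral>\<omega>. (weighted_norm \<Theta> (x t \<omega> - estimate n M x s v t \<omega>))\<^sup>2 \<partial>M) = mtrace (\<Theta> * K t)"
proof -
  obtain h where G: "state_error t (K t) t h"
    using kalman_filter[of t] t by auto
  obtain S where S: "pos_def (n t) S" "distr M (borel_vec (n t)) (x t) = gaussian_measure (n t) S"
    using state_law[of t] t by auto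
  have "integrable M (\<lambda>\<omega>. x t \<omega> $ i)" if i: "i < n t" for i
    using has_bochner_integral_of_law[OF gaussian_errorD(1)[OF G] S(2) gaussian_measure_mean[OF S(1) i]
        measurable_vec_index[OF i]]
    by (simp add: has_bochner_integral_iff)
  then show ?thesis
    unfolding estimate_def using gaussian_error_mean_square[OF G pos_def_kalman[OF s] _ \<Theta>] t by simp
qed

end

section \<open>Optimality of the constructed sensor\<close>

theorem theorem1:
  fixes T :: nat and n :: "nat \<Rightarrow> nat"
    and A W \<Theta> :: "nat \<Rightarrow> real mat" and P0 :: "real mat" and D :: "nat \<Rightarrow> real"
    and M :: "'a measure" and x w :: "nat \<Rightarrow> 'a \<Rightarrow> real Matrix.vec"
    and v :: "sensor \<Rightarrow> nat \<Rightarrow> 'a \<Rightarrow> real Matrix.vec"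
    and P Q :: "nat \<Rightarrow> real mat"
  assumes T: "1 \<le> T"
    and A: "\<And>t. t < T \<Longrightarrow> A t \<in> carrier_mat (n (Suc t)) (n t)"
    and P0: "pos_def (n 0) P0"
    and W: "\<And>t. t < T \<Longrightarrow> pos_def (n (Suc t)) (W t)"
    and \<Theta>: "\<And>t. t \<in> {1..T} \<Longrightarrow> pos_semidef (n t) (\<Theta> t)"
    and source: "gauss_markov_source T n A W P0 M x w"
    and noise: "\<And>s. admissible_sensor T n s \<Longrightarrow> sensor_noise T n M x w s (v s)"
    and optimal: "maxdet_optimal T n A W P0 \<Theta> D P Q"
  shows "(\<forall>t\<in>{1..T}. \<exists>r C V. C \<in> carrier_mat r (n t) \<and> pos_def r V \<and>
            C\<^sup>T * matinv V * C = SNR A W P t \<and>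
            C * C\<^sup>T = 1\<^sub>m r \<and> (\<forall>i<r. \<forall>j<r. i \<noteq> j \<longrightarrow> V $$ (i, j) = 0)) \<and>
         (\<forall>s. admissible_sensor T n s \<and>
            (\<forall>t\<in>{1..T}. (sgain s t)\<^sup>T * matinv (scov s t) * sgain s t = SNR A W P t) \<longrightarrow>
            lgs_optimal T n \<Theta> D M x v s)"
proof -
  interpret data: gauss_markov_data T n A W P0 using T A P0 W by unfold_locales
  have prob: "prob_space M" using source by (simp add: gauss_markov_source_def)
  have F: "maxdet_feasible T n A W P0 \<Theta> D P Q"
    and best: "\<And>P' Q'. maxdet_feasible T n A W P0 \<Theta> D P' Q' \<Longrightarrow> maxdet_objective T A W P0 Q \<le>
        maxdet_objective T A W P0 Q'"
    using optimal by (auto simp: maxdet_optimal_def)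
  have sensed: "sensed_source T n A W P0 M x w s (v s)" if "admissible_sensor T n s" for s
    using that noise[OF that] source prob data.gauss_markov_data_axioms
    by (simp add: sensed_source_def sensed_source_axioms_def)
  have error: "(\<integral>\<omega>. (weighted_norm (\<Theta> t) (x t \<omega> - estimate n M x s (v s) t \<omega>))\<^sup>2 \<partial>M) = mtrace
      (\<Theta> t * kalman_cov A W P0 s t)"
    if "admissible_sensor T n s" "t \<in> {1..T}" for s t
    by (rule sensed_source.estimation_error_eq[OF sensed[OF that(1)] that(2) \<Theta>[OF that(2)]])
  have cost: "lgs_cost T n M x s (v s) = maxdet_objective T A W P0 (smoothed_cov T A W (kalman_cov A W P0 s))"
    if s: "admissible_sensor T n s" for s
    unfolding sensed_source.lgs_cost_eq[OF sensed[OF s]]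
    by (rule data.maxdet_objective_smoothed[symmetric]) (use data.pos_def_kalman[OF s] in auto)
  show ?thesis
  proof (intro conjI ballI allI impI)
    fix t assume t: "t \<in> {1..T}"
    obtain r C V where "C \<in> carrier_mat r (n t)" "pos_def r V" "C\<^sup>T * matinv V * C = SNR A W P t" "C * C\<^sup>T = 1\<^sub>m r"
      "\<And>i j. i < r \<Longrightarrow> j < r \<Longrightarrow> i \<noteq> j \<Longrightarrow> V $$ (i, j) = 0"
      using pos_semidef_factorization[OF data.SNR_pos_semidef[OF F t]] by metis
    then show "\<exists>r C V. C \<in> carrier_mat r (n t) \<and> pos_def r V \<and> C\<^sup>T * matinv V * C = SNR A W P t \<and>
            C * C\<^sup>T = 1\<^sub>m r \<and> (\<forall>i<r. \<forall>j<r. i \<noteq> j \<longrightarrow> V $$ (i, j) = 0)" by blast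
  next
    fix s assume "admissible_sensor T n s \<and>
       (\<forall>t\<in>{1..T}. (sgain s t)\<^sup>T * matinv (scov s t) * sgain s t = SNR A W P t)"
    then have s: "admissible_sensor T n s"
      and snr: "\<And>t. t \<in> {1..T} \<Longrightarrow> (sgain s t)\<^sup>T * matinv (scov s t) * sgain s t = SNR A W P t" by auto
    have K: "kalman_cov A W P0 s t = P t" if "t \<le> T" for t
      using data.kalman_cov_of_SNR[OF F snr that] by simp
    have feas: "lgs_feasible T n \<Theta> D M x s (v s)"
      unfolding lgs_feasible_def using s error[OF s] K F by (auto simp: maxdet_feasible_def)
    have "(\<Sum>t=1..T. (ln (det (predicted_cov A W (kalman_cov A W P0 s) (t - 1))) - ln
        (det (kalman_cov A W P0 s t))) / 2)
        = (\<Sum>t=1..T. (ln (det (predicted_cov A W P (t - 1))) - ln (det (P t))) / 2)"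
      by (intro sum.cong) (auto simp: predicted_cov_def K)
    then have "lgs_cost T n M x s (v s) = maxdet_objective T A W P0 (smoothed_cov T A W P)"
      unfolding sensed_source.lgs_cost_eq[OF sensed[OF s]]
      using data.maxdet_objective_smoothed[of P] data.maxdet_feasible_pos_def[OF F] F by
          (simp add: maxdet_feasible_def)
    also have "\<dots> \<le> maxdet_objective T A W P0 Q" by (rule data.maxdet_objective_smoothed_le[OF F])
    finally have le: "lgs_cost T n M x s (v s) \<le> maxdet_objective T A W P0 Q" .
    show "lgs_optimal T n \<Theta> D M x v s"
      unfolding lgs_optimal_def
    proof (intro conjI allI impI feas)
      fix s' assume f: "lgs_feasible T n \<Theta> D M x s' (v s')"
      then have s': "admissible_sensor T n s'" by (simp add: lgs_feasible_def)
      have "maxdet_feasible T n A W P0 \<Theta> D (kalman_cov A W P0 s') (smoothed_cov T A W (kalman_cov A W P0 s'))"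
        using f error[OF s'] by (intro data.kalman_maxdet_feasible[OF s']) (auto simp: lgs_feasible_def)
      from best[OF this] show "lgs_cost T n M x s (v s) \<le> lgs_cost T n M x s' (v s')"
        using le cost[OF s'] by simp
    qed
  qed
qed

end
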